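(* Let $(G,\omega)$ be a connected symplectic Lie group and let $\pi:E\to M$ be a smooth fiber bundle with fiber $G$. Then $\pi:E\to M$ admits the structure of a symplectic Lie group bundle (that is, there exist Lie group structures on the fibers $E_p$ and a section $\widetilde{\omega}$ of $\wedge^2(\ker\pi_\ast)^\ast$ making $(G,\omega,E,\pi,M,\widetilde{\omega})$ a symplectic Lie group bundle) if and only if there exists a system of local trivializations $\{\psi_i:\pi^{-1}(U_i)\to U_i\times G\}$ for which all the transition functions take their values in the Lie group $\mathrm{Aut}(G,\omega)$.
   Context: A symplectic Lie group $(G,\omega)$ is a Lie group $G$ with a left-invariant symplectic form $\omega$. An isomorphism of symplectic Lie groups is a Lie group isomorphism pulling back the target symplectic form to the source symplectic form. $\mathrm{Aut}(G,\omega)=\{\varphi\in\mathrm{Aut}(G)\mid\varphi^\ast\omega=\omega\}$, where $\mathrm{Aut}(G)$ is the group of Lie group automorphisms of $G$. For $G$ connected, $\mathrm{Aut}(G)$ is a Lie group (Chevalley), its structure being obtained by identifying $\varphi$ with $\varphi_\ast\in\mathrm{Aut}(\mathfrak{g})\subset GL(\mathfrak{g})$, with closed image; $\mathrm{Aut}(G,\omega)$ is a closed Lie subgroup of it. The transition function $\phi_{ji}$ associated to $\psi_j\circ\psi_i^{-1}$ on $U_i\cap U_j$ is defined by $\phi_{ji}(p)=\psi_{j,p}\circ\psi_{i,p}^{-1}:G\to G$, where $\psi_{i,p}$ is the composition $E_p\xrightarrow{\psi_i}\{p\}\times G\cong G$. A symplectic Lie group bundle (SLGB) consists of data $(G,\omega,E,\pi,M,\widetilde{\omega})$,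 where (i) $(G,\omega)$ is a symplectic Lie group; (ii) $\pi:E\to M$ is a smooth fiber bundle with fiber $G$; (iii) $\widetilde{\omega}$ is a smooth section of $\wedge^2(\ker\pi_\ast)^\ast$; such that (a) for all $p\in M$ the fiber $E_p:=\pi^{-1}(p)$ has a Lie group structure (whose smooth structure is that of $E_p$ as an embedded submanifold of $E$); (b) for all $p\in M$, $\gamma_p^\ast\widetilde{\omega}$ is a left-invariant symplectic form on $E_p$, where $\gamma_p:T(E_p)\hookrightarrow\ker\pi_\ast$ is the inclusion; (c) there is a system of local trivializations $\{\psi_i:\pi^{-1}(U_i)\to U_i\times G\}$ such that for all $i$ and $p\in U_i$, $\psi_{i,p}:(E_p,\gamma_p^\ast\widetilde{\omega})\to(G,\omega)$ is an isomorphism of symplectic Lie groups. *)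

theory Defs
  imports "HOL-Analysis.Analysis" "HOL-Algebra.Group"
begin

section \<open>Model spaces and smooth maps between them\<close>

text \<open>
  Manifolds are modelled on finite-dimensional real inner product spaces, i.e. on
  Euclidean spaces in the usual sense. The class \<^class>\<open>euclidean_space\<close> would force
  the dimension to be positive; the class below also allows dimension 0, so that a one-point
  base and the trivial Lie group are covered.
\<close>

class model_space = real_inner +
  assumes finite_spanning: "\<exists>B. finite B \<and> (\<forall>x. \<exists>c. x = (\<Sum>b\<in>B. c b *\<^sub>R b))"

instance prod :: (model_space, model_space) model_space
proof
  obtain A :: "'a set" where A: "finite A" "\<And>x. \<exists>c. x = (\<Sum>b\<in>A. c b *\<^sub>R b)"
    using finite_spanning by blast
  obtain B :: "'b set" where B: "finite B" "\<And>x. \<exists>c. x = (\<Sum>b\<in>B. c b *\<^sub>R b)"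
    using finite_spanning by blast
  let ?f = "\<lambda>a. (a, 0::'b)" and ?g = "\<lambda>b. (0::'a, b)"
  let ?C = "?f ` A \<union> ?g ` B"
  have fin: "finite ?C" using A B by simp
  have "\<exists>c. z = (\<Sum>b\<in>?C. c b *\<^sub>R b)" for z :: "'a \<times> 'b"
  proof -
    have memA: "(a, 0) \<in> span ?C" if "a \<in> A" for a using that by (intro span_base) auto
    have memB: "(0, b) \<in> span ?C" if "b \<in> B" for b using that by (intro span_base) auto
    obtain x y where z: "z = (x, y)" by (cases z)
    obtain c d where c: "x = (\<Sum>b\<in>A. c b *\<^sub>R b)" and d: "y = (\<Sum>b\<in>B. d b *\<^sub>R b)"
      using A(2)[of x] B(2)[of y] by blast
    have "z = (\<Sum>b\<in>A. c b *\<^sub>R (b, 0)) + (\<Sum>b\<in>B. d b *\<^sub>R (0, b))"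
      by (rule prod_eqI) (simp_all add: z c d fst_sum snd_sum)
    also have "\<dots> \<in> span ?C"
      by (intro span_add span_sum span_scale memA memB)
    finally show ?thesis using fin by (simp add: span_finite image_iff)
  qed
  with fin show "\<exists>C::('a \<times> 'b) set. finite C \<and> (\<forall>x. \<exists>c. x = (\<Sum>b\<in>C. c b *\<^sub>R b))" by blast
qed

instance euclidean_space \<subseteq> model_space
proof
  show "\<exists>B. finite B \<and> (\<forall>x::'a. \<exists>c. x = (\<Sum>b\<in>B. c b *\<^sub>R b))"
    by (rule exI[of _ Basis]) (metis finite_Basis euclidean_representation)
qed

text \<open>
  All directional derivatives of order at most \<open>k\<close> are continuous and those of order less
  than \<open>k\<close> are (Frechet) differentiable. On an open subset of a finite-dimensional space
  this is \<open>C^k\<close>. It is only used for open \<open>S\<close>.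
\<close>

primrec Ck_on :: "nat \<Rightarrow> 'a::real_normed_vector set \<Rightarrow> ('a \<Rightarrow> 'b::real_normed_vector) \<Rightarrow> bool" where
  "Ck_on 0 S f \<longleftrightarrow> continuous_on S f"
| "Ck_on (Suc k) S f \<longleftrightarrow>
     (\<forall>x\<in>S. f differentiable (at x)) \<and> (\<forall>v. Ck_on k S (\<lambda>x. frechet_derivative f (at x) v))"

definition smooth_on :: "'a::real_normed_vector set \<Rightarrow> ('a \<Rightarrow> 'b::real_normed_vector) \<Rightarrow> bool" where
  "smooth_on S f \<longleftrightarrow> (\<forall>k. Ck_on k S f)"


section \<open>Smooth manifolds\<close>

text \<open>
  A chart is a pair \<open>(U, \<phi>)\<close> of an open set and a coordinate map; \<open>\<phi>\<close> is a total
  function, but only its values on \<open>U\<close> matter. The atlas of a manifold need not be maximal;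
  it represents the smooth structure it generates.
\<close>

type_synonym ('x, 'a) chart = "'x set \<times> ('x \<Rightarrow> 'a)"

record ('x, 'a) manifold =
  base_top :: "'x topology"
  atlas :: "('x, 'a) chart set"

abbreviation points :: "('x, 'a) manifold \<Rightarrow> 'x set" where
  "points X \<equiv> topspace (base_top X)"

definition chart_inv :: "('x, 'a) chart \<Rightarrow> 'a \<Rightarrow> 'x" where
  "chart_inv c = inv_into (fst c) (snd c)"

definition is_chart :: "'x topology \<Rightarrow> ('x, 'a::topological_space) chart \<Rightarrow> bool" where
  "is_chart T c \<longleftrightarrow> openin T (fst c) \<and> open (snd c ` fst c) \<and>
     homeomorphic_map (subtopology T (fst c)) (top_of_set (snd c ` fst c)) (snd c)"

definition smooth_manifold :: "('x, 'a::model_space) manifold \<Rightarrow> bool" where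
  "smooth_manifold X \<longleftrightarrow>
     Hausdorff_space (base_top X) \<and> second_countable (base_top X) \<and>
     (\<forall>c\<in>atlas X. is_chart (base_top X) c) \<and>
     (\<Union>c\<in>atlas X. fst c) = points X \<and>
     (\<forall>c\<in>atlas X. \<forall>d\<in>atlas X. smooth_on (snd c ` (fst c \<inter> fst d)) (snd d \<circ> chart_inv c))"

definition smooth_map ::
  "('x, 'a::model_space) manifold \<Rightarrow> ('y, 'b::model_space) manifold \<Rightarrow> ('x \<Rightarrow> 'y) \<Rightarrow> bool" where
  "smooth_map X Y f \<longleftrightarrow>
     continuous_map (base_top X) (base_top Y) f \<and>
     (\<forall>c\<in>atlas X. \<forall>d\<in>atlas Y.
        smooth_on (snd c ` (fst c \<inter> f -` fst d)) (snd d \<circ> f \<circ> chart_inv c))"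

definition diffeomorphism ::
  "('x, 'a::model_space) manifold \<Rightarrow> ('y, 'b::model_space) manifold \<Rightarrow> ('x \<Rightarrow> 'y) \<Rightarrow> bool" where
  "diffeomorphism X Y f \<longleftrightarrow>
     bij_betw f (points X) (points Y) \<and> smooth_map X Y f \<and>
     smooth_map Y X (inv_into (points X) f)"

definition open_submanifold :: "('x, 'a) manifold \<Rightarrow> 'x set \<Rightarrow> ('x, 'a) manifold" where
  "open_submanifold X W =
     \<lparr>base_top = subtopology (base_top X) W, atlas = (\<lambda>(U, \<phi>). (U \<inter> W, \<phi>)) ` atlas X\<rparr>"

definition product_manifold ::
  "('x, 'a) manifold \<Rightarrow> ('y, 'b) manifold \<Rightarrow> ('x \<times> 'y, 'a \<times> 'b) manifold" where
  "product_manifold X Y =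
     \<lparr>base_top = prod_topology (base_top X) (base_top Y),
      atlas = {(U \<times> V, map_prod \<phi> \<psi>) | U \<phi> V \<psi>. (U, \<phi>) \<in> atlas X \<and> (V, \<psi>) \<in> atlas Y}\<rparr>"


section \<open>Tangent vectors\<close>

text \<open>
  A tangent vector at \<open>p\<close> is the family of its coordinate vectors in the charts of the atlas
  around \<open>p\<close>, which transform by the derivative of the change of coordinates. It is set to 0
  on all other pairs, so that equality of tangent vectors is equality of functions. The vector
  space operations are pointwise.
\<close>

type_synonym ('x, 'a) tangent = "('x, 'a) chart \<Rightarrow> 'a"

definition charts_at :: "('x, 'a) manifold \<Rightarrow> 'x \<Rightarrow> ('x, 'a) chart set" where
  "charts_at X p = {c \<in> atlas X. p \<in> fst c}"

definition tangent_space ::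
  "('x, 'a::model_space) manifold \<Rightarrow> 'x \<Rightarrow> ('x, 'a) tangent set" where
  "tangent_space X p =
     {v. (\<forall>c\<in>charts_at X p. \<forall>d\<in>charts_at X p.
            v d = frechet_derivative (snd d \<circ> chart_inv c) (at (snd c p)) (v c)) \<and>
         (\<forall>c. c \<notin> charts_at X p \<longrightarrow> v c = 0)}"

text \<open>The tangent vector at \<open>p\<close> whose coordinate vector in the chart \<open>c\<close> is \<open>a\<close>.\<close>

definition coord_vector ::
  "('x, 'a::model_space) manifold \<Rightarrow> ('x, 'a) chart \<Rightarrow> 'x \<Rightarrow> 'a \<Rightarrow> ('x, 'a) tangent" where
  "coord_vector X c p a =
     (\<lambda>d. if d \<in> charts_at X p then frechet_derivative (snd d \<circ> chart_inv c) (at (snd c p)) a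
          else 0)"

text \<open>
  The differential of \<open>f\<close> at \<open>p\<close>. For a tangent vector \<open>v\<close> and a smooth \<open>f\<close> the
  result does not depend on the chart that is chosen around \<open>p\<close>.
\<close>

definition differential ::
  "('x, 'a::model_space) manifold \<Rightarrow> ('y, 'b::model_space) manifold \<Rightarrow> ('x \<Rightarrow> 'y) \<Rightarrow> 'x \<Rightarrow>
   ('x, 'a) tangent \<Rightarrow> ('y, 'b) tangent" where
  "differential X Y f p v =
     (let c = (SOME c. c \<in> charts_at X p) in
      (\<lambda>d. if d \<in> charts_at Y (f p)
           then frechet_derivative (snd d \<circ> f \<circ> chart_inv c) (at (snd c p)) (v c)
           else 0))"

text \<open>
  \<open>S\<close> is the manifold structure that its point set carries as an embedded submanifold of
  \<open>X\<close>: it has the subspace topology, and the inclusion is a smooth immersion.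
\<close>

definition embedded_submanifold ::
  "('x, 'a::model_space) manifold \<Rightarrow> ('x, 'b::model_space) manifold \<Rightarrow> bool" where
  "embedded_submanifold S X \<longleftrightarrow>
     smooth_manifold S \<and> points S \<subseteq> points X \<and>
     base_top S = subtopology (base_top X) (points S) \<and>
     smooth_map S X id \<and>
     (\<forall>p\<in>points S. inj_on (differential S X id p) (tangent_space S p))"


section \<open>Two-forms\<close>

definition smooth_vector_field_on ::
  "('x, 'a::model_space) manifold \<Rightarrow> 'x set \<Rightarrow> ('x \<Rightarrow> ('x, 'a) tangent) \<Rightarrow> bool" where
  "smooth_vector_field_on X W Y \<longleftrightarrow>
     (\<forall>p\<in>W. Y p \<in> tangent_space X p) \<and>
     (\<forall>c\<in>atlas X. smooth_on (snd c ` (fst c \<inter> W)) (\<lambda>x. Y (chart_inv c x) c))"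

definition smooth_function_on ::
  "('x, 'a::model_space) manifold \<Rightarrow> 'x set \<Rightarrow> ('x \<Rightarrow> real) \<Rightarrow> bool" where
  "smooth_function_on X W f \<longleftrightarrow>
     (\<forall>c\<in>atlas X. smooth_on (snd c ` (fst c \<inter> W)) (f \<circ> chart_inv c))"

type_synonym ('x, 'a) two_form = "'x \<Rightarrow> ('x, 'a) tangent \<Rightarrow> ('x, 'a) tangent \<Rightarrow> real"

definition alternating_bilinear ::
  "('x, 'a::model_space) tangent set \<Rightarrow>
   (('x, 'a) tangent \<Rightarrow> ('x, 'a) tangent \<Rightarrow> real) \<Rightarrow> bool" where
  "alternating_bilinear V b \<longleftrightarrow>
     (\<forall>u\<in>V. \<forall>v\<in>V. \<forall>w\<in>V. b (\<lambda>c. u c + v c) w = b u w + b v w) \<and>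
     (\<forall>u\<in>V. \<forall>v\<in>V. \<forall>w\<in>V. b w (\<lambda>c. u c + v c) = b w u + b w v) \<and>
     (\<forall>r. \<forall>u\<in>V. \<forall>v\<in>V. b (\<lambda>c. r *\<^sub>R u c) v = r * b u v) \<and>
     (\<forall>r. \<forall>u\<in>V. \<forall>v\<in>V. b u (\<lambda>c. r *\<^sub>R v c) = r * b u v) \<and>
     (\<forall>u\<in>V. b u u = 0)"

text \<open>
  Smooth sections of \<open>\<Lambda>^2 V^*\<close> for a subbundle \<open>V\<close> of the tangent bundle of \<open>X\<close>,
  given by its fibres: alternating bilinear forms on the fibres that take smooth values on
  local smooth sections of \<open>V\<close>. Values on vectors outside \<open>V p\<close> are irrelevant.
\<close>

definition smooth_section_Lambda2_dual ::
  "('x, 'a::model_space) manifold \<Rightarrow> ('x \<Rightarrow> ('x, 'a) tangent set) \<Rightarrow> ('x, 'a) two_form \<Rightarrow> bool" where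
  "smooth_section_Lambda2_dual X V \<omega> \<longleftrightarrow>
     (\<forall>p\<in>points X. alternating_bilinear (V p) (\<omega> p)) \<and>
     (\<forall>W Y Z. openin (base_top X) W \<and>
        smooth_vector_field_on X W Y \<and> (\<forall>p\<in>W. Y p \<in> V p) \<and>
        smooth_vector_field_on X W Z \<and> (\<forall>p\<in>W. Z p \<in> V p)
        \<longrightarrow> smooth_function_on X W (\<lambda>p. \<omega> p (Y p) (Z p)))"

abbreviation smooth_two_form :: "('x, 'a::model_space) manifold \<Rightarrow> ('x, 'a) two_form \<Rightarrow> bool" where
  "smooth_two_form X \<equiv> smooth_section_Lambda2_dual X (tangent_space X)"

definition local_form ::
  "('x, 'a::model_space) manifold \<Rightarrow> ('x, 'a) two_form \<Rightarrow> ('x, 'a) chart \<Rightarrow> 'a \<Rightarrow> 'a \<Rightarrow> 'a \<Rightarrow> real" where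
  "local_form X \<omega> c x a b =
     (let p = chart_inv c x in \<omega> p (coord_vector X c p a) (coord_vector X c p b))"

text \<open>
  The exterior derivative in a chart, evaluated on the (commuting) constant coordinate fields
  \<open>a\<close>, \<open>b\<close>, \<open>e\<close>.
\<close>

definition local_exterior_derivative ::
  "('x, 'a::model_space) manifold \<Rightarrow> ('x, 'a) two_form \<Rightarrow> ('x, 'a) chart \<Rightarrow>
   'a \<Rightarrow> 'a \<Rightarrow> 'a \<Rightarrow> 'a \<Rightarrow> real" where
  "local_exterior_derivative X \<omega> c x a b e =
     frechet_derivative (\<lambda>y. local_form X \<omega> c y b e) (at x) a
     - frechet_derivative (\<lambda>y. local_form X \<omega> c y a e) (at x) b
     + frechet_derivative (\<lambda>y. local_form X \<omega> c y a b) (at x) e"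

definition closed_two_form :: "('x, 'a::model_space) manifold \<Rightarrow> ('x, 'a) two_form \<Rightarrow> bool" where
  "closed_two_form X \<omega> \<longleftrightarrow>
     (\<forall>c\<in>atlas X. \<forall>x\<in>snd c ` fst c. \<forall>a b e. local_exterior_derivative X \<omega> c x a b e = 0)"

definition nondegenerate_two_form :: "('x, 'a::model_space) manifold \<Rightarrow> ('x, 'a) two_form \<Rightarrow> bool" where
  "nondegenerate_two_form X \<omega> \<longleftrightarrow>
     (\<forall>p\<in>points X. \<forall>u\<in>tangent_space X p.
        (\<forall>v\<in>tangent_space X p. \<omega> p u v = 0) \<longrightarrow> u = (\<lambda>c. 0))"

definition symplectic_form :: "('x, 'a::model_space) manifold \<Rightarrow> ('x, 'a) two_form \<Rightarrow> bool" where
  "symplectic_form X \<omega> \<longleftrightarrow>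
     smooth_two_form X \<omega> \<and> closed_two_form X \<omega> \<and> nondegenerate_two_form X \<omega>"

definition pullback ::
  "('x, 'a::model_space) manifold \<Rightarrow> ('y, 'b::model_space) manifold \<Rightarrow> ('x \<Rightarrow> 'y) \<Rightarrow>
   ('y, 'b) two_form \<Rightarrow> ('x, 'a) two_form" where
  "pullback X Y f \<omega> =
     (\<lambda>p u v. \<omega> (f p) (differential X Y f p u) (differential X Y f p v))"

definition equal_two_forms ::
  "('x, 'a::model_space) manifold \<Rightarrow> ('x, 'a) two_form \<Rightarrow> ('x, 'a) two_form \<Rightarrow> bool" where
  "equal_two_forms X \<alpha> \<beta> \<longleftrightarrow>
     (\<forall>p\<in>points X. \<forall>u\<in>tangent_space X p. \<forall>v\<in>tangent_space X p. \<alpha> p u v = \<beta> p u v)"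


section \<open>Symplectic Lie groups\<close>

record ('x, 'a) lie_group = "'x monoid" +
  mfd :: "('x, 'a) manifold"

definition is_lie_group :: "('x, 'a::model_space) lie_group \<Rightarrow> bool" where
  "is_lie_group G \<longleftrightarrow>
     group G \<and> smooth_manifold (mfd G) \<and> carrier G = points (mfd G) \<and>
     smooth_map (product_manifold (mfd G) (mfd G)) (mfd G) (\<lambda>(x, y). x \<otimes>\<^bsub>G\<^esub> y) \<and>
     smooth_map (mfd G) (mfd G) (\<lambda>x. inv\<^bsub>G\<^esub> x)"

definition left_invariant :: "('x, 'a::model_space) lie_group \<Rightarrow> ('x, 'a) two_form \<Rightarrow> bool" where
  "left_invariant G \<omega> \<longleftrightarrow>
     (\<forall>g\<in>carrier G.
        equal_two_forms (mfd G) (pullback (mfd G) (mfd G) (\<lambda>x. g \<otimes>\<^bsub>G\<^esub> x) \<omega>) \<omega>)"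

definition symplectic_lie_group :: "('x, 'a::model_space) lie_group \<Rightarrow> ('x, 'a) two_form \<Rightarrow> bool" where
  "symplectic_lie_group G \<omega> \<longleftrightarrow>
     is_lie_group G \<and> symplectic_form (mfd G) \<omega> \<and> left_invariant G \<omega>"

definition lie_group_isos ::
  "('x, 'a::model_space) lie_group \<Rightarrow> ('y, 'b::model_space) lie_group \<Rightarrow> ('x \<Rightarrow> 'y) set" where
  "lie_group_isos G H = {\<phi> \<in> iso G H. diffeomorphism (mfd G) (mfd H) \<phi>}"

definition symplectic_lie_group_isos ::
  "('x, 'a::model_space) lie_group \<Rightarrow> ('x, 'a) two_form \<Rightarrow>
   ('y, 'b::model_space) lie_group \<Rightarrow> ('y, 'b) two_form \<Rightarrow> ('x \<Rightarrow> 'y) set" where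
  "symplectic_lie_group_isos G \<alpha> H \<beta> =
     {\<phi> \<in> lie_group_isos G H.
        equal_two_forms (mfd G) (pullback (mfd G) (mfd H) \<phi> \<beta>) \<alpha>}"

definition Aut_lie_group :: "('x, 'a::model_space) lie_group \<Rightarrow> ('x \<Rightarrow> 'x) set" where
  "Aut_lie_group G = lie_group_isos G G"

definition Aut_symplectic ::
  "('x, 'a::model_space) lie_group \<Rightarrow> ('x, 'a) two_form \<Rightarrow> ('x \<Rightarrow> 'x) set" where
  "Aut_symplectic G \<omega> =
     {\<phi> \<in> Aut_lie_group G. equal_two_forms (mfd G) (pullback (mfd G) (mfd G) \<phi> \<omega>) \<omega>}"


section \<open>Smooth fiber bundles\<close>

definition fiber :: "('e, 'c) manifold \<Rightarrow> ('e \<Rightarrow> 'm) \<Rightarrow> 'm \<Rightarrow> 'e set" where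
  "fiber E \<pi> p = {x \<in> points E. \<pi> x = p}"

definition local_trivialization ::
  "('e, 'c::model_space) manifold \<Rightarrow> ('e \<Rightarrow> 'm) \<Rightarrow> ('m, 'b::model_space) manifold \<Rightarrow>
   ('g, 'a::model_space) manifold \<Rightarrow> 'm set \<Rightarrow> ('e \<Rightarrow> 'm \<times> 'g) \<Rightarrow> bool" where
  "local_trivialization E \<pi> M F U \<psi> \<longleftrightarrow>
     openin (base_top M) U \<and>
     diffeomorphism (open_submanifold E {x \<in> points E. \<pi> x \<in> U})
       (product_manifold (open_submanifold M U) F) \<psi> \<and>
     (\<forall>x\<in>points E. \<pi> x \<in> U \<longrightarrow> fst (\<psi> x) = \<pi> x)"

text \<open>A system of local trivializations is the set of its members \<open>(U_i, \<psi>_i)\<close>.\<close>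

definition trivialization_system ::
  "('e, 'c::model_space) manifold \<Rightarrow> ('e \<Rightarrow> 'm) \<Rightarrow> ('m, 'b::model_space) manifold \<Rightarrow>
   ('g, 'a::model_space) manifold \<Rightarrow> ('m set \<times> ('e \<Rightarrow> 'm \<times> 'g)) set \<Rightarrow> bool" where
  "trivialization_system E \<pi> M F \<Psi> \<longleftrightarrow>
     (\<forall>(U, \<psi>)\<in>\<Psi>. local_trivialization E \<pi> M F U \<psi>) \<and>
     (\<Union>(U, \<psi>)\<in>\<Psi>. U) = points M"

definition smooth_fiber_bundle ::
  "('e, 'c::model_space) manifold \<Rightarrow> ('e \<Rightarrow> 'm) \<Rightarrow> ('m, 'b::model_space) manifold \<Rightarrow>
   ('g, 'a::model_space) manifold \<Rightarrow> bool" where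
  "smooth_fiber_bundle E \<pi> M F \<longleftrightarrow>
     smooth_manifold E \<and> smooth_manifold M \<and> smooth_manifold F \<and>
     smooth_map E M \<pi> \<and> \<pi> ` points E = points M \<and>
     (\<exists>\<Psi>. trivialization_system E \<pi> M F \<Psi>)"

text \<open>
  \<open>fiber_coord \<psi>\<close> restricted to the fibre over \<open>p\<close> is the map \<open>\<psi>_p\<close> from \<open>E_p\<close> via
  \<open>{p} \<times> G\<close> to \<open>G\<close>, and \<open>transition E \<pi> \<psi> \<psi>' p = \<psi>'_p \<circ> \<psi>_p^{-1}\<close>.
\<close>

definition fiber_coord :: "('e \<Rightarrow> 'm \<times> 'g) \<Rightarrow> 'e \<Rightarrow> 'g" where
  "fiber_coord \<psi> = snd \<circ> \<psi>"

definition transition ::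
  "('e, 'c) manifold \<Rightarrow> ('e \<Rightarrow> 'm) \<Rightarrow> ('e \<Rightarrow> 'm \<times> 'g) \<Rightarrow> ('e \<Rightarrow> 'm \<times> 'g) \<Rightarrow> 'm \<Rightarrow> 'g \<Rightarrow> 'g" where
  "transition E \<pi> \<psi> \<psi>' p = fiber_coord \<psi>' \<circ> inv_into (fiber E \<pi> p) (fiber_coord \<psi>)"

definition vertical_space ::
  "('e, 'c::model_space) manifold \<Rightarrow> ('e \<Rightarrow> 'm) \<Rightarrow> ('m, 'b::model_space) manifold \<Rightarrow>
   'e \<Rightarrow> ('e, 'c) tangent set" where
  "vertical_space E \<pi> M x = {v \<in> tangent_space E x. differential E M \<pi> x v = (\<lambda>d. 0)}"


section \<open>Symplectic Lie group bundles\<close>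

text \<open>
  \<open>L p\<close> is the Lie group structure on the fibre \<open>E_p\<close>. The form \<open>\<gamma>_p^* \<omega>'\<close> is the
  pullback of \<open>\<omega>'\<close> along the inclusion of \<open>E_p\<close> into \<open>E\<close>, whose differential takes its
  values in \<open>ker \<pi>_*\<close>.
\<close>

definition fiber_form ::
  "('e, 'c::model_space) manifold \<Rightarrow> ('e, 'a::model_space) lie_group \<Rightarrow>
   ('e, 'c) two_form \<Rightarrow> ('e, 'a) two_form" where
  "fiber_form E H \<omega>' = pullback (mfd H) E id \<omega>'"

definition symplectic_lie_group_bundle ::
  "('g, 'a::model_space) lie_group \<Rightarrow> ('g, 'a) two_form \<Rightarrow>
   ('e, 'c::model_space) manifold \<Rightarrow> ('e \<Rightarrow> 'm) \<Rightarrow> ('m, 'b::model_space) manifold \<Rightarrow>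
   ('m \<Rightarrow> ('e, 'a) lie_group) \<Rightarrow> ('e, 'c) two_form \<Rightarrow> bool" where
  "symplectic_lie_group_bundle G \<omega> E \<pi> M L \<omega>' \<longleftrightarrow>
     symplectic_lie_group G \<omega> \<and>
     smooth_fiber_bundle E \<pi> M (mfd G) \<and>
     smooth_section_Lambda2_dual E (vertical_space E \<pi> M) \<omega>' \<and>
     (\<forall>p\<in>points M. is_lie_group (L p) \<and> carrier (L p) = fiber E \<pi> p \<and>
        embedded_submanifold (mfd (L p)) E) \<and>
     (\<forall>p\<in>points M. symplectic_form (mfd (L p)) (fiber_form E (L p) \<omega>') \<and>
        left_invariant (L p) (fiber_form E (L p) \<omega>')) \<and>
     (\<exists>\<Psi>. trivialization_system E \<pi> M (mfd G) \<Psi> \<and>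
        (\<forall>(U, \<psi>)\<in>\<Psi>. \<forall>p\<in>U.
           fiber_coord \<psi> \<in> symplectic_lie_group_isos (L p) (fiber_form E (L p) \<omega>') G \<omega>))"

end

theory Submission
  imports Defs
begin

text \<open>
  If the fibres are symplectic Lie groups and \<open>\<psi>\<close>, \<open>\<psi>'\<close> are trivializations as in the definition of a
  symplectic Lie group bundle, then \<open>\<psi>'\<^sub>p\<close> and \<open>\<psi>\<^sub>p\<close> are both isomorphisms from \<open>E\<^sub>p\<close> to \<open>(G, \<omega>)\<close>, so the
  transition \<open>\<psi>'\<^sub>p \<circ> \<psi>\<^sub>p\<^sup>-\<^sup>1\<close> is an automorphism of \<open>(G, \<omega>)\<close> (\<open>transition_symplectic_of_bundle\<close>).

  Conversely, let the transitions be automorphisms of \<open>(G, \<omega>)\<close>. Each fibre \<open>E\<^sub>p\<close> receives the manifold and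
  group structure of \<open>G\<close> through \<open>\<psi>\<^sub>p\<close> for one chosen trivialization \<open>\<psi>\<close> around \<open>p\<close>, and a pair of vertical
  vectors at \<open>x\<close> is given the value of \<open>\<omega>\<close> on their images under the differential of the fibre coordinate
  \<open>snd \<circ> \<psi>\<close>. The choices can be made independently at every point, because on vertical vectors another
  trivialization changes these images by the differential of a transition, which preserves \<open>\<omega>\<close>
  (\<open>pullback_transition\<close>). Hence near any point the form may be computed with one fixed trivialization, where
  it is the restriction of a pullback of \<open>\<omega>\<close> along a smooth map and therefore smooth
  (\<open>smooth_function_pullback\<close>). Restricted to a fibre, it is the pullback of \<open>\<omega>\<close> along \<open>\<psi>\<^sub>p\<close>, so it
  inherits closedness, nondegeneracy and left invariance from \<open>\<omega>\<close>. What makes the comparison of trivializations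
  work is that a vertical vector is the image of a tangent vector of the fibre
  (\<open>vertical_tangent_fiber\<close>).

  The groundwork is the calculus of smooth maps between open sets and then between manifolds: composition, products, the
  chain rule for differentials of maps that are smooth on an open set, and the pullback of two-forms.
\<close>

section \<open>Calculus of smooth maps on model spaces\<close>

text \<open>Gram-Schmidt orthogonalization of a finite spanning set.\<close>

lemma finite_parseval_frame:
  "\<exists>B::'a::model_space set. finite B \<and> (\<forall>x. (\<Sum>b\<in>B. (x \<bullet> b) *\<^sub>R b) = x)"
proof -
  obtain A :: "'a set" where A: "finite A" "\<And>x. \<exists>c. x = (\<Sum>b\<in>A. c b *\<^sub>R b)"
    using finite_spanning by blast
  obtain C where C: "finite C" "span C = span A" "pairwise orthogonal C"
    using basis_orthogonal[OF A(1)] by blast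
  have spC: "span C = UNIV"
    using A by (auto simp: C(2) span_finite image_iff)
  define D where "D = C - {0}"
  have D: "finite D" "pairwise orthogonal D" "span D = UNIV" "0 \<notin> D"
    using C spC by (auto simp: D_def pairwise_def)
  define B where "B = (\<lambda>c. c /\<^sub>R norm c) ` D"
  have fB: "finite B" using D by (simp add: B_def)
  have one: "b \<bullet> b = 1" if b: "b \<in> B" for b
  proof -
    obtain c where "b = c /\<^sub>R norm c" "c \<noteq> 0" using b D(4) by (auto simp: B_def)
    then have "norm b = 1" by simp
    then show ?thesis by (simp add: norm_eq_sqrt_inner)
  qed
  have orth: "b \<bullet> b' = 0" if bb: "b \<in> B" "b' \<in> B" "b \<noteq> b'" for b b'
  proof -
    obtain c c' where c: "b = c /\<^sub>R norm c" "b' = c' /\<^sub>R norm c'" "c \<in> D" "c' \<in> D"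
      using bb by (auto simp: B_def)
    then have "c \<noteq> c'" using bb(3) by auto
    then have "c \<bullet> c' = 0" using D(2) c by (auto simp: pairwise_def orthogonal_def)
    then show ?thesis by (simp add: c)
  qed
  have "(\<Sum>b\<in>B. (x \<bullet> b) *\<^sub>R b) = x" for x
  proof -
    let ?r = "x - (\<Sum>b\<in>B. (x \<bullet> b) *\<^sub>R b)"
    have rB: "?r \<bullet> b = 0" if "b \<in> B" for b
    proof -
      have "(\<Sum>a\<in>B. (x \<bullet> a) * (a \<bullet> b)) = (\<Sum>a\<in>B. if a = b then x \<bullet> b else 0)"
        using orth[OF _ that] one[OF that] by (intro sum.cong) auto
      also have "\<dots> = x \<bullet> b" using fB that by simp
      finally show ?thesis by (simp add: inner_diff_left inner_sum_left)
    qed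
    have "orthogonal ?r c" if c: "c \<in> D" for c
    proof -
      have "?r \<bullet> (c /\<^sub>R norm c) = 0" by (rule rB) (simp add: B_def c)
      then have "inverse (norm c) * (?r \<bullet> c) = 0" by (simp only: inner_scaleR_right)
      moreover have "inverse (norm c) \<noteq> 0" using c D(4) by auto
      ultimately show ?thesis unfolding orthogonal_def by (metis mult_eq_0_iff)
    qed
    then have "orthogonal ?r y" if "y \<in> span D" for y
      using orthogonal_to_span[OF that, of ?r] by blast
    then have "orthogonal ?r ?r" using D(3) by blast
    then show ?thesis by (simp add: orthogonal_def)
  qed
  then show ?thesis using fB by blast
qed

text \<open>A finite Parseval frame. An orthonormal basis is one, and the expansion \<open>x = \<Sum>\<^sub>b \<langle>x, b\<rangle> b\<close> gives bounded
  linear coordinates.\<close>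

definition frame :: "'a::model_space set" where
  "frame = (SOME B. finite B \<and> (\<forall>x. (\<Sum>b\<in>B. (x \<bullet> b) *\<^sub>R b) = x))"

lemma frame: "finite (frame :: 'a::model_space set)" "(\<Sum>b\<in>frame. (x \<bullet> b) *\<^sub>R b) = (x::'a)"
  using someI_ex[OF finite_parseval_frame] unfolding frame_def by auto

lemma linear_frame_expansion:
  fixes f :: "'a::model_space \<Rightarrow> 'b::real_vector"
  assumes "linear f"
  shows "f x = (\<Sum>b\<in>frame. (x \<bullet> b) *\<^sub>R f b)"
proof -
  interpret linear f by fact
  have "f x = f (\<Sum>b\<in>frame. (x \<bullet> b) *\<^sub>R b)" by (simp add: frame)
  also have "\<dots> = (\<Sum>b\<in>frame. (x \<bullet> b) *\<^sub>R f b)" by (simp add: sum scaleR)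
  finally show ?thesis .
qed

lemma Ck_on_subset: "Ck_on k S f \<Longrightarrow> T \<subseteq> S \<Longrightarrow> Ck_on k T f"
  by (induction k arbitrary: f) (auto intro: continuous_on_subset)

lemma Ck_on_SucD: "Ck_on (Suc k) S f \<Longrightarrow> Ck_on k S f"
proof (induction k arbitrary: f)
  case 0
  then have "f differentiable_on S"
    by (auto simp: differentiable_on_def intro: differentiable_at_withinI)
  then show ?case by (simp add: differentiable_imp_continuous_on)
next
  case (Suc k)
  then show ?case by (metis Ck_on.simps(2))
qed

lemma Ck_on_cong:
  assumes "open S" "\<And>x. x \<in> S \<Longrightarrow> f x = g x" "Ck_on k S f"
  shows "Ck_on k S g"
  using assms(2,3)
proof (induction k arbitrary: f g)
  case 0
  then show ?case by (metis Ck_on.simps(1) continuous_on_cong)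
next
  case (Suc k)
  have 1: "(g has_derivative frechet_derivative f (at x)) (at x)" if "x \<in> S" for x
    using Suc.prems that assms(1)
    by (intro has_derivative_transform_within_open[of f _ x UNIV S g]) (auto simp: frechet_derivative_works)
  then have 2: "frechet_derivative f (at x) = frechet_derivative g (at x)" if "x \<in> S" for x
    using that frechet_derivative_at by blast
  show ?case
    unfolding Ck_on.simps
  proof (intro conjI ballI allI)
    show "g differentiable at x" if "x \<in> S" for x using 1 that by (auto simp: differentiable_def)
    show "Ck_on k S (\<lambda>x. frechet_derivative g (at x) v)" for v
      by (rule Suc.IH[of "\<lambda>x. frechet_derivative f (at x) v"]) (use Suc.prems 2 in auto)
  qed
qed

lemma Ck_on_SucI:
  assumes "open S" "\<And>x. x \<in> S \<Longrightarrow> (f has_derivative f' x) (at x)" "\<And>v. Ck_on k S (\<lambda>x. f' x v)"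
  shows "Ck_on (Suc k) S f"
  unfolding Ck_on.simps
proof (intro conjI ballI allI)
  show "f differentiable at x" if "x \<in> S" for x using assms that by (auto simp: differentiable_def)
  show "Ck_on k S (\<lambda>x. frechet_derivative f (at x) v)" for v
    by (rule Ck_on_cong[OF assms(1) _ assms(3)[of v]]) (use assms(2) frechet_derivative_at in metis)
qed

lemma Ck_on_has_derivative:
  assumes "Ck_on (Suc k) S f" "x \<in> S"
  shows "(f has_derivative frechet_derivative f (at x)) (at x)"
  using assms by (auto simp: frechet_derivative_works)

lemma Ck_on_local:
  assumes "\<And>x. x \<in> S \<Longrightarrow> \<exists>T. open T \<and> x \<in> T \<and> Ck_on k T f"
  shows "Ck_on k S f"
  using assms
proof (induction k arbitrary: f)
  case 0
  have "continuous (at x) f" if "x \<in> S" for x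
    using 0[OF that] by (auto simp: continuous_on_eq_continuous_at)
  then show ?case by (simp add: continuous_at_imp_continuous_on)
next
  case (Suc k)
  have *: "\<exists>T. open T \<and> x \<in> T \<and> (\<forall>y\<in>T. f differentiable at y) \<and> (\<forall>v. Ck_on k T (\<lambda>x. frechet_derivative f (at x) v))"
    if "x \<in> S" for x using Suc.prems[OF that] by simp
  show ?case unfolding Ck_on.simps
  proof (intro conjI ballI allI)
    show "f differentiable at x" if "x \<in> S" for x using *[OF that] by blast
    show "Ck_on k S (\<lambda>x. frechet_derivative f (at x) v)" for v
    proof (rule Suc.IH)
      show "\<exists>T. open T \<and> x \<in> T \<and> Ck_on k T (\<lambda>x. frechet_derivative f (at x) v)" if "x \<in> S" for x
        using *[OF that] by fast
    qed
  qed
qed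

lemma Ck_on_const: "Ck_on k S (\<lambda>x. c)"
  by (induction k arbitrary: c) auto

lemma Ck_on_bounded_linear:
  assumes "open S" "bounded_linear f"
  shows "Ck_on k S f"
proof (cases k)
  case 0
  then show ?thesis using assms(2) by (simp add: linear_continuous_on)
next
  case (Suc k)
  then show ?thesis
    using Ck_on_SucI[OF assms(1) bounded_linear_imp_has_derivative[OF assms(2)] Ck_on_const] by simp
qed

lemma Ck_on_add:
  assumes "open S" "Ck_on k S f" "Ck_on k S g"
  shows "Ck_on k S (\<lambda>x. f x + g x)"
  using assms(2,3)
proof (induction k arbitrary: f g)
  case 0 then show ?case by (simp add: continuous_on_add)
next
  case (Suc k)
  show ?case
    by (rule Ck_on_SucI[OF assms(1) has_derivative_add[OF Ck_on_has_derivative[OF Suc.prems(1)]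
            Ck_on_has_derivative[OF Suc.prems(2)]]])
      (use Suc in auto)
qed

lemma Ck_on_sum:
  assumes "open S" "\<And>i. i \<in> I \<Longrightarrow> Ck_on k S (f i)"
  shows "Ck_on k S (\<lambda>x. \<Sum>i\<in>I. f i x)"
  using assms(2) by (induction I rule: infinite_finite_induct) (auto intro: Ck_on_const Ck_on_add assms(1))

lemma (in bounded_bilinear) Ck_on_prod:
  assumes "open S" "Ck_on k S f" "Ck_on k S g"
  shows "Ck_on k S (\<lambda>x. prod (f x) (g x))"
  using assms(2,3)
proof (induction k arbitrary: f g)
  case 0 then show ?case by (simp add: continuous_on)
next
  case (Suc k)
  show ?case
  proof (rule Ck_on_SucI[OF assms(1) FDERIV[OF Ck_on_has_derivative[OF Suc.prems(1)]
          Ck_on_has_derivative[OF Suc.prems(2)]]])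
    show "Ck_on k S (\<lambda>x. prod (f x) (frechet_derivative g (at x) v) + prod (frechet_derivative f (at x) v) (g x))" for v
      using Suc.prems(1,2)[THEN Ck_on_SucD] Suc.prems by (intro Ck_on_add Suc.IH assms(1)) auto
  qed
qed

lemmas Ck_on_scaleR = bounded_bilinear.Ck_on_prod[OF bounded_bilinear_scaleR]

lemma Ck_on_compose_bounded_linear:
  assumes "open S" "bounded_linear L" "Ck_on k S f"
  shows "Ck_on k S (\<lambda>x. L (f x))"
  using assms(3)
proof (induction k arbitrary: f)
  case 0 then show ?case using assms(2) by (simp add: bounded_linear.continuous_on)
next
  case (Suc k)
  show ?case
    by (rule Ck_on_SucI[OF assms(1) bounded_linear.has_derivative[OF assms(2) Ck_on_has_derivative[OF Suc.prems]]])
       (use Suc in auto)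
qed

lemma Ck_on_Pair:
  assumes "open S" "Ck_on k S f" "Ck_on k S g"
  shows "Ck_on k S (\<lambda>x. (f x, g x))"
proof -
  have "Ck_on k S (\<lambda>x. (f x, 0) + (0, g x))"
    using Ck_on_compose_bounded_linear[OF assms(1) bounded_linear_Pair[OF bounded_linear_ident bounded_linear_zero] assms(2)]
      Ck_on_compose_bounded_linear[OF assms(1) bounded_linear_Pair[OF bounded_linear_zero bounded_linear_ident] assms(3)]
    by (rule Ck_on_add[OF assms(1)])
  then show ?thesis by simp
qed

text \<open>By the chain rule the derivative of \<open>g \<circ> f\<close> in the direction \<open>v\<close> is \<open>\<Sum>\<^sub>b \<langle>Df v, b\<rangle> Dg b\<close>, summed over the frame.
  In this form \<open>g\<close> is differentiated in constant directions only, so the induction on the order of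
  differentiability goes through.\<close>

lemma Ck_on_compose:
  fixes f :: "'a::real_normed_vector \<Rightarrow> 'b::model_space"
  assumes "open S" "open T" "f ` S \<subseteq> T" "Ck_on k S f" "Ck_on k T g"
  shows "Ck_on k S (\<lambda>x. g (f x))"
  using assms(4,5)
proof (induction k arbitrary: g)
  case 0
  then show ?case
    using continuous_on_compose2[of T g S f] assms(3) by simp
next
  case (Suc k)
  have fT: "f x \<in> T" if "x \<in> S" for x using assms(3) that by auto
  note fk = Ck_on_SucD[OF Suc.prems(1)]
  let ?D = "\<lambda>x v. frechet_derivative g (at (f x)) (frechet_derivative f (at x) v)"
  show ?case
  proof (rule Ck_on_SucI[OF assms(1)])
    show "((\<lambda>x. g (f x)) has_derivative ?D x) (at x)" if "x \<in> S" for x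
      using has_derivative_compose[OF Ck_on_has_derivative[OF Suc.prems(1) that]
          Ck_on_has_derivative[OF Suc.prems(2) fT[OF that]]] .
    have eq: "(\<Sum>b\<in>frame. (frechet_derivative f (at x) v \<bullet> b) *\<^sub>R frechet_derivative g (at (f x)) b) = ?D x v"
      if "x \<in> S" for x v
      by (rule linear_frame_expansion[symmetric])
        (rule has_derivative_linear[OF Ck_on_has_derivative[OF Suc.prems(2) fT[OF that]]])
    show "Ck_on k S (\<lambda>x. ?D x v)" for v
    proof (rule Ck_on_cong[OF assms(1) eq])
      have "Ck_on k S (\<lambda>x. frechet_derivative f (at x) v \<bullet> b)" for b
        by (rule Ck_on_compose_bounded_linear[OF assms(1) bounded_linear_inner_left])
          (use Suc.prems(1) in simp)
      moreover have "Ck_on k S (\<lambda>x. frechet_derivative g (at (f x)) b)" for b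
        using Suc.IH[OF fk, of "\<lambda>y. frechet_derivative g (at y) b"] Suc.prems(2) by auto
      ultimately show "Ck_on k S (\<lambda>x. \<Sum>b\<in>frame. (frechet_derivative f (at x) v \<bullet> b) *\<^sub>R
                        frechet_derivative g (at (f x)) b)"
        by (intro Ck_on_sum[OF assms(1)] Ck_on_scaleR[OF assms(1)]) auto
    qed
  qed
qed

lemma smooth_on_subset: "smooth_on S f \<Longrightarrow> T \<subseteq> S \<Longrightarrow> smooth_on T f"
  unfolding smooth_on_def by (blast intro: Ck_on_subset)

lemma smooth_on_cong: "open S \<Longrightarrow> (\<And>x. x \<in> S \<Longrightarrow> f x = g x) \<Longrightarrow> smooth_on S f \<Longrightarrow> smooth_on S g"
  unfolding smooth_on_def by (blast intro: Ck_on_cong)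

lemma smooth_on_local:
  "(\<And>x. x \<in> S \<Longrightarrow> \<exists>T. open T \<and> x \<in> T \<and> smooth_on T f) \<Longrightarrow> smooth_on S f"
  unfolding smooth_on_def by (meson Ck_on_local)

lemma smooth_on_bounded_linear: "open S \<Longrightarrow> bounded_linear f \<Longrightarrow> smooth_on S f"
  by (simp add: smooth_on_def Ck_on_bounded_linear)

lemma smooth_on_const: "smooth_on S (\<lambda>x. c)"
  by (simp add: smooth_on_def Ck_on_const)

lemma smooth_on_sum: "open S \<Longrightarrow> (\<And>i. i \<in> I \<Longrightarrow> smooth_on S (f i)) \<Longrightarrow> smooth_on S (\<lambda>x. \<Sum>i\<in>I. f i x)"
  by (simp add: smooth_on_def Ck_on_sum)

lemma smooth_on_scaleR: "open S \<Longrightarrow> smooth_on S f \<Longrightarrow> smooth_on S g \<Longrightarrow> smooth_on S (\<lambda>x. f x *\<^sub>R g x)"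
  by (simp add: smooth_on_def Ck_on_scaleR)

lemma smooth_on_mult:
  fixes f g :: "_ \<Rightarrow> real"
  shows "open S \<Longrightarrow> smooth_on S f \<Longrightarrow> smooth_on S g \<Longrightarrow> smooth_on S (\<lambda>x. f x * g x)"
  using smooth_on_scaleR[of S f g] by simp

lemma smooth_on_compose_bounded_linear:
  "open S \<Longrightarrow> bounded_linear L \<Longrightarrow> smooth_on S f \<Longrightarrow> smooth_on S (\<lambda>x. L (f x))"
  by (simp add: smooth_on_def Ck_on_compose_bounded_linear)

lemma smooth_on_Pair: "open S \<Longrightarrow> smooth_on S f \<Longrightarrow> smooth_on S g \<Longrightarrow> smooth_on S (\<lambda>x. (f x, g x))"
  by (simp add: smooth_on_def Ck_on_Pair)

lemma smooth_on_compose: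
  fixes f :: "'a::real_normed_vector \<Rightarrow> 'b::model_space"
  shows "open S \<Longrightarrow> open T \<Longrightarrow> f ` S \<subseteq> T \<Longrightarrow> smooth_on S f \<Longrightarrow> smooth_on T g \<Longrightarrow> smooth_on S (\<lambda>x. g (f x))"
  by (simp add: smooth_on_def Ck_on_compose)

lemma smooth_on_has_derivative:
  "smooth_on S f \<Longrightarrow> x \<in> S \<Longrightarrow> (f has_derivative frechet_derivative f (at x)) (at x)"
  unfolding smooth_on_def by (blast intro: Ck_on_has_derivative)

lemma smooth_on_directional_derivative:
  fixes f :: "'a::model_space \<Rightarrow> 'b::real_normed_vector"
  assumes "open S" "smooth_on S f" "smooth_on S w"
  shows "smooth_on S (\<lambda>x. frechet_derivative f (at x) (w x))"
proof (rule smooth_on_cong[OF assms(1)])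
  show "(\<Sum>b\<in>frame. (w x \<bullet> b) *\<^sub>R frechet_derivative f (at x) b) = frechet_derivative f (at x) (w x)"
    if "x \<in> S" for x
    by (rule linear_frame_expansion[symmetric])
      (rule has_derivative_linear[OF smooth_on_has_derivative[OF assms(2) that]])
  have "smooth_on S (\<lambda>x. frechet_derivative f (at x) b)" for b
    using assms(2) unfolding smooth_on_def by (metis Ck_on.simps(2))
  moreover have "smooth_on S (\<lambda>x. w x \<bullet> b)" for b
    by (rule smooth_on_compose_bounded_linear[OF assms(1) bounded_linear_inner_left assms(3)])
  ultimately show "smooth_on S (\<lambda>x. \<Sum>b\<in>frame. (w x \<bullet> b) *\<^sub>R frechet_derivative f (at x) b)"
    by (intro smooth_on_sum[OF assms(1)] smooth_on_scaleR[OF assms(1)])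
qed

section \<open>Charts and atlases\<close>

text \<open>The differential calculus is a matter of the charts alone, so their conditions are separated from the
  Hausdorff and countability axioms. Products and open submanifolds enter only as such carriers of charts.\<close>

definition smooth_atlas :: "('x, 'a::model_space) manifold \<Rightarrow> bool" where
  "smooth_atlas X \<longleftrightarrow>
     (\<forall>c\<in>atlas X. is_chart (base_top X) c) \<and>
     (\<Union>c\<in>atlas X. fst c) = points X \<and>
     (\<forall>c\<in>atlas X. \<forall>d\<in>atlas X. smooth_on (snd c ` (fst c \<inter> fst d)) (snd d \<circ> chart_inv c))"

lemma smooth_manifold_iff:
  "smooth_manifold X \<longleftrightarrow>
     Hausdorff_space (base_top X) \<and> second_countable (base_top X) \<and> smooth_atlas X"
  by (auto simp: smooth_manifold_def smooth_atlas_def)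

lemma smooth_manifold_atlas: "smooth_manifold X \<Longrightarrow> smooth_atlas X"
  by (simp add: smooth_manifold_iff)

lemma is_chart_inj:
  assumes "is_chart T c" shows "inj_on (snd c) (fst c)"
proof -
  have "fst c \<subseteq> topspace T" using assms by (auto simp: is_chart_def dest: openin_subset)
  then have "topspace (subtopology T (fst c)) = fst c" by auto
  then show ?thesis using assms by (metis homeomorphic_imp_injective_map is_chart_def)
qed

lemma is_chart_open_image:
  assumes "is_chart T c" "openin T W" shows "open (snd c ` (fst c \<inter> W))"
proof -
  have c: "openin T (fst c)" "open (snd c ` fst c)"
    "homeomorphic_map (subtopology T (fst c)) (top_of_set (snd c ` fst c)) (snd c)"
    using assms(1) by (auto simp: is_chart_def)
  have "openin (subtopology T (fst c)) (fst c \<inter> W)"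
    using assms(2) by (simp add: openin_subtopology_Int2)
  moreover from this have "fst c \<inter> W \<subseteq> topspace (subtopology T (fst c))" by (rule openin_subset)
  ultimately have "openin (top_of_set (snd c ` fst c)) (snd c ` (fst c \<inter> W))"
    using homeomorphic_map_openness[OF c(3)] by blast
  then show ?thesis using c(2) by (simp add: openin_open_eq)
qed

lemma is_chart_continuous:
  assumes "is_chart T c" shows "continuous_map (subtopology T (fst c)) euclidean (snd c)"
  using assms by (auto simp: is_chart_def continuous_map_in_subtopology dest: homeomorphic_imp_continuous_map)

text \<open>For a concrete coordinate map it is easier to see that it is continuous, injective and open than to
  exhibit a continuous inverse.\<close>

lemma is_chartI:
  assumes U: "openin T U" and inj: "inj_on \<phi> U"
    and cont: "continuous_map (subtopology T U) euclidean \<phi>"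
    and op: "\<And>W. openin T W \<Longrightarrow> W \<subseteq> U \<Longrightarrow> open (\<phi> ` W)"
  shows "is_chart T (U, \<phi>)"
proof -
  have top: "topspace (subtopology T U) = U" using openin_subset[OF U] by auto
  have "homeomorphic_map (subtopology T U) (top_of_set (\<phi> ` U)) \<phi>"
  proof (rule bijective_open_imp_homeomorphic_map)
    show "continuous_map (subtopology T U) (top_of_set (\<phi> ` U)) \<phi>"
      using cont top by (auto simp: continuous_map_in_subtopology)
    show "open_map (subtopology T U) (top_of_set (\<phi> ` U)) \<phi>"
      unfolding open_map_def
    proof (intro allI impI)
      fix W assume "openin (subtopology T U) W"
      then have W: "openin T W" "W \<subseteq> U" using U openin_open_subtopology by blast+
      show "openin (top_of_set (\<phi> ` U)) (\<phi> ` W)"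
        using op[OF W] W(2) op[OF U] by (auto simp: openin_open_eq)
    qed
  qed (use top inj in auto)
  then show ?thesis using U op[OF U] by (simp add: is_chart_def)
qed

context
  fixes X :: "('x, 'a::model_space) manifold" and c
  assumes X: "smooth_atlas X" and c: "c \<in> atlas X"
begin

lemma atlas_chart: "is_chart (base_top X) c"
  using X c by (simp add: smooth_atlas_def)

lemma atlas_openin: "openin (base_top X) (fst c)"
  using atlas_chart by (simp add: is_chart_def)

lemma atlas_subset_points: "fst c \<subseteq> points X"
  using atlas_openin by (rule openin_subset)

lemma atlas_open_image: "openin (base_top X) W \<Longrightarrow> open (snd c ` (fst c \<inter> W))"
  using is_chart_open_image[OF atlas_chart] .

lemma atlas_inv: "x \<in> fst c \<Longrightarrow> chart_inv c (snd c x) = x"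
  unfolding chart_inv_def by (rule inv_into_f_f[OF is_chart_inj[OF atlas_chart]])

end

lemma atlas_cover: "smooth_atlas X \<Longrightarrow> p \<in> points X \<Longrightarrow> \<exists>c. c \<in> charts_at X p"
  unfolding smooth_atlas_def charts_at_def by blast

lemma charts_atD: "c \<in> charts_at X p \<Longrightarrow> c \<in> atlas X" "c \<in> charts_at X p \<Longrightarrow> p \<in> fst c"
  by (auto simp: charts_at_def)

lemma openin_preimage_on:
  assumes "openin T W" "continuous_map (subtopology T W) T' f" "openin T' V"
  shows "openin T (W \<inter> f -` V)"
proof -
  have "openin (subtopology T W) {x \<in> topspace (subtopology T W). f x \<in> V}"
    using assms(2,3) by (rule openin_continuous_map_preimage)
  moreover have "{x \<in> topspace (subtopology T W). f x \<in> V} = W \<inter> f -` V"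
    using openin_subset[OF assms(1)] by auto
  ultimately show ?thesis using assms(1) openin_open_subtopology by metis
qed


section \<open>Smooth maps\<close>

text \<open>Passing to an open submanifold replaces the charts, and with them the index set of tangent vectors. Smoothness
  on an open subset in the charts of \<open>X\<close> itself keeps all differentials on the tangent spaces of \<open>X\<close>.\<close>

definition smooth_map_on ::
  "('x, 'a::model_space) manifold \<Rightarrow> 'x set \<Rightarrow> ('y, 'b::model_space) manifold \<Rightarrow> ('x \<Rightarrow> 'y) \<Rightarrow> bool" where
  "smooth_map_on X W Y f \<longleftrightarrow>
     openin (base_top X) W \<and> continuous_map (subtopology (base_top X) W) (base_top Y) f \<and>
     (\<forall>c\<in>atlas X. \<forall>d\<in>atlas Y.
        smooth_on (snd c ` (fst c \<inter> W \<inter> f -` fst d)) (snd d \<circ> f \<circ> chart_inv c))"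

lemma smooth_map_on_rep:
  "smooth_map_on X W Y f \<Longrightarrow> c \<in> atlas X \<Longrightarrow> d \<in> atlas Y \<Longrightarrow>
    smooth_on (snd c ` (fst c \<inter> W \<inter> f -` fst d)) (snd d \<circ> f \<circ> chart_inv c)"
  by (simp add: smooth_map_on_def)

lemma smooth_map_on_points:
  assumes "smooth_atlas X"
  shows "smooth_map_on X (points X) Y f \<longleftrightarrow> smooth_map X Y f"
proof -
  have "fst c \<inter> points X \<inter> f -` S = fst c \<inter> f -` S" if "c \<in> atlas X" for c S
    using atlas_subset_points[OF assms that] by blast
  then show ?thesis by (simp add: smooth_map_on_def smooth_map_def)
qed

lemma smooth_map_on_openin: "smooth_map_on X W Y f \<Longrightarrow> openin (base_top X) W"
  by (simp add: smooth_map_on_def)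

lemma smooth_map_on_subset_points: "smooth_map_on X W Y f \<Longrightarrow> W \<subseteq> points X"
  by (rule openin_subset[OF smooth_map_on_openin])

lemma smooth_map_on_image: "smooth_map_on X W Y f \<Longrightarrow> x \<in> W \<Longrightarrow> f x \<in> points Y"
  using smooth_map_on_subset_points[of X W Y f]
  by (auto simp: smooth_map_on_def continuous_map_def)

lemma smooth_map_on_preimage:
  "smooth_map_on X W Y f \<Longrightarrow> openin (base_top Y) V \<Longrightarrow> openin (base_top X) (W \<inter> f -` V)"
  by (auto simp: smooth_map_on_def intro: openin_preimage_on)

lemma smooth_map_on_subset:
  assumes "smooth_map_on X W Y f" "openin (base_top X) V" "V \<subseteq> W"
  shows "smooth_map_on X V Y f"
  unfolding smooth_map_on_def
proof (intro conjI ballI)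
  show "continuous_map (subtopology (base_top X) V) (base_top Y) f"
    using assms(1,3) by (auto simp: smooth_map_on_def intro: continuous_map_from_subtopology_mono)
  show "smooth_on (snd c ` (fst c \<inter> V \<inter> f -` fst d)) (snd d \<circ> f \<circ> chart_inv c)"
    if "c \<in> atlas X" "d \<in> atlas Y" for c d
    by (rule smooth_on_subset[OF smooth_map_on_rep[OF assms(1) that]]) (use assms(3) in blast)
qed fact

text \<open>Smoothness may be tested near each point; for a composition this leaves room to shrink the neighbourhood until
  the intermediate values lie in a single chart.\<close>

lemma smooth_map_onI:
  assumes X: "smooth_atlas X" and "openin (base_top X) W"
    and "continuous_map (subtopology (base_top X) W) (base_top Y) f"
    and loc: "\<And>c d p. c \<in> atlas X \<Longrightarrow> d \<in> atlas Y \<Longrightarrow> p \<in> fst c \<Longrightarrow> p \<in> W \<Longrightarrow> f p \<in> fst d \<Longrightarrow>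
      \<exists>N. openin (base_top X) N \<and> p \<in> N \<and> smooth_on (snd c ` (fst c \<inter> N)) (\<lambda>y. snd d (f (chart_inv c y)))"
  shows "smooth_map_on X W Y f"
  unfolding smooth_map_on_def
proof (intro conjI ballI smooth_on_local)
  fix c d y assume c: "c \<in> atlas X" and d: "d \<in> atlas Y" and "y \<in> snd c ` (fst c \<inter> W \<inter> f -` fst d)"
  then obtain p where p: "p \<in> fst c" "p \<in> W" "f p \<in> fst d" "y = snd c p" by auto
  obtain N where N: "openin (base_top X) N" "p \<in> N"
    "smooth_on (snd c ` (fst c \<inter> N)) (\<lambda>y. snd d (f (chart_inv c y)))"
    using loc[OF c d p(1-3)] by blast
  show "\<exists>T. open T \<and> y \<in> T \<and> smooth_on T (snd d \<circ> f \<circ> chart_inv c)"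
    using atlas_open_image[OF X c N(1)] N p by (intro exI[of _ "snd c ` (fst c \<inter> N)"]) (auto simp: o_def)
qed fact+

lemma smooth_map_on_cong:
  assumes X: "smooth_atlas X" and Y: "smooth_atlas Y" and f: "smooth_map_on X W Y f"
    and eq: "\<And>x. x \<in> W \<Longrightarrow> f x = g x"
  shows "smooth_map_on X W Y g"
proof (rule smooth_map_onI[OF X smooth_map_on_openin[OF f]])
  show "continuous_map (subtopology (base_top X) W) (base_top Y) g"
    by (rule continuous_map_eq[of _ _ f]) (use f eq in \<open>auto simp: smooth_map_on_def\<close>)
  fix c d p assume c: "c \<in> atlas X" and d: "d \<in> atlas Y" and p: "p \<in> fst c" "p \<in> W" "g p \<in> fst d"
  let ?N = "W \<inter> f -` fst d"
  have N: "openin (base_top X) ?N"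
    by (rule smooth_map_on_preimage[OF f atlas_openin[OF Y d]])
  have "smooth_on (snd c ` (fst c \<inter> ?N)) (\<lambda>y. snd d (f (chart_inv c y)))"
    using f c d by (auto simp: smooth_map_on_def o_def Int_assoc)
  then have "smooth_on (snd c ` (fst c \<inter> ?N)) (\<lambda>y. snd d (g (chart_inv c y)))"
    by (rule smooth_on_cong[rotated 2, OF _ atlas_open_image[OF X c N]])
      (use eq in \<open>auto simp: atlas_inv[OF X c]\<close>)
  then show "\<exists>N. openin (base_top X) N \<and> p \<in> N \<and> smooth_on (snd c ` (fst c \<inter> N)) (\<lambda>y. snd d (g (chart_inv c y)))"
    using N p eq by (intro exI[of _ ?N]) auto
qed

lemma smooth_map_on_compose:
  assumes X: "smooth_atlas X" and Y: "smooth_atlas Y" and Z: "smooth_atlas Z"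
    and f: "smooth_map_on X W Y f" and g: "smooth_map_on Y V Z g" and sub: "f ` W \<subseteq> V"
  shows "smooth_map_on X W Z (g \<circ> f)"
proof (rule smooth_map_onI[OF X smooth_map_on_openin[OF f]])
  have "continuous_map (subtopology (base_top X) W) (subtopology (base_top Y) V) f"
    using f sub by (auto simp: smooth_map_on_def continuous_map_in_subtopology)
  then show "continuous_map (subtopology (base_top X) W) (base_top Z) (g \<circ> f)"
    using g by (auto simp: smooth_map_on_def intro: continuous_map_compose)
  fix c e p assume c: "c \<in> atlas X" and e: "e \<in> atlas Z" and p: "p \<in> fst c" "p \<in> W" "(g \<circ> f) p \<in> fst e"
  obtain d where d: "d \<in> atlas Y" "f p \<in> fst d"
    using atlas_cover[OF Y smooth_map_on_image[OF f p(2)]] by (auto simp: charts_at_def)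
  let ?V = "V \<inter> g -` fst e"
  let ?N = "W \<inter> f -` (fst d \<inter> ?V)"
  have V: "openin (base_top Y) ?V"
    by (rule smooth_map_on_preimage[OF g atlas_openin[OF Z e]])
  have N: "openin (base_top X) ?N"
    by (rule smooth_map_on_preimage[OF f openin_Int[OF atlas_openin[OF Y d(1)] V]])
  let ?S = "snd c ` (fst c \<inter> ?N)" and ?T = "snd d ` (fst d \<inter> ?V)"
  have S: "open ?S" and T: "open ?T"
    using atlas_open_image[OF X c N] atlas_open_image[OF Y d(1) V] .
  have "smooth_on (snd c ` (fst c \<inter> W \<inter> f -` fst d)) (\<lambda>y. snd d (f (chart_inv c y)))"
    using f c d(1) by (auto simp: smooth_map_on_def o_def)
  then have 1: "smooth_on ?S (\<lambda>y. snd d (f (chart_inv c y)))"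
    by (rule smooth_on_subset) auto
  have 2: "smooth_on ?T (\<lambda>z. snd e (g (chart_inv d z)))"
    using g e d(1) by (auto simp: smooth_map_on_def o_def Int_assoc)
  have "smooth_on ?S (\<lambda>y. snd e (g (chart_inv d (snd d (f (chart_inv c y))))))"
    by (rule smooth_on_compose[OF S T _ 1 2]) (auto simp: atlas_inv[OF X c])
  then have "smooth_on ?S (\<lambda>y. snd e ((g \<circ> f) (chart_inv c y)))"
    by (rule smooth_on_cong[OF S, rotated]) (auto simp: atlas_inv[OF X c] atlas_inv[OF Y d(1)])
  then show "\<exists>N. openin (base_top X) N \<and> p \<in> N \<and>
      smooth_on (snd c ` (fst c \<inter> N)) (\<lambda>y. snd e ((g \<circ> f) (chart_inv c y)))"
    using N p d sub by (intro exI[of _ ?N]) auto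
qed

lemma smooth_map_compose:
  assumes "smooth_atlas X" "smooth_atlas Y" "smooth_atlas Z" "smooth_map X Y f" "smooth_map Y Z g"
  shows "smooth_map X Z (g \<circ> f)"
  using smooth_map_on_compose[of X Y Z "points X" f "points Y" g] assms smooth_map_on_image[of X "points X" Y f]
  by (auto simp: smooth_map_on_points)

lemma smooth_map_cong:
  assumes "smooth_atlas X" "smooth_atlas Y" "smooth_map X Y f" "\<And>x. x \<in> points X \<Longrightarrow> f x = g x"
  shows "smooth_map X Y g"
  using smooth_map_on_cong[of X Y "points X" f g] assms by (simp add: smooth_map_on_points)

lemma smooth_map_id: "smooth_atlas X \<Longrightarrow> smooth_map X X id"
  by (simp add: smooth_map_def smooth_atlas_def)

lemma smooth_map_on_const:
  assumes X: "smooth_atlas X" and "openin (base_top X) W" "y \<in> points Y"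
  shows "smooth_map_on X W Y (\<lambda>_. y)"
proof (rule smooth_map_onI[OF X assms(2)])
  show "continuous_map (subtopology (base_top X) W) (base_top Y) (\<lambda>_. y)" using assms(3) by simp
  show "\<exists>N. openin (base_top X) N \<and> p \<in> N \<and> smooth_on (snd c ` (fst c \<inter> N)) (\<lambda>_. snd d y)"
    if "c \<in> atlas X" "p \<in> fst c" for c p d
    using atlas_openin[OF X that(1)] that(2) smooth_on_const by blast
qed

lemma smooth_map_const: "smooth_atlas X \<Longrightarrow> y \<in> points Y \<Longrightarrow> smooth_map X Y (\<lambda>_. y)"
  using smooth_map_on_const[of X "points X" y Y] by (simp add: smooth_map_on_points)

lemma smooth_map_on_smooth_map:
  assumes X: "smooth_atlas X" and Y: "smooth_atlas Y" and f: "smooth_map X Y f" and W: "openin (base_top X) W"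
  shows "smooth_map_on X W Y f"
  using smooth_map_on_subset[of X "points X" Y f W] f W openin_subset[OF W] by (simp add: smooth_map_on_points X)


section \<open>Open submanifolds and products\<close>

lemma chart_inv_restrict:
  assumes "is_chart T c" "y \<in> snd c ` (fst c \<inter> W)"
  shows "chart_inv (fst c \<inter> W, snd c) y = chart_inv c y"
proof -
  obtain x where "x \<in> fst c \<inter> W" "y = snd c x" using assms(2) by auto
  moreover have "inj_on (snd c) (fst c)" "inj_on (snd c) (fst c \<inter> W)"
    using is_chart_inj[OF assms(1)] by (auto intro: inj_on_subset)
  ultimately show ?thesis by (simp add: chart_inv_def)
qed

lemma open_submanifold_simps:
  "base_top (open_submanifold X W) = subtopology (base_top X) W"
  "atlas (open_submanifold X W) = (\<lambda>c. (fst c \<inter> W, snd c)) ` atlas X"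
  by (auto simp: open_submanifold_def split_def)

lemma smooth_map_open_submanifold_iff:
  assumes X: "smooth_atlas X" and Y: "smooth_atlas Y" and W: "openin (base_top X) W"
  shows "smooth_map (open_submanifold X W) Y f \<longleftrightarrow> smooth_map_on X W Y f"
proof -
  have eq: "smooth_on (snd c ` (fst c \<inter> W \<inter> f -` fst d)) (snd d \<circ> f \<circ> chart_inv (fst c \<inter> W, snd c)) \<longleftrightarrow>
     smooth_on (snd c ` (fst c \<inter> W \<inter> f -` fst d)) (snd d \<circ> f \<circ> chart_inv c)"
    if cont: "continuous_map (subtopology (base_top X) W) (base_top Y) f" and c: "c \<in> atlas X" and d: "d \<in> atlas Y" for c d
  proof -
    have "open (snd c ` (fst c \<inter> (W \<inter> f -` fst d)))"
      by (rule atlas_open_image[OF X c openin_preimage_on[OF W cont atlas_openin[OF Y d]]])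
    then have "open (snd c ` (fst c \<inter> W \<inter> f -` fst d))" by (simp add: Int_assoc)
    then show ?thesis
      using chart_inv_restrict[OF atlas_chart[OF X c], of _ W]
      by (auto elim!: smooth_on_cong[rotated 2])
  qed
  show ?thesis
    unfolding smooth_map_def smooth_map_on_def open_submanifold_simps ball_simps fst_conv snd_conv
    using W eq by (metis (no_types, lifting))
qed

lemma smooth_map_on_into_open_submanifold:
  assumes X: "smooth_atlas X" and Y: "smooth_atlas Y" and "smooth_map_on X W Y f" "f ` W \<subseteq> V"
  shows "smooth_map_on X W (open_submanifold Y V) f"
proof -
  have eq: "fst c \<inter> W \<inter> f -` (fst d \<inter> V) = fst c \<inter> W \<inter> f -` fst d" for c d
    using assms(4) by auto
  show ?thesis
    using assms(3,4) unfolding smooth_map_on_def open_submanifold_simps continuous_map_in_subtopology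
      ball_simps fst_conv snd_conv eq by (simp add: Pi_iff image_subset_iff)
qed

lemma smooth_atlas_open_submanifold:
  assumes X: "smooth_atlas X" and W: "openin (base_top X) W"
  shows "smooth_atlas (open_submanifold X W)"
  unfolding smooth_atlas_def
proof (intro conjI ballI)
  let ?T = "subtopology (base_top X) W"
  fix c' assume "c' \<in> atlas (open_submanifold X W)"
  then obtain c where c: "c \<in> atlas X" "c' = (fst c \<inter> W, snd c)" by (auto simp: open_submanifold_simps)
  have "is_chart ?T (fst c \<inter> W, snd c)"
  proof (rule is_chartI)
    show "openin ?T (fst c \<inter> W)" using atlas_openin[OF X c(1)] by (simp add: openin_subtopology_Int)
    show "inj_on (snd c) (fst c \<inter> W)" using is_chart_inj[OF atlas_chart[OF X c(1)]] by (auto intro: inj_on_subset)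
    show "continuous_map (subtopology ?T (fst c \<inter> W)) euclidean (snd c)"
      unfolding subtopology_subtopology
      by (rule continuous_map_from_subtopology_mono[OF is_chart_continuous[OF atlas_chart[OF X c(1)]]]) auto
    show "open (snd c ` V)" if "openin ?T V" "V \<subseteq> fst c \<inter> W" for V
    proof -
      have "openin (base_top X) V" using that W openin_open_subtopology by blast
      moreover have "fst c \<inter> V = V" using that by auto
      ultimately show ?thesis using atlas_open_image[OF X c(1)] by metis
    qed
  qed
  then show "is_chart (base_top (open_submanifold X W)) c'" by (simp add: c open_submanifold_simps)
  fix d' assume "d' \<in> atlas (open_submanifold X W)"
  then obtain d where d: "d \<in> atlas X" "d' = (fst d \<inter> W, snd d)" by (auto simp: open_submanifold_simps)
  let ?S = "snd c ` (fst c \<inter> (W \<inter> fst d))"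
  have "smooth_on (snd c ` (fst c \<inter> fst d)) (snd d \<circ> chart_inv c)"
    using X c(1) d(1) by (simp add: smooth_atlas_def)
  then have "smooth_on ?S (snd d \<circ> chart_inv c)" by (rule smooth_on_subset) auto
  moreover have "open ?S"
    by (rule atlas_open_image[OF X c(1) openin_Int[OF W atlas_openin[OF X d(1)]]])
  ultimately have "smooth_on ?S (snd d \<circ> chart_inv c')"
    using chart_inv_restrict[OF atlas_chart[OF X c(1)], of _ W]
    by (elim smooth_on_cong[rotated 2]) (auto simp: c)
  moreover have "fst c' \<inter> fst d' = fst c \<inter> (W \<inter> fst d)" by (auto simp: c d)
  ultimately show "smooth_on (snd c' ` (fst c' \<inter> fst d')) (snd d' \<circ> chart_inv c')"
    by (simp add: c d)
next
  have "(\<Union>c\<in>atlas X. fst c) = points X" using X by (simp add: smooth_atlas_def)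
  then show "(\<Union>c\<in>atlas (open_submanifold X W). fst c) = points (open_submanifold X W)"
    using openin_subset[OF W] by (auto simp: open_submanifold_simps)
qed

lemma product_manifold_simps:
  "base_top (product_manifold X Y) = prod_topology (base_top X) (base_top Y)"
  "atlas (product_manifold X Y) = {(fst c \<times> fst d, map_prod (snd c) (snd d)) | c d. c \<in> atlas X \<and> d \<in> atlas Y}"
  by (force simp: product_manifold_def)+

lemma chart_inv_product:
  assumes "is_chart T c" "is_chart T' d" "x \<in> fst c" "y \<in> fst d"
  shows "chart_inv (fst c \<times> fst d, map_prod (snd c) (snd d)) (snd c x, snd d y) = (x, y)"
proof -
  have "inj_on (map_prod (snd c) (snd d)) (fst c \<times> fst d)"
    using is_chart_inj[OF assms(1)] is_chart_inj[OF assms(2)] by (rule map_prod_inj_on)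
  then have "inv_into (fst c \<times> fst d) (map_prod (snd c) (snd d)) (map_prod (snd c) (snd d) (x, y)) = (x, y)"
    using assms by (intro inv_into_f_f) auto
  then show ?thesis by (simp add: chart_inv_def)
qed

lemma is_chart_product:
  assumes c: "is_chart T c" and d: "is_chart T' d"
  shows "is_chart (prod_topology T T') (fst c \<times> fst d, map_prod (snd c) (snd d))"
proof (rule is_chartI)
  show "openin (prod_topology T T') (fst c \<times> fst d)"
    using c d by (simp add: is_chart_def openin_prod_Times_iff)
  show "inj_on (map_prod (snd c) (snd d)) (fst c \<times> fst d)"
    using is_chart_inj[OF c] is_chart_inj[OF d] by (rule map_prod_inj_on)
  have "continuous_map (prod_topology (subtopology T (fst c)) (subtopology T' (fst d)))
      (prod_topology euclidean euclidean) (\<lambda>(x, y). (snd c x, snd d y))"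
    using is_chart_continuous[OF c] is_chart_continuous[OF d] by (metis continuous_map_prod_top)
  then show "continuous_map (subtopology (prod_topology T T') (fst c \<times> fst d)) euclidean (map_prod (snd c) (snd d))"
    by (simp add: subtopology_Times euclidean_product_topology map_prod_def)
  fix W assume W: "openin (prod_topology T T') W" "W \<subseteq> fst c \<times> fst d"
  show "open (map_prod (snd c) (snd d) ` W)"
    unfolding open_prod_def
  proof (intro ballI)
    fix z assume "z \<in> map_prod (snd c) (snd d) ` W"
    then obtain x y where xy: "(x, y) \<in> W" "z = (snd c x, snd d y)" by auto
    obtain A B where AB: "openin T A" "openin T' B" "x \<in> A" "y \<in> B" "A \<times> B \<subseteq> W"
      using W(1)[unfolded openin_prod_topology_alt, rule_format, OF xy(1)] by blast
    have "(snd c ` (fst c \<inter> A)) \<times> (snd d ` (fst d \<inter> B)) \<subseteq> map_prod (snd c) (snd d) ` W"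
      using AB(5) by force
    then show "\<exists>A B. open A \<and> open B \<and> z \<in> A \<times> B \<and> A \<times> B \<subseteq> map_prod (snd c) (snd d) ` W"
      using is_chart_open_image[OF c AB(1)] is_chart_open_image[OF d AB(2)] AB xy W(2)
      by (intro exI[of _ "snd c ` (fst c \<inter> A)"] exI[of _ "snd d ` (fst d \<inter> B)"]) auto
  qed
qed

lemma smooth_on_fst: "open S \<Longrightarrow> smooth_on S fst" and smooth_on_snd: "open S \<Longrightarrow> smooth_on S snd"
  by (auto intro: smooth_on_bounded_linear bounded_linear_fst bounded_linear_snd)

lemma smooth_on_compose_fst:
  fixes f :: "'a::model_space \<Rightarrow> 'c::real_normed_vector"
  assumes "open S" "smooth_on S f" "open T"
  shows "smooth_on (S \<times> (T :: 'b::model_space set)) (\<lambda>z. f (fst z))"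
  by (rule smooth_on_compose[OF open_Times[OF assms(1,3)] assms(1) _ smooth_on_fst[OF open_Times[OF assms(1,3)]] assms(2)]) auto

lemma smooth_on_compose_snd:
  fixes f :: "'b::model_space \<Rightarrow> 'c::real_normed_vector"
  assumes "open S" "smooth_on S f" "open T"
  shows "smooth_on ((T :: 'a::model_space set) \<times> S) (\<lambda>z. f (snd z))"
  by (rule smooth_on_compose[OF open_Times[OF assms(3,1)] assms(1) _ smooth_on_snd[OF open_Times[OF assms(3,1)]] assms(2)]) auto

lemma smooth_atlas_product:
  assumes X: "smooth_atlas X" and Y: "smooth_atlas Y"
  shows "smooth_atlas (product_manifold X Y)"
  unfolding smooth_atlas_def
proof (intro conjI ballI)
  fix c' assume "c' \<in> atlas (product_manifold X Y)"
  then obtain c d where cd: "c \<in> atlas X" "d \<in> atlas Y" "c' = (fst c \<times> fst d, map_prod (snd c) (snd d))"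
    by (auto simp: product_manifold_simps)
  show "is_chart (base_top (product_manifold X Y)) c'"
    using is_chart_product[OF atlas_chart[OF X cd(1)] atlas_chart[OF Y cd(2)]]
    by (simp add: cd product_manifold_simps)
  fix d' assume "d' \<in> atlas (product_manifold X Y)"
  then obtain a b where ab: "a \<in> atlas X" "b \<in> atlas Y" "d' = (fst a \<times> fst b, map_prod (snd a) (snd b))"
    by (auto simp: product_manifold_simps)
  let ?S = "snd c ` (fst c \<inter> fst a)" and ?T = "snd d ` (fst d \<inter> fst b)"
  have op: "open ?S" "open ?T"
    using atlas_open_image[OF X cd(1) atlas_openin[OF X ab(1)]]
      atlas_open_image[OF Y cd(2) atlas_openin[OF Y ab(2)]] .
  have "smooth_on ?S (snd a \<circ> chart_inv c)" "smooth_on ?T (snd b \<circ> chart_inv d)"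
    using X Y cd ab by (auto simp: smooth_atlas_def)
  then have "smooth_on (?S \<times> ?T) (\<lambda>z. ((snd a \<circ> chart_inv c) (fst z), (snd b \<circ> chart_inv d) (snd z)))"
    using op by (intro smooth_on_Pair smooth_on_compose_fst smooth_on_compose_snd open_Times)
  then have "smooth_on (?S \<times> ?T) (snd d' \<circ> chart_inv c')"
    by (rule smooth_on_cong[OF open_Times[OF op], rotated])
      (auto simp: cd ab chart_inv_product[OF atlas_chart[OF X cd(1)] atlas_chart[OF Y cd(2)]]
        atlas_inv[OF X cd(1)] atlas_inv[OF Y cd(2)])
  moreover have "snd c' ` (fst c' \<inter> fst d') = ?S \<times> ?T"
    by (force simp: cd ab)
  ultimately show "smooth_on (snd c' ` (fst c' \<inter> fst d')) (snd d' \<circ> chart_inv c')" by simp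
next
  have "(\<Union>c\<in>atlas X. fst c) = points X" "(\<Union>c\<in>atlas Y. fst c) = points Y"
    using X Y by (auto simp: smooth_atlas_def)
  moreover have "(\<Union>c\<in>atlas (product_manifold X Y). fst c) = (\<Union>c\<in>atlas X. fst c) \<times> (\<Union>c\<in>atlas Y. fst c)"
  proof (intro subset_antisym subsetI)
    fix z assume "z \<in> (\<Union>c\<in>atlas X. fst c) \<times> (\<Union>c\<in>atlas Y. fst c)"
    then obtain c d where cd: "c \<in> atlas X" "d \<in> atlas Y" "z \<in> fst c \<times> fst d" by auto
    then have "(fst c \<times> fst d, map_prod (snd c) (snd d)) \<in> atlas (product_manifold X Y)"
      unfolding product_manifold_simps by blast
    from UN_I[OF this, of z fst] show "z \<in> (\<Union>c\<in>atlas (product_manifold X Y). fst c)" using cd(3) by simp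
  qed (auto simp: product_manifold_simps)
  ultimately show "(\<Union>c\<in>atlas (product_manifold X Y). fst c) = points (product_manifold X Y)"
    by (simp add: product_manifold_simps)
qed

lemma smooth_map_on_Pair:
  assumes X: "smooth_atlas X" and Y: "smooth_atlas Y" and Z: "smooth_atlas Z"
    and f: "smooth_map_on X W Y f" and g: "smooth_map_on X W Z g"
  shows "smooth_map_on X W (product_manifold Y Z) (\<lambda>x. (f x, g x))"
proof (rule smooth_map_onI[OF X smooth_map_on_openin[OF f]])
  show "continuous_map (subtopology (base_top X) W) (base_top (product_manifold Y Z)) (\<lambda>x. (f x, g x))"
    using f g by (auto simp: product_manifold_simps smooth_map_on_def continuous_map_pairwise o_def)
  fix c d' p assume c: "c \<in> atlas X" and d': "d' \<in> atlas (product_manifold Y Z)"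
    and p: "p \<in> fst c" "p \<in> W" "(f p, g p) \<in> fst d'"
  obtain d e where de: "d \<in> atlas Y" "e \<in> atlas Z" "d' = (fst d \<times> fst e, map_prod (snd d) (snd e))"
    using d' by (auto simp: product_manifold_simps)
  let ?N = "(W \<inter> f -` fst d) \<inter> (W \<inter> g -` fst e)"
  have N: "openin (base_top X) ?N"
    by (intro openin_Int smooth_map_on_preimage[OF f] smooth_map_on_preimage[OF g] atlas_openin[OF Y de(1)]
        atlas_openin[OF Z de(2)])
  have "smooth_on (snd c ` (fst c \<inter> W \<inter> f -` fst d)) (\<lambda>y. snd d (f (chart_inv c y)))"
    "smooth_on (snd c ` (fst c \<inter> W \<inter> g -` fst e)) (\<lambda>y. snd e (g (chart_inv c y)))"
    using f g c de by (auto simp: smooth_map_on_def o_def)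
  then have "smooth_on (snd c ` (fst c \<inter> ?N)) (\<lambda>y. snd d (f (chart_inv c y)))"
    "smooth_on (snd c ` (fst c \<inter> ?N)) (\<lambda>y. snd e (g (chart_inv c y)))"
    by (auto elim!: smooth_on_subset)
  from smooth_on_Pair[OF atlas_open_image[OF X c N] this]
  show "\<exists>N. openin (base_top X) N \<and> p \<in> N \<and>
      smooth_on (snd c ` (fst c \<inter> N)) (\<lambda>y. snd d' (f (chart_inv c y), g (chart_inv c y)))"
    using N p by (intro exI[of _ ?N]) (auto simp: de)
qed

lemma smooth_map_Pair:
  assumes "smooth_atlas X" "smooth_atlas Y" "smooth_atlas Z" "smooth_map X Y f" "smooth_map X Z g"
  shows "smooth_map X (product_manifold Y Z) (\<lambda>x. (f x, g x))"
  using smooth_map_on_Pair[of X Y Z "points X" f g] assms by (simp add: smooth_map_on_points)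

lemma smooth_map_fst:
  assumes X: "smooth_atlas X" and Y: "smooth_atlas Y"
  shows "smooth_map (product_manifold X Y) X fst"
  unfolding smooth_map_def
proof (intro conjI ballI)
  show "continuous_map (base_top (product_manifold X Y)) (base_top X) fst"
    by (simp add: product_manifold_simps continuous_map_fst)
  fix c' a assume "c' \<in> atlas (product_manifold X Y)" and a: "a \<in> atlas X"
  then obtain c d where cd: "c \<in> atlas X" "d \<in> atlas Y" "c' = (fst c \<times> fst d, map_prod (snd c) (snd d))"
    by (auto simp: product_manifold_simps)
  let ?S = "snd c ` (fst c \<inter> fst a)" and ?T = "snd d ` (fst d \<inter> points Y)"
  have op: "open ?S" "open ?T"
    using atlas_open_image[OF X cd(1) atlas_openin[OF X a]] atlas_open_image[OF Y cd(2) openin_topspace] .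
  have "smooth_on ?S (snd a \<circ> chart_inv c)" using X cd a by (auto simp: smooth_atlas_def)
  then have "smooth_on (?S \<times> ?T) (\<lambda>z. (snd a \<circ> chart_inv c) (fst z))"
    using op by (intro smooth_on_compose_fst)
  then have "smooth_on (?S \<times> ?T) (snd a \<circ> fst \<circ> chart_inv c')"
    by (rule smooth_on_cong[OF open_Times[OF op], rotated])
      (auto simp: cd chart_inv_product[OF atlas_chart[OF X cd(1)] atlas_chart[OF Y cd(2)]] atlas_inv[OF X cd(1)])
  moreover have "snd c' ` (fst c' \<inter> fst -` fst a) \<subseteq> ?S \<times> ?T"
    using atlas_subset_points[OF Y cd(2)] by (auto simp: cd)
  ultimately show "smooth_on (snd c' ` (fst c' \<inter> fst -` fst a)) (snd a \<circ> fst \<circ> chart_inv c')"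
    by (blast intro: smooth_on_subset)
qed

lemma smooth_map_snd:
  assumes X: "smooth_atlas X" and Y: "smooth_atlas Y"
  shows "smooth_map (product_manifold X Y) Y snd"
  unfolding smooth_map_def
proof (intro conjI ballI)
  show "continuous_map (base_top (product_manifold X Y)) (base_top Y) snd"
    by (simp add: product_manifold_simps continuous_map_snd)
  fix c' a assume "c' \<in> atlas (product_manifold X Y)" and a: "a \<in> atlas Y"
  then obtain c d where cd: "c \<in> atlas X" "d \<in> atlas Y" "c' = (fst c \<times> fst d, map_prod (snd c) (snd d))"
    by (auto simp: product_manifold_simps)
  let ?S = "snd c ` (fst c \<inter> points X)" and ?T = "snd d ` (fst d \<inter> fst a)"
  have op: "open ?S" "open ?T"
    using atlas_open_image[OF X cd(1) openin_topspace] atlas_open_image[OF Y cd(2) atlas_openin[OF Y a]] .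
  have "smooth_on ?T (snd a \<circ> chart_inv d)" using Y cd a by (auto simp: smooth_atlas_def)
  then have "smooth_on (?S \<times> ?T) (\<lambda>z. (snd a \<circ> chart_inv d) (snd z))"
    using op by (intro smooth_on_compose_snd)
  then have "smooth_on (?S \<times> ?T) (snd a \<circ> snd \<circ> chart_inv c')"
    by (rule smooth_on_cong[OF open_Times[OF op], rotated])
      (auto simp: cd chart_inv_product[OF atlas_chart[OF X cd(1)] atlas_chart[OF Y cd(2)]] atlas_inv[OF Y cd(2)])
  moreover have "snd c' ` (fst c' \<inter> snd -` fst a) \<subseteq> ?S \<times> ?T"
    using atlas_subset_points[OF X cd(1)] by (auto simp: cd)
  ultimately show "smooth_on (snd c' ` (fst c' \<inter> snd -` fst a)) (snd a \<circ> snd \<circ> chart_inv c')"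
    by (blast intro: smooth_on_subset)
qed


section \<open>Differentials\<close>

lemma smooth_map_on_rep_has_derivative:
  assumes "smooth_map_on X W Y f" "p \<in> W" "c \<in> charts_at X p" "d \<in> charts_at Y (f p)"
  shows "((snd d \<circ> f \<circ> chart_inv c) has_derivative
    frechet_derivative (snd d \<circ> f \<circ> chart_inv c) (at (snd c p))) (at (snd c p))"
  by (rule smooth_on_has_derivative[of "snd c ` (fst c \<inter> W \<inter> f -` fst d)"])
    (use assms in \<open>auto simp: smooth_map_on_def charts_at_def\<close>)

text \<open>The chain rule in charts. With \<open>f\<close> or \<open>g\<close> the identity, it also says how representations change with the
  charts; this makes \<open>differential\<close> independent of the chart chosen in its definition
  (\<open>differential_apply\<close>) and a family of tangent vectors (\<open>differential_in_tangent_space\<close>).\<close>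

lemma frechet_derivative_rep_chain:
  assumes X: "smooth_atlas X" and Y: "smooth_atlas Y"
    and f: "smooth_map_on X W Y f" and g: "smooth_map_on Y V Z g" and p: "p \<in> W" "f p \<in> V"
    and c: "c \<in> charts_at X p" and d: "d \<in> charts_at Y (f p)" and e: "e \<in> charts_at Z (g (f p))"
  shows "frechet_derivative (snd e \<circ> (g \<circ> f) \<circ> chart_inv c) (at (snd c p)) a =
    frechet_derivative (snd e \<circ> g \<circ> chart_inv d) (at (snd d (f p)))
      (frechet_derivative (snd d \<circ> f \<circ> chart_inv c) (at (snd c p)) a)"
proof -
  note cX = charts_atD[OF c] and dY = charts_atD[OF d]
  let ?F = "snd d \<circ> f \<circ> chart_inv c" and ?G = "snd e \<circ> g \<circ> chart_inv d"
  have Fp: "?F (snd c p) = snd d (f p)" using atlas_inv[OF X cX] by simp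
  have "((?G \<circ> ?F) has_derivative
      (frechet_derivative ?G (at (snd d (f p))) \<circ> frechet_derivative ?F (at (snd c p)))) (at (snd c p))"
    using smooth_map_on_rep_has_derivative[OF f p(1) c d] smooth_map_on_rep_has_derivative[OF g p(2) d e]
    by (intro diff_chain_at) (simp_all only: Fp)
  then have "((snd e \<circ> (g \<circ> f) \<circ> chart_inv c) has_derivative
      (frechet_derivative ?G (at (snd d (f p))) \<circ> frechet_derivative ?F (at (snd c p)))) (at (snd c p))"
  proof (rule has_derivative_transform_within_open)
    show "open (snd c ` (fst c \<inter> (W \<inter> f -` fst d)))"
      by (rule atlas_open_image[OF X cX(1) smooth_map_on_preimage[OF f atlas_openin[OF Y dY(1)]]])
  qed (use p cX dY in \<open>auto simp: atlas_inv[OF X cX(1)] atlas_inv[OF Y dY(1)]\<close>)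
  from frechet_derivative_at[OF this] show ?thesis by (simp add: fun_eq_iff)
qed

lemma smooth_map_on_id: "smooth_atlas X \<Longrightarrow> openin (base_top X) W \<Longrightarrow> smooth_map_on X W X id"
  by (rule smooth_map_on_smooth_map) (auto intro: smooth_map_id)

lemma tangent_spaceD:
  "v \<in> tangent_space X p \<Longrightarrow> c \<in> charts_at X p \<Longrightarrow> d \<in> charts_at X p \<Longrightarrow>
    v d = frechet_derivative (snd d \<circ> chart_inv c) (at (snd c p)) (v c)"
  unfolding tangent_space_def by blast

lemma tangent_space_outside: "v \<in> tangent_space X p \<Longrightarrow> d \<notin> charts_at X p \<Longrightarrow> v d = 0"
  unfolding tangent_space_def by blast

text \<open>One chart determines a tangent vector, so identities between differentials reduce to a computation in
  a convenient chart.\<close>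

lemma tangent_eqI:
  assumes "u \<in> tangent_space X p" "v \<in> tangent_space X p" "c \<in> charts_at X p" "u c = v c"
  shows "u = v"
proof
  show "u d = v d" for d
    using tangent_spaceD[OF assms(1,3), of d] tangent_spaceD[OF assms(2,3), of d]
      tangent_space_outside[OF assms(1)] tangent_space_outside[OF assms(2)] assms(4)
    by (cases "d \<in> charts_at X p") simp_all
qed

lemma differential_apply:
  assumes X: "smooth_atlas X" and f: "smooth_map_on X W Y f" and p: "p \<in> W"
    and v: "v \<in> tangent_space X p" and c: "c \<in> charts_at X p" and d: "d \<in> charts_at Y (f p)"
  shows "differential X Y f p v d = frechet_derivative (snd d \<circ> f \<circ> chart_inv c) (at (snd c p)) (v c)"
proof -
  define c0 where "c0 = (SOME c. c \<in> charts_at X p)"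
  have c0: "c0 \<in> charts_at X p" unfolding c0_def using c by (rule someI)
  have pX: "p \<in> points X" using smooth_map_on_subset_points[OF f] p by auto
  have "differential X Y f p v d = frechet_derivative (snd d \<circ> f \<circ> chart_inv c0) (at (snd c0 p)) (v c0)"
    by (simp add: differential_def d flip: c0_def)
  also have "\<dots> = frechet_derivative (snd d \<circ> f \<circ> chart_inv c) (at (snd c p))
      (frechet_derivative (snd c \<circ> chart_inv c0) (at (snd c0 p)) (v c0))"
    using frechet_derivative_rep_chain[OF X X smooth_map_on_id[OF X openin_topspace] f, of p c0 c d "v c0"] pX p c c0 d by simp
  also have "\<dots> = frechet_derivative (snd d \<circ> f \<circ> chart_inv c) (at (snd c p)) (v c)"
    using tangent_spaceD[OF v c0 c] by simp
  finally show ?thesis .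
qed

lemma differential_outside: "d \<notin> charts_at Y (f p) \<Longrightarrow> differential X Y f p v d = 0"
  by (simp add: differential_def Let_def)

lemma frechet_derivative_tangent_space:
  assumes X: "smooth_atlas X" and Y: "smooth_atlas Y" and f: "smooth_map_on X W Y f" and p: "p \<in> W"
    and c: "c \<in> charts_at X p" and d: "d \<in> charts_at Y (f p)" "e \<in> charts_at Y (f p)"
  shows "frechet_derivative (snd e \<circ> f \<circ> chart_inv c) (at (snd c p)) a =
    frechet_derivative (snd e \<circ> chart_inv d) (at (snd d (f p)))
      (frechet_derivative (snd d \<circ> f \<circ> chart_inv c) (at (snd c p)) a)"
  using frechet_derivative_rep_chain[OF X Y f smooth_map_on_id[OF Y openin_topspace] p _ c d(1), of e a]
    d smooth_map_on_image[OF f p] by simp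

lemma differential_in_tangent_space:
  assumes X: "smooth_atlas X" and Y: "smooth_atlas Y" and f: "smooth_map_on X W Y f" and p: "p \<in> W"
    and v: "v \<in> tangent_space X p"
  shows "differential X Y f p v \<in> tangent_space Y (f p)"
proof -
  obtain c where c: "c \<in> charts_at X p"
    using atlas_cover[OF X] smooth_map_on_subset_points[OF f] p by blast
  show ?thesis
    unfolding tangent_space_def
    by (auto simp: differential_outside differential_apply[OF X f p v c]
        intro: frechet_derivative_tangent_space[OF X Y f p c])
qed

lemma differential_compose:
  assumes X: "smooth_atlas X" and Y: "smooth_atlas Y" and Z: "smooth_atlas Z"
    and f: "smooth_map_on X W Y f" and g: "smooth_map_on Y V Z g" and fW: "f ` W \<subseteq> V"
    and p: "p \<in> W" and v: "v \<in> tangent_space X p"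
  shows "differential X Z (g \<circ> f) p v = differential Y Z g (f p) (differential X Y f p v)"
proof
  fix e
  obtain c where c: "c \<in> charts_at X p"
    using atlas_cover[OF X] smooth_map_on_subset_points[OF f] p by blast
  obtain d where d: "d \<in> charts_at Y (f p)"
    using atlas_cover[OF Y smooth_map_on_image[OF f p]] by blast
  have q: "f p \<in> V" using fW p by blast
  note gf = smooth_map_on_compose[OF X Y Z f g fW]
  note dv = differential_in_tangent_space[OF X Y f p v]
  show "differential X Z (g \<circ> f) p v e = differential Y Z g (f p) (differential X Y f p v) e"
  proof (cases "e \<in> charts_at Z (g (f p))")
    case True
    then show ?thesis
      using differential_apply[OF X gf p v c, of e] differential_apply[OF Y g q dv d True]
        differential_apply[OF X f p v c d] frechet_derivative_rep_chain[OF X Y f g p q c d True]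
      by simp
  qed (simp add: differential_outside)
qed

lemma differential_cong:
  assumes X: "smooth_atlas X" and Y: "smooth_atlas Y" and f: "smooth_map_on X W Y f"
    and eq: "\<And>x. x \<in> W \<Longrightarrow> f x = g x" and p: "p \<in> W" and v: "v \<in> tangent_space X p"
  shows "differential X Y f p v = differential X Y g p v"
proof
  fix d
  obtain c where c: "c \<in> charts_at X p"
    using atlas_cover[OF X] smooth_map_on_subset_points[OF f] p by blast
  note cX = charts_atD[OF c]
  note g = smooth_map_on_cong[OF X Y f eq]
  show "differential X Y f p v d = differential X Y g p v d"
  proof (cases "d \<in> charts_at Y (f p)")
    case True
    have "frechet_derivative (snd d \<circ> f \<circ> chart_inv c) (at (snd c p)) =
      frechet_derivative (snd d \<circ> g \<circ> chart_inv c) (at (snd c p))"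
    proof (rule frechet_derivative_transform_within_open)
      show "(snd d \<circ> f \<circ> chart_inv c) differentiable at (snd c p)"
        using smooth_map_on_rep_has_derivative[OF f p c True] by (auto simp: differentiable_def)
      show "open (snd c ` (fst c \<inter> W))" by (rule atlas_open_image[OF X cX(1) smooth_map_on_openin[OF f]])
    qed (use p cX eq in \<open>auto simp: atlas_inv[OF X cX(1)]\<close>)
    then show ?thesis
      using differential_apply[OF X f p v c True] differential_apply[OF X g p v c, of d] True eq[OF p] by simp
  qed (simp add: differential_outside eq[OF p])
qed

lemma differential_id:
  assumes X: "smooth_atlas X" and p: "p \<in> points X" and v: "v \<in> tangent_space X p"
  shows "differential X X id p v = v"
proof
  fix d
  obtain c where c: "c \<in> charts_at X p" using atlas_cover[OF X p] by blast
  show "differential X X id p v d = v d"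
  proof (cases "d \<in> charts_at X p")
    case True
    then show ?thesis
      using differential_apply[OF X smooth_map_on_id[OF X openin_topspace] p v c, of d] tangent_spaceD[OF v c True] by simp
  qed (simp add: differential_outside tangent_space_outside[OF v])
qed

lemma tangent_space_linear:
  assumes X: "smooth_atlas X" and p: "p \<in> points X" and u: "u \<in> tangent_space X p" and v: "v \<in> tangent_space X p"
  shows "(\<lambda>c. r *\<^sub>R u c + s *\<^sub>R v c) \<in> tangent_space X p"
proof -
  have "linear (frechet_derivative (snd d \<circ> chart_inv c) (at (snd c p)))" if "c \<in> charts_at X p" "d \<in> charts_at X p" for c d
    using smooth_map_on_rep_has_derivative[OF smooth_map_on_id[OF X openin_topspace] p that(1), of d] that
    by (simp add: has_derivative_linear)
  then show ?thesis
    by (auto simp: tangent_space_def linear_add linear_scale tangent_space_outside[OF u] tangent_space_outside[OF v]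
        tangent_spaceD[OF u, symmetric] tangent_spaceD[OF v, symmetric])
qed

lemma differential_linear:
  assumes X: "smooth_atlas X" and f: "smooth_map_on X W Y f" and p: "p \<in> W"
  shows "differential X Y f p (\<lambda>c. r *\<^sub>R u c + s *\<^sub>R v c) =
    (\<lambda>d. r *\<^sub>R differential X Y f p u d + s *\<^sub>R differential X Y f p v d)"
proof -
  define c where "c = (SOME c. c \<in> charts_at X p)"
  have c: "c \<in> charts_at X p" unfolding c_def
    using atlas_cover[OF X] smooth_map_on_subset_points[OF f] p by (metis someI subsetD)
  have "linear (frechet_derivative (snd d \<circ> f \<circ> chart_inv c) (at (snd c p)))" if "d \<in> charts_at Y (f p)" for d
    using smooth_map_on_rep_has_derivative[OF f p c that] by (rule has_derivative_linear)
  then show ?thesis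
    by (auto simp: differential_def fun_eq_iff linear_add linear_scale simp flip: c_def)
qed

lemma coord_vector:
  assumes X: "smooth_atlas X" and c: "c \<in> charts_at X p"
  shows "coord_vector X c p a \<in> tangent_space X p" and "coord_vector X c p a c = a"
proof -
  note cX = charts_atD[OF c]
  have p: "p \<in> points X" using atlas_subset_points[OF X cX(1)] cX(2) by blast
  have "frechet_derivative (snd c \<circ> chart_inv c) (at (snd c p)) = (\<lambda>x. x)"
  proof (rule sym, rule frechet_derivative_at, rule has_derivative_transform_within_open[OF has_derivative_ident])
    show "open (snd c ` (fst c \<inter> points X))" by (rule atlas_open_image[OF X cX(1) openin_topspace])
  qed (use p cX in \<open>auto simp: atlas_inv[OF X cX(1)]\<close>)
  then show "coord_vector X c p a c = a" using c by (simp add: coord_vector_def)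
  show "coord_vector X c p a \<in> tangent_space X p"
    unfolding tangent_space_def mem_Collect_eq
  proof (intro conjI ballI allI impI)
    fix d e assume d: "d \<in> charts_at X p" and e: "e \<in> charts_at X p"
    show "coord_vector X c p a e = frechet_derivative (snd e \<circ> chart_inv d) (at (snd d p)) (coord_vector X c p a d)"
      unfolding coord_vector_def if_P[OF d] if_P[OF e]
      using frechet_derivative_tangent_space[OF X X smooth_map_on_id[OF X openin_topspace] p c, of d e a] d e
      by (simp only: comp_id id_apply)
  qed (simp add: coord_vector_def)
qed

lemma coord_vector_eq:
  assumes "smooth_atlas X" "c \<in> charts_at X p" "v \<in> tangent_space X p"
  shows "coord_vector X c p (v c) = v"
  by (rule tangent_eqI[OF coord_vector(1) assms(3,2)]) (simp_all add: assms coord_vector(2))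

section \<open>Two-forms and their pullbacks\<close>

lemma smooth_function_on_local:
  assumes X: "smooth_atlas X"
    and loc: "\<And>p. p \<in> W \<Longrightarrow> \<exists>N. openin (base_top X) N \<and> p \<in> N \<and> smooth_function_on X N h"
  shows "smooth_function_on X W h"
  unfolding smooth_function_on_def
proof (intro ballI smooth_on_local)
  fix c y assume c: "c \<in> atlas X" and "y \<in> snd c ` (fst c \<inter> W)"
  then obtain p where p: "p \<in> fst c" "p \<in> W" "y = snd c p" by auto
  obtain N where N: "openin (base_top X) N" "p \<in> N" "smooth_function_on X N h" using loc[OF p(2)] by blast
  have "smooth_on (snd c ` (fst c \<inter> N)) (h \<circ> chart_inv c)"
    using N(3) c by (simp add: smooth_function_on_def)
  then show "\<exists>T. open T \<and> y \<in> T \<and> smooth_on T (h \<circ> chart_inv c)"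
    using atlas_open_image[OF X c N(1)] N(2) p by blast
qed

lemma smooth_function_on_cong:
  assumes X: "smooth_atlas X" and W: "openin (base_top X) W"
    and eq: "\<And>p. p \<in> W \<Longrightarrow> h p = k p" and h: "smooth_function_on X W h"
  shows "smooth_function_on X W k"
  unfolding smooth_function_on_def
proof
  fix c assume c: "c \<in> atlas X"
  have "smooth_on (snd c ` (fst c \<inter> W)) (h \<circ> chart_inv c)"
    using h c by (simp add: smooth_function_on_def)
  then show "smooth_on (snd c ` (fst c \<inter> W)) (k \<circ> chart_inv c)"
    by (rule smooth_on_cong[OF atlas_open_image[OF X c W], rotated]) (auto simp: atlas_inv[OF X c] eq)
qed

lemma smooth_vector_field_on_subset:
  assumes "smooth_vector_field_on X W A" "V \<subseteq> W"
  shows "smooth_vector_field_on X V A"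
  unfolding smooth_vector_field_on_def
proof (intro conjI ballI)
  show "smooth_on (snd c ` (fst c \<inter> V)) (\<lambda>x. A (chart_inv c x) c)" if "c \<in> atlas X" for c
    by (rule smooth_on_subset[of "snd c ` (fst c \<inter> W)"])
      (use assms that in \<open>auto simp: smooth_vector_field_on_def\<close>)
qed (use assms in \<open>auto simp: smooth_vector_field_on_def\<close>)

lemma smooth_coord_field:
  assumes X: "smooth_atlas X" and c: "c \<in> atlas X"
  shows "smooth_vector_field_on X (fst c) (\<lambda>p. coord_vector X c p a)"
  unfolding smooth_vector_field_on_def
proof (intro conjI ballI)
  show "coord_vector X c p a \<in> tangent_space X p" if "p \<in> fst c" for p
    by (rule coord_vector(1)[OF X]) (use c that in \<open>simp add: charts_at_def\<close>)
  fix e assume e: "e \<in> atlas X"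
  let ?S = "snd e ` (fst e \<inter> fst c)" and ?T = "snd c ` (fst c \<inter> fst e)"
  have S: "open ?S" and T: "open ?T"
    using atlas_open_image[OF X e atlas_openin[OF X c]] atlas_open_image[OF X c atlas_openin[OF X e]] .
  have ce: "smooth_on ?T (snd e \<circ> chart_inv c)" and ec: "smooth_on ?S (snd c \<circ> chart_inv e)"
    using X c e by (simp_all add: smooth_atlas_def)
  have sub: "(snd c \<circ> chart_inv e) ` ?S \<subseteq> ?T" by (auto simp: atlas_inv[OF X e])
  have "smooth_on ?S (\<lambda>x. frechet_derivative (snd e \<circ> chart_inv c) (at ((snd c \<circ> chart_inv e) x)) a)"
    by (rule smooth_on_compose[OF S T sub ec smooth_on_directional_derivative[OF T ce smooth_on_const]])
  then show "smooth_on ?S (\<lambda>x. coord_vector X c (chart_inv e x) a e)"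
    by (rule smooth_on_cong[OF S, rotated])
      (use e in \<open>auto simp: atlas_inv[OF X e] coord_vector_def charts_at_def\<close>)
qed

lemma smooth_section_Lambda2_dualD:
  assumes "smooth_section_Lambda2_dual X V \<omega>" "openin (base_top X) W"
    and "smooth_vector_field_on X W A" "\<And>p. p \<in> W \<Longrightarrow> A p \<in> V p"
    and "smooth_vector_field_on X W B" "\<And>p. p \<in> W \<Longrightarrow> B p \<in> V p"
  shows "smooth_function_on X W (\<lambda>p. \<omega> p (A p) (B p))"
proof -
  have "openin (base_top X) W \<and> smooth_vector_field_on X W A \<and> (\<forall>p\<in>W. A p \<in> V p) \<and>
      smooth_vector_field_on X W B \<and> (\<forall>p\<in>W. B p \<in> V p) \<longrightarrow> smooth_function_on X W (\<lambda>p. \<omega> p (A p) (B p))"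
    using assms(1) unfolding smooth_section_Lambda2_dual_def by (elim conjE, intro impI) (erule allE[of _ W], erule allE[of _ A], erule allE[of _ B], erule mp)
  with assms show ?thesis by simp
qed

text \<open>Smoothness of a form is a condition on smooth fields; on the coordinate fields of a chart it says that the
  coefficients are smooth.\<close>

lemma smooth_local_form:
  assumes X: "smooth_atlas X" and c: "c \<in> atlas X" and \<omega>: "smooth_two_form X \<omega>"
  shows "smooth_on (snd c ` fst c) (\<lambda>x. local_form X \<omega> c x a b)"
proof -
  have "smooth_function_on X (fst c) (\<lambda>p. \<omega> p (coord_vector X c p a) (coord_vector X c p b))"
    by (rule smooth_section_Lambda2_dualD[OF \<omega> atlas_openin[OF X c] smooth_coord_field[OF X c] _ smooth_coord_field[OF X c]])
      (use smooth_coord_field[OF X c] in \<open>simp_all add: smooth_vector_field_on_def\<close>)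
  then show ?thesis
    using c by (auto simp: smooth_function_on_def local_form_def Let_def o_def)
qed

lemma coord_vector_linear:
  assumes X: "smooth_atlas X" and c: "c \<in> charts_at X p"
  shows "coord_vector X c p (a + b) = (\<lambda>d. coord_vector X c p a d + coord_vector X c p b d)"
    and "coord_vector X c p (r *\<^sub>R a) = (\<lambda>d. r *\<^sub>R coord_vector X c p a d)"
proof -
  have p: "p \<in> points X" using atlas_subset_points[OF X] charts_atD[OF c] by blast
  have "linear (frechet_derivative (snd d \<circ> chart_inv c) (at (snd c p)))" if "d \<in> charts_at X p" for d
    using smooth_map_on_rep_has_derivative[OF smooth_map_on_id[OF X openin_topspace] p c, of d] that
    by (simp add: has_derivative_linear)
  then show "coord_vector X c p (a + b) = (\<lambda>d. coord_vector X c p a d + coord_vector X c p b d)"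
    "coord_vector X c p (r *\<^sub>R a) = (\<lambda>d. r *\<^sub>R coord_vector X c p a d)"
    by (auto simp: coord_vector_def fun_eq_iff linear_add linear_scale)
qed

lemma bilinear_coord_expansion:
  assumes X: "smooth_atlas X" and c: "c \<in> charts_at X p"
    and alt: "alternating_bilinear (tangent_space X p) \<beta>"
  shows "\<beta> (coord_vector X c p a) (coord_vector X c p b) =
    (\<Sum>i\<in>frame. \<Sum>j\<in>frame. (a \<bullet> i) * (b \<bullet> j) * \<beta> (coord_vector X c p i) (coord_vector X c p j))"
proof -
  let ?v = "coord_vector X c p"
  note mem = coord_vector(1)[OF X c] and lin = coord_vector_linear[OF X c]
  have l: "linear (\<lambda>a. \<beta> (?v a) (?v b))" for b
    using alt mem by (intro linearI) (auto simp: lin alternating_bilinear_def)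
  have r: "linear (\<lambda>b. \<beta> (?v a) (?v b))" for a
    using alt mem by (intro linearI) (auto simp: lin alternating_bilinear_def)
  show ?thesis
    by (subst linear_frame_expansion[OF l], subst linear_frame_expansion[OF r])
      (simp add: sum_distrib_left mult.assoc)
qed

lemma pullback_compose:
  assumes "smooth_atlas X" "smooth_atlas Y" "smooth_atlas Z"
    and "smooth_map_on X W Y f" "smooth_map_on Y V Z g" "f ` W \<subseteq> V"
    and "p \<in> W" "u \<in> tangent_space X p" "v \<in> tangent_space X p"
  shows "pullback X Z (g \<circ> f) \<omega> p u v = pullback X Y f (pullback Y Z g \<omega>) p u v"
  using differential_compose[OF assms(1-7)] assms(8,9) by (simp add: pullback_def)

text \<open>The subspace \<open>V\<close> is a full tangent space for the forms on the fibres and the vertical space for the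
  form on the total space.\<close>

lemma alternating_bilinear_pullback:
  assumes X: "smooth_atlas X" and Y: "smooth_atlas Y" and f: "smooth_map_on X W Y f" and p: "p \<in> W"
    and V: "V \<subseteq> tangent_space X p"
    and lin: "\<And>r s u v. u \<in> V \<Longrightarrow> v \<in> V \<Longrightarrow> (\<lambda>c. r *\<^sub>R u c + s *\<^sub>R v c) \<in> V"
    and alt: "alternating_bilinear (tangent_space Y (f p)) (\<omega> (f p))"
    and eq: "\<And>u v. u \<in> V \<Longrightarrow> v \<in> V \<Longrightarrow> \<beta> u v = pullback X Y f \<omega> p u v"
  shows "alternating_bilinear V \<beta>"
proof -
  let ?D = "differential X Y f p"
  have mem: "?D u \<in> tangent_space Y (f p)" if "u \<in> V" for u
    using differential_in_tangent_space[OF X Y f p] V that by blast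
  have add: "(\<lambda>c. u c + v c) \<in> V" "?D (\<lambda>c. u c + v c) = (\<lambda>d. ?D u d + ?D v d)"
    if "u \<in> V" "v \<in> V" for u v
    using lin[OF that, of 1 1] differential_linear[OF X f p, of 1 u 1 v] by simp_all
  have scale: "(\<lambda>c. r *\<^sub>R u c) \<in> V" "?D (\<lambda>c. r *\<^sub>R u c) = (\<lambda>d. r *\<^sub>R ?D u d)" if "u \<in> V" for u r
    using lin[OF that that, of r 0] differential_linear[OF X f p, of r u 0 u] by simp_all
  show ?thesis
    using alt unfolding alternating_bilinear_def
    by (simp add: eq pullback_def add scale mem)
qed

text \<open>In a chart \<open>d\<close> of the target the form has smooth coefficients, and the coordinates of the image of a
  field \<open>A\<close> are the directional derivatives of the representation of \<open>f\<close> along \<open>A\<close>. The value of the pullback is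
  thus a finite sum of products of smooth functions.\<close>

lemma smooth_function_pullback:
  assumes X: "smooth_atlas X" and Y: "smooth_atlas Y" and f: "smooth_map_on X W Y f"
    and \<omega>: "smooth_two_form Y \<omega>"
    and A: "smooth_vector_field_on X W A" and B: "smooth_vector_field_on X W B"
  shows "smooth_function_on X W (\<lambda>p. pullback X Y f \<omega> p (A p) (B p))"
  unfolding smooth_function_on_def
proof (intro ballI smooth_on_local)
  fix c y assume c: "c \<in> atlas X" and "y \<in> snd c ` (fst c \<inter> W)"
  then obtain p where p: "p \<in> fst c" "p \<in> W" "y = snd c p" by auto
  obtain d where d: "d \<in> atlas Y" "f p \<in> fst d"
    using atlas_cover[OF Y smooth_map_on_image[OF f p(2)]] by (auto simp: charts_at_def)
  let ?N = "W \<inter> f -` fst d"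
  let ?S = "snd c ` (fst c \<inter> ?N)"
  let ?Q = "snd d \<circ> f \<circ> chart_inv c"
  have S: "open ?S"
    by (rule atlas_open_image[OF X c smooth_map_on_preimage[OF f atlas_openin[OF Y d(1)]]])
  have Q: "smooth_on ?S ?Q"
    using smooth_map_on_rep[OF f c d(1)] by (simp add: Int_assoc)
  have field: "smooth_on ?S (\<lambda>x. C (chart_inv c x) c)" if "smooth_vector_field_on X W C" for C
    by (rule smooth_on_subset[of "snd c ` (fst c \<inter> W)"])
      (use that c in \<open>auto simp: smooth_vector_field_on_def\<close>)
  define a b where "a x = frechet_derivative ?Q (at x) (A (chart_inv c x) c)"
    and "b x = frechet_derivative ?Q (at x) (B (chart_inv c x) c)" for x
  have a: "smooth_on ?S (\<lambda>x. a x \<bullet> i)" and b: "smooth_on ?S (\<lambda>x. b x \<bullet> i)" for i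
    using smooth_on_compose_bounded_linear[OF S bounded_linear_inner_left
        smooth_on_directional_derivative[OF S Q field[OF A]], of i]
      smooth_on_compose_bounded_linear[OF S bounded_linear_inner_left
        smooth_on_directional_derivative[OF S Q field[OF B]], of i]
    by (simp_all add: a_def b_def)
  have T: "open (snd d ` fst d)" using atlas_open_image[OF Y d(1) atlas_openin[OF Y d(1)]] by simp
  have loc: "smooth_on ?S (\<lambda>x. local_form Y \<omega> d (?Q x) i j)" for i j
    by (rule smooth_on_compose[OF S T _ Q smooth_local_form[OF Y d(1) \<omega>]]) (auto simp: atlas_inv[OF X c])
  have "smooth_on ?S (\<lambda>x. \<Sum>i\<in>frame. \<Sum>j\<in>frame. (a x \<bullet> i) * (b x \<bullet> j) * local_form Y \<omega> d (?Q x) i j)"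
    by (intro smooth_on_sum[OF S] smooth_on_mult[OF S] a b loc)
  then have "smooth_on ?S ((\<lambda>p. pullback X Y f \<omega> p (A p) (B p)) \<circ> chart_inv c)"
  proof (rule smooth_on_cong[OF S, rotated])
    fix x assume "x \<in> ?S"
    then obtain q where q: "q \<in> fst c" "q \<in> W" "f q \<in> fst d" "x = snd c q" by auto
    have cq: "c \<in> charts_at X q" and dq: "d \<in> charts_at Y (f q)" using q c d by (auto simp: charts_at_def)
    have D: "differential X Y f q (C q) = coord_vector Y d (f q) (frechet_derivative ?Q (at x) (C q c))"
      if "smooth_vector_field_on X W C" for C
    proof -
      have Cq: "C q \<in> tangent_space X q" using that q(2) by (simp add: smooth_vector_field_on_def)
      show ?thesis
        using coord_vector_eq[OF Y dq differential_in_tangent_space[OF X Y f q(2) Cq]]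
          differential_apply[OF X f q(2) Cq cq dq] by (simp add: q)
    qed
    have alt: "alternating_bilinear (tangent_space Y (f q)) (\<omega> (f q))"
      using \<omega> smooth_map_on_image[OF f q(2)] by (simp add: smooth_section_Lambda2_dual_def)
    have Qx: "chart_inv d (?Q x) = f q" using q by (simp add: atlas_inv[OF X c] atlas_inv[OF Y d(1)])
    have "((\<lambda>p. pullback X Y f \<omega> p (A p) (B p)) \<circ> chart_inv c) x =
        \<omega> (f q) (coord_vector Y d (f q) (a x)) (coord_vector Y d (f q) (b x))"
      using q by (simp add: pullback_def D[OF A] D[OF B] a_def b_def atlas_inv[OF X c])
    also have "\<dots> = (\<Sum>i\<in>frame. \<Sum>j\<in>frame. (a x \<bullet> i) * (b x \<bullet> j) * local_form Y \<omega> d (?Q x) i j)"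
      unfolding local_form_def Qx Let_def by (rule bilinear_coord_expansion[OF Y dq alt])
    finally show "(\<Sum>i\<in>frame. \<Sum>j\<in>frame. (a x \<bullet> i) * (b x \<bullet> j) * local_form Y \<omega> d (?Q x) i j) =
        ((\<lambda>p. pullback X Y f \<omega> p (A p) (B p)) \<circ> chart_inv c) x" by simp
  qed
  then show "\<exists>T. open T \<and> y \<in> T \<and> smooth_on T ((\<lambda>p. pullback X Y f \<omega> p (A p) (B p)) \<circ> chart_inv c)"
    using S p d by (intro exI[of _ ?S]) auto
qed


section \<open>Diffeomorphisms\<close>

lemma diffeomorphismD:
  assumes "diffeomorphism X Y f"
  shows "bij_betw f (points X) (points Y)" "smooth_map X Y f" "smooth_map Y X (inv_into (points X) f)"
    and "x \<in> points X \<Longrightarrow> inv_into (points X) f (f x) = x"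
    and "y \<in> points Y \<Longrightarrow> f (inv_into (points X) f y) = y"
    and "x \<in> points X \<Longrightarrow> f x \<in> points Y"
    and "y \<in> points Y \<Longrightarrow> inv_into (points X) f y \<in> points X"
  using assms by (auto simp: diffeomorphism_def bij_betw_inv_into_left bij_betw_inv_into_right
      dest: bij_betwE bij_betw_inv_into)

lemma diffeomorphism_compose:
  assumes X: "smooth_atlas X" and Y: "smooth_atlas Y" and Z: "smooth_atlas Z"
    and f: "diffeomorphism X Y f" and g: "diffeomorphism Y Z g"
  shows "diffeomorphism X Z (g \<circ> f)"
proof -
  note F = diffeomorphismD[OF f] and G = diffeomorphismD[OF g]
  have bij: "bij_betw (g \<circ> f) (points X) (points Z)" using F(1) G(1) by (rule bij_betw_trans)
  have "smooth_map Z X (inv_into (points X) f \<circ> inv_into (points Y) g)"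
    by (rule smooth_map_compose[OF Z Y X G(3) F(3)])
  moreover have "(inv_into (points X) f \<circ> inv_into (points Y) g) z = inv_into (points X) (g \<circ> f) z"
    if "z \<in> points Z" for z
    using that G(5)[OF that] G(7)[OF that] F(5,7) bij
    by (intro inv_into_f_eq[symmetric]) (auto simp: bij_betw_def)
  ultimately have "smooth_map Z X (inv_into (points X) (g \<circ> f))"
    by (rule smooth_map_cong[OF Z X])
  then show ?thesis
    using bij smooth_map_compose[OF X Y Z F(2) G(2)] by (simp add: diffeomorphism_def)
qed

lemma diffeomorphism_cong:
  assumes X: "smooth_atlas X" and Y: "smooth_atlas Y" and f: "diffeomorphism X Y f"
    and eq: "\<And>x. x \<in> points X \<Longrightarrow> f x = g x"
  shows "diffeomorphism X Y g"
proof -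
  note F = diffeomorphismD[OF f]
  have bij: "bij_betw g (points X) (points Y)" using F(1) eq by (metis bij_betw_cong)
  have "inv_into (points X) f y = inv_into (points X) g y" if "y \<in> points Y" for y
    using F(5)[OF that] F(7)[OF that] eq bij by (intro inv_into_f_eq[symmetric]) (auto simp: bij_betw_def)
  then show ?thesis
    using bij smooth_map_cong[OF X Y F(2) eq] smooth_map_cong[OF Y X F(3)] by (simp add: diffeomorphism_def)
qed

lemma diffeomorphism_inv:
  assumes X: "smooth_atlas X" and Y: "smooth_atlas Y" and f: "diffeomorphism X Y f"
  shows "diffeomorphism Y X (inv_into (points X) f)"
proof -
  note F = diffeomorphismD[OF f]
  have "smooth_map X Y (inv_into (points Y) (inv_into (points X) f))"
    by (rule smooth_map_cong[OF X Y F(2)]) (simp add: inv_into_inv_into_eq[OF F(1)])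
  then show ?thesis using F bij_betw_inv_into[OF F(1)] by (simp add: diffeomorphism_def)
qed

lemma smooth_map_smooth_map_on:
  "smooth_atlas X \<Longrightarrow> smooth_map X Y f \<Longrightarrow> smooth_map_on X (points X) Y f"
  by (simp add: smooth_map_on_points)

lemma diffeomorphism_differential_inverse:
  assumes X: "smooth_atlas X" and Y: "smooth_atlas Y" and f: "diffeomorphism X Y f"
    and p: "p \<in> points X" and u: "u \<in> tangent_space X p"
  shows "differential Y X (inv_into (points X) f) (f p) (differential X Y f p u) = u"
proof -
  note F = diffeomorphismD[OF f]
  let ?g = "inv_into (points X) f"
  note fo = smooth_map_smooth_map_on[OF X F(2)] and go = smooth_map_smooth_map_on[OF Y F(3)]
  have sub: "f ` points X \<subseteq> points Y" using F(6) by blast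
  have "differential Y X ?g (f p) (differential X Y f p u) = differential X X (?g \<circ> f) p u"
    by (rule differential_compose[OF X Y X fo go sub p u, symmetric])
  also have "\<dots> = differential X X id p u"
    by (rule differential_cong[OF X X smooth_map_on_compose[OF X Y X fo go sub] _ p u]) (simp add: F(4))
  finally show ?thesis using differential_id[OF X p u] by simp
qed

text \<open>A vector in the kernel of the pulled back form is mapped into the kernel of \<open>\<omega>\<close>, because the differential of
  a diffeomorphism is onto; and it is determined by its image.\<close>

lemma nondegenerate_pullback:
  assumes X: "smooth_atlas X" and Y: "smooth_atlas Y" and f: "diffeomorphism X Y f"
    and \<omega>: "nondegenerate_two_form Y \<omega>"
  shows "nondegenerate_two_form X (pullback X Y f \<omega>)"
  unfolding nondegenerate_two_form_def
proof (intro ballI impI)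
  fix p u assume p: "p \<in> points X" and u: "u \<in> tangent_space X p"
    and null: "\<forall>v\<in>tangent_space X p. pullback X Y f \<omega> p u v = 0"
  note F = diffeomorphismD[OF f]
  let ?g = "inv_into (points X) f"
  note fo = smooth_map_smooth_map_on[OF X F(2)] and go = smooth_map_smooth_map_on[OF Y F(3)]
  note g = diffeomorphism_inv[OF X Y f]
  let ?u = "differential X Y f p u"
  have q: "f p \<in> points Y" and gf: "?g (f p) = p" using F(4,6) p by auto
  have "\<omega> (f p) ?u w = 0" if w: "w \<in> tangent_space Y (f p)" for w
  proof -
    have w': "differential Y X ?g (f p) w \<in> tangent_space X p"
      using differential_in_tangent_space[OF Y X go q w] by (simp add: gf)
    have "differential X Y (inv_into (points Y) ?g) (?g (f p)) (differential Y X ?g (f p) w) = w"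
      by (rule diffeomorphism_differential_inverse[OF Y X g q w])
    moreover have "differential X Y f p (differential Y X ?g (f p) w) =
        differential X Y (inv_into (points Y) ?g) p (differential Y X ?g (f p) w)"
      by (rule differential_cong[OF X Y fo _ p w']) (simp add: inv_into_inv_into_eq[OF F(1)])
    ultimately have "differential X Y f p (differential Y X ?g (f p) w) = w" by (simp add: gf)
    then show ?thesis using null w' by (force simp: pullback_def)
  qed
  then have "?u = (\<lambda>c. 0)"
    using \<omega> q differential_in_tangent_space[OF X Y fo p u] by (simp add: nondegenerate_two_form_def)
  then have "u = differential Y X ?g (f p) (\<lambda>c. 0)"
    using diffeomorphism_differential_inverse[OF X Y f p u] by simp
  also have "\<dots> = (\<lambda>c. 0)"
    using differential_linear[OF Y go q, of 0 "\<lambda>c. 0" 0 "\<lambda>c. 0"] by simp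
  finally show "u = (\<lambda>c. 0)" .
qed


section \<open>Lie groups and their isomorphisms\<close>

lemma is_lie_groupD:
  assumes "is_lie_group G"
  shows "group G" "smooth_atlas (mfd G)" "carrier G = points (mfd G)"
  using assms by (auto simp: is_lie_group_def smooth_manifold_atlas)

lemma smooth_map_left_translation:
  assumes G: "is_lie_group G" and g: "g \<in> carrier G"
  shows "smooth_map (mfd G) (mfd G) (\<lambda>x. g \<otimes>\<^bsub>G\<^esub> x)"
proof -
  note D = is_lie_groupD[OF G]
  have "smooth_map (mfd G) (product_manifold (mfd G) (mfd G)) (\<lambda>x. (g, id x))"
    using g D by (intro smooth_map_Pair smooth_map_const smooth_map_id) auto
  then have "smooth_map (mfd G) (mfd G) ((\<lambda>(x, y). x \<otimes>\<^bsub>G\<^esub> y) \<circ> (\<lambda>x. (g, id x)))"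
    using G D by (intro smooth_map_compose[OF D(2) smooth_atlas_product[OF D(2) D(2)] D(2)]) (auto simp: is_lie_group_def)
  then show ?thesis by (simp add: o_def)
qed

lemma lie_group_isosD:
  assumes "\<phi> \<in> lie_group_isos H G"
  shows "\<phi> \<in> iso H G" "diffeomorphism (mfd H) (mfd G) \<phi>"
  using assms by (auto simp: lie_group_isos_def)

text \<open>A homomorphism intertwines left translations: \<open>\<phi> \<circ> L\<^sub>g = L\<^bsub>\<phi>(g)\<^esub> \<circ> \<phi>\<close>.\<close>

lemma left_invariant_pullback:
  assumes H: "is_lie_group H" and G: "is_lie_group G" and \<phi>: "\<phi> \<in> lie_group_isos H G"
    and \<omega>: "left_invariant G \<omega>" and eq: "equal_two_forms (mfd H) \<alpha> (pullback (mfd H) (mfd G) \<phi> \<omega>)"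
  shows "left_invariant H \<alpha>"
  unfolding left_invariant_def equal_two_forms_def
proof (intro ballI)
  fix g p u v
  assume g: "g \<in> carrier H" and p: "p \<in> points (mfd H)"
    and u: "u \<in> tangent_space (mfd H) p" and v: "v \<in> tangent_space (mfd H) p"
  note HD = is_lie_groupD[OF H] and GD = is_lie_groupD[OF G]
  note F = diffeomorphismD[OF lie_group_isosD(2)[OF \<phi>]]
  have hom: "\<phi> (x \<otimes>\<^bsub>H\<^esub> y) = \<phi> x \<otimes>\<^bsub>G\<^esub> \<phi> y" if "x \<in> carrier H" "y \<in> carrier H" for x y
    using lie_group_isosD(1)[OF \<phi>] that by (simp add: iso_def hom_mult)
  have \<phi>g: "\<phi> g \<in> carrier G" using g F(6) HD(3) GD(3) by simp
  let ?L = "\<lambda>x. g \<otimes>\<^bsub>H\<^esub> x" and ?M = "\<lambda>x. \<phi> g \<otimes>\<^bsub>G\<^esub> x"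
  note Lo = smooth_map_smooth_map_on[OF HD(2) smooth_map_left_translation[OF H g]]
  note Mo = smooth_map_smooth_map_on[OF GD(2) smooth_map_left_translation[OF G \<phi>g]]
  note \<phi>o = smooth_map_smooth_map_on[OF HD(2) F(2)]
  have subL: "?L ` points (mfd H) \<subseteq> points (mfd H)"
    using smooth_map_on_image[OF Lo] by blast
  have sub\<phi>: "\<phi> ` points (mfd H) \<subseteq> points (mfd G)" using F(6) by blast
  have comm: "(\<phi> \<circ> ?L) x = (?M \<circ> \<phi>) x" if "x \<in> points (mfd H)" for x
    using hom[OF g] that HD(3) by simp
  have D: "differential (mfd H) (mfd G) \<phi> (?L p) (differential (mfd H) (mfd H) ?L p w) =
      differential (mfd G) (mfd G) ?M (\<phi> p) (differential (mfd H) (mfd G) \<phi> p w)"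
    if w: "w \<in> tangent_space (mfd H) p" for w
  proof -
    have "differential (mfd H) (mfd G) \<phi> (?L p) (differential (mfd H) (mfd H) ?L p w) =
        differential (mfd H) (mfd G) (\<phi> \<circ> ?L) p w"
      by (rule differential_compose[OF HD(2) HD(2) GD(2) Lo \<phi>o subL p w, symmetric])
    also have "\<dots> = differential (mfd H) (mfd G) (?M \<circ> \<phi>) p w"
      by (rule differential_cong[OF HD(2) GD(2) smooth_map_on_compose[OF HD(2) HD(2) GD(2) Lo \<phi>o subL] comm p w])
    also have "\<dots> = differential (mfd G) (mfd G) ?M (\<phi> p) (differential (mfd H) (mfd G) \<phi> p w)"
      by (rule differential_compose[OF HD(2) GD(2) GD(2) \<phi>o Mo sub\<phi> p w])
    finally show ?thesis .
  qed
  have \<phi>p: "\<phi> p \<in> points (mfd G)" using F(6)[OF p] .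
  have Dmem: "differential (mfd H) (mfd G) \<phi> p w \<in> tangent_space (mfd G) (\<phi> p)"
    if "w \<in> tangent_space (mfd H) p" for w
    by (rule differential_in_tangent_space[OF HD(2) GD(2) \<phi>o p that])
  have Lmem: "differential (mfd H) (mfd H) ?L p w \<in> tangent_space (mfd H) (?L p)"
    if "w \<in> tangent_space (mfd H) p" for w
    by (rule differential_in_tangent_space[OF HD(2) HD(2) Lo p that])
  have Lp: "?L p \<in> points (mfd H)" using subL p by blast
  have "pullback (mfd H) (mfd H) ?L \<alpha> p u v = pullback (mfd G) (mfd G) ?M \<omega> (\<phi> p)
      (differential (mfd H) (mfd G) \<phi> p u) (differential (mfd H) (mfd G) \<phi> p v)"
    using eq Lp Lmem[OF u] Lmem[OF v] comm[OF p] by (simp add: equal_two_forms_def pullback_def D[OF u] D[OF v])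
  also have "\<dots> = \<omega> (\<phi> p) (differential (mfd H) (mfd G) \<phi> p u) (differential (mfd H) (mfd G) \<phi> p v)"
    using \<omega> \<phi>g \<phi>p Dmem[OF u] Dmem[OF v] by (simp add: left_invariant_def equal_two_forms_def)
  also have "\<dots> = \<alpha> p u v"
    using eq p u v by (simp add: equal_two_forms_def pullback_def)
  finally show "pullback (mfd H) (mfd H) ?L \<alpha> p u v = \<alpha> p u v" .
qed

lemma Aut_symplectic_eq: "Aut_symplectic G \<omega> = symplectic_lie_group_isos G \<omega> G \<omega>"
  by (simp add: Aut_symplectic_def symplectic_lie_group_isos_def Aut_lie_group_def)

lemma symplectic_lie_group_isosD:
  assumes "\<phi> \<in> symplectic_lie_group_isos H \<alpha> G \<beta>"
  shows "\<phi> \<in> iso H G" "diffeomorphism (mfd H) (mfd G) \<phi>"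
    and "p \<in> points (mfd H) \<Longrightarrow> u \<in> tangent_space (mfd H) p \<Longrightarrow> v \<in> tangent_space (mfd H) p \<Longrightarrow>
      pullback (mfd H) (mfd G) \<phi> \<beta> p u v = \<alpha> p u v"
  using assms by (auto simp: symplectic_lie_group_isos_def lie_group_isos_def equal_two_forms_def)

lemma symplectic_lie_group_isosI:
  assumes "\<phi> \<in> iso H G" "diffeomorphism (mfd H) (mfd G) \<phi>"
    and "\<And>p u v. p \<in> points (mfd H) \<Longrightarrow> u \<in> tangent_space (mfd H) p \<Longrightarrow> v \<in> tangent_space (mfd H) p \<Longrightarrow>
      pullback (mfd H) (mfd G) \<phi> \<beta> p u v = \<alpha> p u v"
  shows "\<phi> \<in> symplectic_lie_group_isos H \<alpha> G \<beta>"
  using assms by (auto simp: symplectic_lie_group_isos_def lie_group_isos_def equal_two_forms_def)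

lemma symplectic_lie_group_isos_compose:
  assumes H: "is_lie_group H" and G: "is_lie_group G" and K: "is_lie_group K"
    and \<phi>: "\<phi> \<in> symplectic_lie_group_isos H \<alpha> G \<beta>" and \<psi>: "\<psi> \<in> symplectic_lie_group_isos G \<beta> K \<gamma>"
  shows "\<psi> \<circ> \<phi> \<in> symplectic_lie_group_isos H \<alpha> K \<gamma>"
proof (rule symplectic_lie_group_isosI)
  note HD = is_lie_groupD[OF H] and GD = is_lie_groupD[OF G] and KD = is_lie_groupD[OF K]
  note P = symplectic_lie_group_isosD[OF \<phi>] and Q = symplectic_lie_group_isosD[OF \<psi>]
  show "\<psi> \<circ> \<phi> \<in> iso H K" by (rule iso_set_trans[OF P(1) Q(1)])
  show "diffeomorphism (mfd H) (mfd K) (\<psi> \<circ> \<phi>)"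
    by (rule diffeomorphism_compose[OF HD(2) GD(2) KD(2) P(2) Q(2)])
  fix p u v
  assume p: "p \<in> points (mfd H)" and u: "u \<in> tangent_space (mfd H) p" and v: "v \<in> tangent_space (mfd H) p"
  note \<phi>o = smooth_map_smooth_map_on[OF HD(2) diffeomorphismD(2)[OF P(2)]]
  note \<psi>o = smooth_map_smooth_map_on[OF GD(2) diffeomorphismD(2)[OF Q(2)]]
  have sub: "\<phi> ` points (mfd H) \<subseteq> points (mfd G)" using diffeomorphismD(6)[OF P(2)] by blast
  have "pullback (mfd H) (mfd K) (\<psi> \<circ> \<phi>) \<gamma> p u v =
      pullback (mfd H) (mfd G) \<phi> (pullback (mfd G) (mfd K) \<psi> \<gamma>) p u v"
    by (rule pullback_compose[OF HD(2) GD(2) KD(2) \<phi>o \<psi>o sub p u v])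
  also have "\<dots> = pullback (mfd H) (mfd G) \<phi> \<beta> p u v"
    unfolding pullback_def[of "mfd H"]
    by (intro Q(3) differential_in_tangent_space[OF HD(2) GD(2) \<phi>o p] u v) (use sub p in blast)
  also have "\<dots> = \<alpha> p u v" by (rule P(3)[OF p u v])
  finally show "pullback (mfd H) (mfd K) (\<psi> \<circ> \<phi>) \<gamma> p u v = \<alpha> p u v" .
qed

lemma symplectic_lie_group_isos_inv:
  assumes H: "is_lie_group H" and G: "is_lie_group G" and \<phi>: "\<phi> \<in> symplectic_lie_group_isos H \<alpha> G \<beta>"
  shows "inv_into (carrier H) \<phi> \<in> symplectic_lie_group_isos G \<beta> H \<alpha>"
proof (rule symplectic_lie_group_isosI)
  note HD = is_lie_groupD[OF H] and GD = is_lie_groupD[OF G]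
  note P = symplectic_lie_group_isosD[OF \<phi>]
  note F = diffeomorphismD[OF P(2)]
  let ?g = "inv_into (carrier H) \<phi>"
  have F4: "?g (\<phi> x) = x" if "x \<in> points (mfd H)" for x using F(4)[OF that] HD(3) by simp
  have F5: "\<phi> (?g y) = y" if "y \<in> points (mfd G)" for y using F(5)[OF that] HD(3) by simp
  show "?g \<in> iso G H" using group.iso_set_sym[OF HD(1) P(1)] .
  show dif: "diffeomorphism (mfd G) (mfd H) ?g"
    using diffeomorphism_inv[OF HD(2) GD(2) P(2)] HD(3) by simp
  fix q u v
  assume q: "q \<in> points (mfd G)" and u: "u \<in> tangent_space (mfd G) q" and v: "v \<in> tangent_space (mfd G) q"
  note \<phi>o = smooth_map_smooth_map_on[OF HD(2) F(2)]
  note go = smooth_map_smooth_map_on[OF GD(2) diffeomorphismD(2)[OF dif]]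
  have sub: "?g ` points (mfd G) \<subseteq> points (mfd H)" using diffeomorphismD(6)[OF dif] by blast
  have gq: "?g q \<in> points (mfd H)" using sub q by blast
  have Dg: "differential (mfd G) (mfd H) ?g q w \<in> tangent_space (mfd H) (?g q)"
    if "w \<in> tangent_space (mfd G) q" for w
    by (rule differential_in_tangent_space[OF GD(2) HD(2) go q that])
  have inv: "differential (mfd H) (mfd G) \<phi> (?g q) (differential (mfd G) (mfd H) ?g q w) = w"
    if w: "w \<in> tangent_space (mfd G) q" for w
  proof -
    have "differential (mfd H) (mfd G) \<phi> (?g q) (differential (mfd G) (mfd H) ?g q w) =
        differential (mfd G) (mfd G) (\<phi> \<circ> ?g) q w"
      by (rule differential_compose[OF GD(2) HD(2) GD(2) go \<phi>o sub q w, symmetric])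
    also have "\<dots> = differential (mfd G) (mfd G) id q w"
      by (rule differential_cong[OF GD(2) GD(2) smooth_map_on_compose[OF GD(2) HD(2) GD(2) go \<phi>o sub] _ q w])
        (simp add: F5)
    finally show ?thesis using differential_id[OF GD(2) q w] by simp
  qed
  have "pullback (mfd G) (mfd H) ?g \<alpha> q u v =
      pullback (mfd H) (mfd G) \<phi> \<beta> (?g q) (differential (mfd G) (mfd H) ?g q u) (differential (mfd G) (mfd H) ?g q v)"
    using P(3)[OF gq Dg[OF u] Dg[OF v]] by (simp add: pullback_def)
  also have "\<dots> = \<beta> q u v" by (simp add: pullback_def inv[OF u] inv[OF v] F5[OF q])
  finally show "pullback (mfd G) (mfd H) ?g \<alpha> q u v = \<beta> q u v" .
qed

section \<open>Transport of structure\<close>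

text \<open>The structures on the fibres are obtained from \<open>G\<close> by a homeomorphism \<open>f\<close>. The topology \<open>T\<close> is
  prescribed, since on a fibre it has to be the subspace topology of the total space; only charts and group operations
  are pulled back.\<close>

definition transport_chart :: "'e topology \<Rightarrow> ('e \<Rightarrow> 'g) \<Rightarrow> ('g, 'a) chart \<Rightarrow> ('e, 'a) chart" where
  "transport_chart T f c = (topspace T \<inter> f -` fst c, snd c \<circ> f)"

definition transport_manifold :: "'e topology \<Rightarrow> ('e \<Rightarrow> 'g) \<Rightarrow> ('g, 'a) manifold \<Rightarrow> ('e, 'a) manifold" where
  "transport_manifold T f X = \<lparr>base_top = T, atlas = transport_chart T f ` atlas X\<rparr>"

lemma transport_manifold_simps [simp]:
  "base_top (transport_manifold T f X) = T"
  "atlas (transport_manifold T f X) = transport_chart T f ` atlas X"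
  by (auto simp: transport_manifold_def)

context
  fixes T :: "'e topology" and f :: "'e \<Rightarrow> 'g" and X :: "('g, 'a::model_space) manifold"
  assumes X: "smooth_atlas X" and hom: "homeomorphic_map T (base_top X) f"
begin

lemma transport_bij: "bij_betw f (topspace T) (points X)"
  using hom by (auto simp: bij_betw_def homeomorphic_imp_surjective_map homeomorphic_imp_injective_map)

lemma transport_chart_inv:
  assumes "c \<in> atlas X" "x \<in> topspace T" "f x \<in> fst c"
  shows "chart_inv (transport_chart T f c) (snd c (f x)) = x"
proof -
  have "inj_on f (topspace T \<inter> f -` fst c)"
    using transport_bij by (auto simp: bij_betw_def intro: inj_on_subset)
  moreover have "inj_on (snd c) (f ` (topspace T \<inter> f -` fst c))"
    using is_chart_inj[OF atlas_chart[OF X assms(1)]] by (rule inj_on_subset) auto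
  ultimately have "inj_on (snd c \<circ> f) (topspace T \<inter> f -` fst c)" by (rule comp_inj_on)
  from inv_into_f_f[OF this, of x] assms show ?thesis by (simp add: chart_inv_def transport_chart_def)
qed

lemma transport_image:
  assumes "c \<in> atlas X"
  shows "(snd c \<circ> f) ` (topspace T \<inter> f -` fst c \<inter> f -` V) = snd c ` (fst c \<inter> V)"
proof -
  have "fst c \<subseteq> f ` topspace T"
    using atlas_subset_points[OF X assms] transport_bij by (auto simp: bij_betw_def)
  then have "f ` (topspace T \<inter> f -` fst c \<inter> f -` V) = fst c \<inter> V" by blast
  then show ?thesis by (metis image_comp)
qed

lemma transport_rep:
  assumes c: "c \<in> atlas X" and d: "d \<in> atlas X"
  shows "smooth_on (snd c ` (fst c \<inter> fst d)) (snd d \<circ> f \<circ> chart_inv (transport_chart T f c))"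
proof (rule smooth_on_cong[OF atlas_open_image[OF X c atlas_openin[OF X d]]])
  show "smooth_on (snd c ` (fst c \<inter> fst d)) (snd d \<circ> chart_inv c)"
    using X c d by (simp add: smooth_atlas_def)
  fix y assume "y \<in> snd c ` (fst c \<inter> fst d)"
  then obtain x where "x \<in> topspace T" "f x \<in> fst c" "y = snd c (f x)"
    unfolding transport_image[OF c, symmetric] by auto
  then show "(snd d \<circ> chart_inv c) y = (snd d \<circ> f \<circ> chart_inv (transport_chart T f c)) y"
    using transport_chart_inv[OF c] atlas_inv[OF X c] by simp
qed

lemma transport_smooth_atlas: "smooth_atlas (transport_manifold T f X)"
  unfolding smooth_atlas_def transport_manifold_simps
proof (intro conjI ballI; (elim imageE)?)
  fix c' c assume c': "c' = transport_chart T f c" and c: "c \<in> atlas X"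
  let ?U = "topspace T \<inter> f -` fst c"
  have cont: "continuous_map T (base_top X) f" using hom by (rule homeomorphic_imp_continuous_map)
  have "is_chart T (?U, snd c \<circ> f)"
  proof (rule is_chartI)
    show U: "openin T ?U"
      using openin_preimage_on[OF openin_topspace _ atlas_openin[OF X c], of T f] cont by simp
    show "inj_on (snd c \<circ> f) ?U"
      by (rule inj_on_inverseI[of _ "chart_inv (transport_chart T f c)"]) (simp add: transport_chart_inv[OF c])
    have "continuous_map (subtopology T ?U) (subtopology (base_top X) (fst c)) f"
      using cont by (auto simp: continuous_map_in_subtopology continuous_map_from_subtopology)
    then show "continuous_map (subtopology T ?U) euclidean (snd c \<circ> f)"
      by (rule continuous_map_compose[OF _ is_chart_continuous[OF atlas_chart[OF X c]]])
    fix W assume W: "openin T W" "W \<subseteq> ?U"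
    have "openin (base_top X) (f ` W)"
      using homeomorphic_map_openness[OF hom] W(1) openin_subset[OF W(1)] by blast
    moreover have "fst c \<inter> f ` W = f ` W" using W(2) by auto
    ultimately show "open ((snd c \<circ> f) ` W)"
      using atlas_open_image[OF X c, of "f ` W"] by (simp add: image_comp)
  qed
  then show "is_chart T c'" by (simp add: c' transport_chart_def)
next
  fix c' d' c d assume c: "c \<in> atlas X" "c' = transport_chart T f c" and d: "d \<in> atlas X" "d' = transport_chart T f d"
  have eq: "fst c' \<inter> fst d' = topspace T \<inter> f -` fst c \<inter> f -` fst d" by (auto simp: c d transport_chart_def)
  show "smooth_on (snd c' ` (fst c' \<inter> fst d')) (snd d' \<circ> chart_inv c')"
    unfolding eq using transport_image[OF c(1), of "fst d"] transport_rep[OF c(1) d(1)]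
    by (simp add: c(2) d(2) transport_chart_def[of T f d] transport_chart_def[of T f c, THEN arg_cong, of snd] o_assoc)
next
  have "(\<Union>c\<in>atlas X. fst c) = points X" using X by (simp add: smooth_atlas_def)
  moreover have "f ` topspace T = points X" using transport_bij by (simp add: bij_betw_def)
  moreover have "(\<Union>c\<in>transport_chart T f ` atlas X. fst c) = topspace T \<inter> f -` (\<Union>c\<in>atlas X. fst c)"
    by (auto simp: transport_chart_def)
  ultimately show "(\<Union>c\<in>transport_chart T f ` atlas X. fst c) = topspace T" by auto
qed

lemma transport_diffeomorphism: "diffeomorphism (transport_manifold T f X) X f"
proof -
  have bij: "bij_betw f (topspace T) (points X)" by (rule transport_bij)
  let ?g = "inv_into (topspace T) f"
  have gf: "?g (f x) = x" if "x \<in> topspace T" for x using bij that by (rule bij_betw_inv_into_left)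
  have fg: "f (?g y) = y" "?g y \<in> topspace T" if "y \<in> points X" for y
    using bij that by (auto simp: bij_betw_inv_into_right dest: bij_betw_inv_into bij_betwE)
  have 1: "smooth_map (transport_manifold T f X) X f"
    unfolding smooth_map_def transport_manifold_simps
  proof (intro conjI ballI; (elim imageE)?)
    show "continuous_map T (base_top X) f" using hom by (rule homeomorphic_imp_continuous_map)
    fix c' c d assume c: "c \<in> atlas X" "c' = transport_chart T f c" and d: "d \<in> atlas X"
    show "smooth_on (snd c' ` (fst c' \<inter> f -` fst d)) (snd d \<circ> f \<circ> chart_inv c')"
      using transport_image[OF c(1), of "fst d"] transport_rep[OF c(1) d]
      by (simp add: c(2) transport_chart_def[of T f c, THEN arg_cong, of snd] transport_chart_def[of T f c, THEN arg_cong, of fst])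
  qed
  have 2: "smooth_map X (transport_manifold T f X) ?g"
    unfolding smooth_map_def transport_manifold_simps
  proof (intro conjI ballI; (elim imageE)?)
    obtain h where h: "homeomorphic_maps T (base_top X) f h" using hom by (auto simp: homeomorphic_map_maps)
    have "h y = ?g y" if "y \<in> points X" for y
      using h that bij by (intro inv_into_f_eq[symmetric]) (auto simp: homeomorphic_maps_def continuous_map_def bij_betw_def)
    then show "continuous_map (base_top X) T ?g"
      using h by (auto simp: homeomorphic_maps_def intro: continuous_map_eq)
    fix c d' d assume c: "c \<in> atlas X" and d: "d \<in> atlas X" "d' = transport_chart T f d"
    have "smooth_on (snd c ` (fst c \<inter> fst d)) (snd d \<circ> chart_inv c)"
      using X c d by (simp add: smooth_atlas_def)
    then have "smooth_on (snd c ` (fst c \<inter> fst d)) (snd d' \<circ> ?g \<circ> chart_inv c)"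
      by (rule smooth_on_cong[OF atlas_open_image[OF X c atlas_openin[OF X d(1)]], rotated])
        (use atlas_subset_points[OF X c] in \<open>auto simp: d(2) transport_chart_def atlas_inv[OF X c] fg\<close>)
    moreover have "fst c \<inter> ?g -` fst d' \<subseteq> fst c \<inter> fst d"
      using atlas_subset_points[OF X c] fg by (auto simp: d(2) transport_chart_def)
    ultimately show "smooth_on (snd c ` (fst c \<inter> ?g -` fst d')) (snd d' \<circ> ?g \<circ> chart_inv c)"
      by (meson smooth_on_subset image_mono)
  qed
  show ?thesis using bij 1 2 by (simp add: diffeomorphism_def)
qed

text \<open>Because the charts are themselves pulled back, a form and its pullback have the same coefficients in
  corresponding charts, hence the same exterior derivative there. This is how closedness passes to the fibres.\<close>

lemma transport_local_form:
  assumes eq: "equal_two_forms (transport_manifold T f X) \<alpha> (pullback (transport_manifold T f X) X f \<omega>)"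
    and c: "c \<in> atlas X" and y: "y \<in> snd c ` fst c"
  shows "local_form (transport_manifold T f X) \<alpha> (transport_chart T f c) y a b = local_form X \<omega> c y a b"
proof -
  let ?L = "transport_manifold T f X" and ?c = "transport_chart T f c"
  obtain z where z: "z \<in> topspace T" "f z \<in> fst c" "y = snd c (f z)"
    using y transport_image[OF c, of UNIV, simplified Int_UNIV_right vimage_UNIV, symmetric] by auto
  have cL: "?c \<in> charts_at ?L z" using z c by (simp add: charts_at_def transport_chart_def)
  have cX: "c \<in> charts_at X (f z)" using z c by (simp add: charts_at_def)
  note L = transport_smooth_atlas
  note fo = smooth_map_smooth_map_on[OF L diffeomorphismD(2)[OF transport_diffeomorphism]]
  have zL: "z \<in> points ?L" using z by simp
  have D: "differential ?L X f z (coord_vector ?L ?c z e) = coord_vector X c (f z) e" for e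
  proof (rule tangent_eqI[OF differential_in_tangent_space[OF L X fo zL coord_vector(1)[OF L cL]]
        coord_vector(1)[OF X cX] cX])
    have "differential ?L X f z (coord_vector ?L ?c z e) c =
        frechet_derivative (snd ?c \<circ> chart_inv ?c) (at (snd ?c z)) (coord_vector ?L ?c z e ?c)"
      using differential_apply[OF L fo zL coord_vector(1)[OF L cL] cL cX]
      by (simp add: transport_chart_def[of T f c, THEN arg_cong, of snd])
    also have "\<dots> = coord_vector ?L ?c z e ?c"
      by (rule tangent_spaceD[OF coord_vector(1)[OF L cL] cL cL, symmetric])
    finally show "differential ?L X f z (coord_vector ?L ?c z e) c = coord_vector X c (f z) e c"
      by (simp add: coord_vector(2)[OF L cL] coord_vector(2)[OF X cX])
  qed
  have inv: "chart_inv ?c y = z" "chart_inv c y = f z"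
    using z transport_chart_inv[OF c] atlas_inv[OF X c] by simp_all
  show ?thesis
    using eq zL coord_vector(1)[OF L cL]
    by (simp add: local_form_def Let_def inv equal_two_forms_def pullback_def D)
qed

lemma transport_symplectic_form:
  assumes eq: "equal_two_forms (transport_manifold T f X) \<alpha> (pullback (transport_manifold T f X) X f \<omega>)"
    and \<omega>: "symplectic_form X \<omega>"
  shows "symplectic_form (transport_manifold T f X) \<alpha>"
proof -
  let ?L = "transport_manifold T f X"
  note L = transport_smooth_atlas
  note fo = smooth_map_smooth_map_on[OF L diffeomorphismD(2)[OF transport_diffeomorphism]]
  have s: "smooth_two_form X \<omega>" and cl: "closed_two_form X \<omega>" and nd: "nondegenerate_two_form X \<omega>"
    using \<omega> by (auto simp: symplectic_form_def)
  have eq': "\<alpha> p u v = pullback ?L X f \<omega> p u v"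
    if "p \<in> topspace T" "u \<in> tangent_space ?L p" "v \<in> tangent_space ?L p" for p u v
    using eq that by (simp add: equal_two_forms_def)
  have "smooth_two_form ?L \<alpha>"
    unfolding smooth_section_Lambda2_dual_def
  proof (intro conjI ballI allI impI; (elim conjE)?)
    fix p assume p: "p \<in> points ?L"
    show "alternating_bilinear (tangent_space ?L p) (\<alpha> p)"
    proof (rule alternating_bilinear_pullback[OF L X fo p subset_refl])
      show "alternating_bilinear (tangent_space X (f p)) (\<omega> (f p))"
        using s smooth_map_on_image[OF fo p] by (simp add: smooth_section_Lambda2_dual_def)
    qed (use p eq' in \<open>simp_all add: tangent_space_linear[OF L]\<close>)
  next
    fix W A B
    assume W: "openin (base_top ?L) W" and A: "smooth_vector_field_on ?L W A" and B: "smooth_vector_field_on ?L W B"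
    have WT: "W \<subseteq> topspace T" using openin_subset[OF W] by simp
    have fW: "smooth_map_on ?L W X f" using smooth_map_on_subset[OF fo W] WT by simp
    show "smooth_function_on ?L W (\<lambda>p. \<alpha> p (A p) (B p))"
      by (rule smooth_function_on_cong[OF L W _ smooth_function_pullback[OF L X fW s A B]])
        (use A B WT eq' in \<open>auto simp: smooth_vector_field_on_def\<close>)
  qed
  moreover have "closed_two_form ?L \<alpha>"
    unfolding closed_two_form_def transport_manifold_simps
  proof (intro ballI allI; (elim imageE)?)
    fix c' c x z a b e
    assume c: "c \<in> atlas X" "c' = transport_chart T f c" and x: "x = snd c' z" "z \<in> fst c'"
    have x: "x \<in> snd c ` fst c" using x by (auto simp: c transport_chart_def)
    have op: "open (snd c ` fst c)" using atlas_open_image[OF X c(1) atlas_openin[OF X c(1)]] by simp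
    have "frechet_derivative (\<lambda>y. local_form ?L \<alpha> c' y a b) (at x) = frechet_derivative (\<lambda>y. local_form X \<omega> c y a b) (at x)" for a b
    proof (rule frechet_derivative_transform_within_open[OF _ op x, symmetric])
      show "(\<lambda>y. local_form X \<omega> c y a b) differentiable at x"
        using smooth_on_has_derivative[OF smooth_local_form[OF X c(1) s] x] by (auto simp: differentiable_def)
    qed (simp add: c(2) transport_local_form[OF eq c(1)])
    moreover have "local_exterior_derivative X \<omega> c x a b e = 0"
      using cl c(1) x unfolding closed_two_form_def by blast
    ultimately show "local_exterior_derivative ?L \<alpha> c' x a b e = 0"
      by (simp add: local_exterior_derivative_def)
  qed
  moreover have "nondegenerate_two_form ?L \<alpha>"
    using nondegenerate_pullback[OF L X transport_diffeomorphism nd] eq'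
    by (simp add: nondegenerate_two_form_def)
  ultimately show ?thesis by (simp add: symplectic_form_def)
qed

end

definition transport_lie_group :: "'e topology \<Rightarrow> ('e \<Rightarrow> 'g) \<Rightarrow> ('g, 'a) lie_group \<Rightarrow> ('e, 'a) lie_group" where
  "transport_lie_group T f G =
     \<lparr>carrier = topspace T, mult = (\<lambda>x y. inv_into (topspace T) f (f x \<otimes>\<^bsub>G\<^esub> f y)),
      one = inv_into (topspace T) f \<one>\<^bsub>G\<^esub>, mfd = transport_manifold T f (mfd G)\<rparr>"

lemma transport_lie_group_simps [simp]:
  "carrier (transport_lie_group T f G) = topspace T"
  "mult (transport_lie_group T f G) x y = inv_into (topspace T) f (f x \<otimes>\<^bsub>G\<^esub> f y)"
  "one (transport_lie_group T f G) = inv_into (topspace T) f \<one>\<^bsub>G\<^esub>"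
  "mfd (transport_lie_group T f G) = transport_manifold T f (mfd G)"
  by (auto simp: transport_lie_group_def)

lemma transport_lie_group:
  assumes G: "is_lie_group G" and hom: "homeomorphic_map T (base_top (mfd G)) f"
    and T: "Hausdorff_space T" "second_countable T"
  shows "is_lie_group (transport_lie_group T f G)" and "f \<in> lie_group_isos (transport_lie_group T f G) G"
proof -
  let ?H = "transport_lie_group T f G" and ?L = "transport_manifold T f (mfd G)" and ?g = "inv_into (topspace T) f"
  note GD = is_lie_groupD[OF G]
  interpret G: group G by (rule GD(1))
  note bij = transport_bij[OF GD(2) hom]
  note L = transport_smooth_atlas[OF GD(2) hom]
  note dif = transport_diffeomorphism[OF GD(2) hom]
  have f: "f x \<in> carrier G" "?g (f x) = x" if "x \<in> topspace T" for x
    using bij that GD(3) by (auto simp: bij_betw_inv_into_left dest: bij_betwE)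
  have g: "f (?g y) = y" "?g y \<in> topspace T" if "y \<in> carrier G" for y
    using bij that GD(3) by (auto simp: bij_betw_inv_into_right dest: bij_betw_inv_into bij_betwE)
  have grp: "group ?H"
  proof (rule groupI)
    show "\<exists>y\<in>carrier ?H. y \<otimes>\<^bsub>?H\<^esub> x = \<one>\<^bsub>?H\<^esub>" if "x \<in> carrier ?H" for x
      using that f g by (intro bexI[of _ "?g (inv\<^bsub>G\<^esub> f x)"]) auto
  qed (use f g in \<open>auto simp: G.m_assoc\<close>)
  interpret H: group ?H by (rule grp)
  have "f \<in> hom ?H G" using f g by (auto simp: hom_def)
  then show "f \<in> lie_group_isos ?H G"
    using bij dif GD(3) by (simp add: lie_group_isos_def iso_def)
  have fst: "smooth_map (product_manifold ?L ?L) ?L fst" and snd: "smooth_map (product_manifold ?L ?L) ?L snd"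
    by (rule smooth_map_fst[OF L L], rule smooth_map_snd[OF L L])
  note LL = smooth_atlas_product[OF L L] and GG = smooth_atlas_product[OF GD(2) GD(2)]
  note F = diffeomorphismD[OF dif]
  let ?ff = "\<lambda>z. ((f \<circ> fst) z, (f \<circ> snd) z)"
  have "smooth_map (product_manifold ?L ?L) (product_manifold (mfd G) (mfd G)) ?ff"
    by (rule smooth_map_Pair[OF LL GD(2) GD(2) smooth_map_compose[OF LL L GD(2) fst F(2)]
          smooth_map_compose[OF LL L GD(2) snd F(2)]])
  moreover have "smooth_map (product_manifold (mfd G) (mfd G)) (mfd G) (\<lambda>(x, y). x \<otimes>\<^bsub>G\<^esub> y)"
    using G by (simp add: is_lie_group_def)
  ultimately have "smooth_map (product_manifold ?L ?L) (mfd G) ((\<lambda>(x, y). x \<otimes>\<^bsub>G\<^esub> y) \<circ> ?ff)"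
    by (rule smooth_map_compose[OF LL GG GD(2)])
  then have "smooth_map (product_manifold ?L ?L) ?L (?g \<circ> ((\<lambda>(x, y). x \<otimes>\<^bsub>G\<^esub> y) \<circ> ?ff))"
    using F(3) by (intro smooth_map_compose[OF LL GD(2) L]) simp_all
  then have mult: "smooth_map (product_manifold ?L ?L) ?L (\<lambda>(x, y). x \<otimes>\<^bsub>?H\<^esub> y)"
    by (simp add: o_def split_def)
  have "smooth_map (mfd G) (mfd G) (\<lambda>x. inv\<^bsub>G\<^esub> x)" using G by (simp add: is_lie_group_def)
  then have "smooth_map ?L ?L (?g \<circ> ((\<lambda>x. inv\<^bsub>G\<^esub> x) \<circ> f))"
    using F(2,3) by (intro smooth_map_compose[OF L GD(2) L] smooth_map_compose[OF L GD(2) GD(2)]) simp_all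
  moreover have "(?g \<circ> ((\<lambda>x. inv\<^bsub>G\<^esub> x) \<circ> f)) x = inv\<^bsub>?H\<^esub> x" if "x \<in> points ?L" for x
    using that f g by (intro H.inv_equality[symmetric]) auto
  ultimately have inv: "smooth_map ?L ?L (\<lambda>x. inv\<^bsub>?H\<^esub> x)"
    by (rule smooth_map_cong[OF L L])
  show "is_lie_group ?H"
    using grp mult inv T L by (simp add: is_lie_group_def smooth_manifold_iff)
qed


section \<open>Local trivializations\<close>

lemma differential_const: "differential X Y (\<lambda>_. y) p v = (\<lambda>d. 0)"
  by (auto simp: differential_def Let_def o_def fun_eq_iff)

lemma product_charts_at:
  assumes c: "c \<in> charts_at X p" and d: "d \<in> charts_at Y q"
  shows "(fst c \<times> fst d, map_prod (snd c) (snd d)) \<in> charts_at (product_manifold X Y) (p, q)"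
proof -
  have "(fst c \<times> fst d, map_prod (snd c) (snd d)) \<in> atlas (product_manifold X Y)"
    unfolding product_manifold_simps using charts_atD(1)[OF c] charts_atD(1)[OF d] by blast
  then show ?thesis using charts_atD(2)[OF c] charts_atD(2)[OF d] by (simp add: charts_at_def)
qed

text \<open>In a product chart the differential of \<open>x \<mapsto> (f x, g x)\<close> has the differentials of \<open>f\<close> and \<open>g\<close> as its
  components; this splits tangent vectors of a trivialized bundle into a horizontal and a vertical part.\<close>

lemma differential_Pair:
  assumes X: "smooth_atlas X" and Y: "smooth_atlas Y" and Z: "smooth_atlas Z"
    and f: "smooth_map_on X W Y f" and g: "smooth_map_on X W Z g" and p: "p \<in> W"
    and v: "v \<in> tangent_space X p" and c: "c \<in> charts_at Y (f p)" and d: "d \<in> charts_at Z (g p)"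
  shows "differential X (product_manifold Y Z) (\<lambda>x. (f x, g x)) p v (fst c \<times> fst d, map_prod (snd c) (snd d)) =
    (differential X Y f p v c, differential X Z g p v d)"
proof -
  let ?e = "(fst c \<times> fst d, map_prod (snd c) (snd d))"
  obtain b where b: "b \<in> charts_at X p"
    using atlas_cover[OF X] smooth_map_on_subset_points[OF f] p by blast
  have e: "?e \<in> charts_at (product_manifold Y Z) (f p, g p)" by (rule product_charts_at[OF c d])
  have "(snd ?e \<circ> (\<lambda>x. (f x, g x)) \<circ> chart_inv b) =
      (\<lambda>x. ((snd c \<circ> f \<circ> chart_inv b) x, (snd d \<circ> g \<circ> chart_inv b) x))" by auto
  then have "((snd ?e \<circ> (\<lambda>x. (f x, g x)) \<circ> chart_inv b) has_derivative
      (\<lambda>a. (frechet_derivative (snd c \<circ> f \<circ> chart_inv b) (at (snd b p)) a,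
            frechet_derivative (snd d \<circ> g \<circ> chart_inv b) (at (snd b p)) a))) (at (snd b p))"
    using has_derivative_Pair[OF smooth_map_on_rep_has_derivative[OF f p b c]
        smooth_map_on_rep_has_derivative[OF g p b d]] by simp
  from frechet_derivative_at[OF this, symmetric] show ?thesis
    using differential_apply[OF X smooth_map_on_Pair[OF X Y Z f g] p v b e]
      differential_apply[OF X f p v b c] differential_apply[OF X g p v b d] by simp
qed

definition over :: "('e, 'c) manifold \<Rightarrow> ('e \<Rightarrow> 'm) \<Rightarrow> 'm set \<Rightarrow> 'e set" where
  "over E \<pi> U = {x \<in> points E. \<pi> x \<in> U}"

definition triv_inv :: "('e, 'c) manifold \<Rightarrow> ('e \<Rightarrow> 'm) \<Rightarrow> 'm set \<Rightarrow> ('e \<Rightarrow> 'm \<times> 'g) \<Rightarrow> 'm \<Rightarrow> 'g \<Rightarrow> 'e" where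
  "triv_inv E \<pi> U \<psi> p g = inv_into (over E \<pi> U) \<psi> (p, g)"

context
  fixes E :: "('e, 'c::model_space) manifold" and \<pi> :: "'e \<Rightarrow> 'm"
    and M :: "('m, 'b::model_space) manifold" and F :: "('g, 'a::model_space) manifold"
    and U :: "'m set" and \<psi> :: "'e \<Rightarrow> 'm \<times> 'g"
  assumes E: "smooth_atlas E" and M: "smooth_atlas M" and F: "smooth_atlas F"
    and \<pi>: "smooth_map E M \<pi>" and triv: "local_trivialization E \<pi> M F U \<psi>"
begin

lemma triv_openin: "openin (base_top M) U"
  using triv by (simp add: local_trivialization_def)

lemma openin_over: "openin (base_top E) (over E \<pi> U)"
  using smooth_map_on_preimage[OF smooth_map_smooth_map_on[OF E \<pi>] triv_openin]
  by (simp add: over_def vimage_def Collect_conj_eq)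

lemma triv_base_atlas: "smooth_atlas (open_submanifold M U)"
  by (rule smooth_atlas_open_submanifold[OF M triv_openin])

lemma triv_total_atlas: "smooth_atlas (open_submanifold E (over E \<pi> U))"
  by (rule smooth_atlas_open_submanifold[OF E openin_over])

lemma triv_product_atlas: "smooth_atlas (product_manifold (open_submanifold M U) F)"
  by (rule smooth_atlas_product[OF triv_base_atlas F])

lemma triv_diffeomorphism:
  "diffeomorphism (open_submanifold E (over E \<pi> U)) (product_manifold (open_submanifold M U) F) \<psi>"
  using triv by (simp add: local_trivialization_def over_def)

lemma triv_points:
  "points (open_submanifold E (over E \<pi> U)) = over E \<pi> U"
  "points (product_manifold (open_submanifold M U) F) = U \<times> points F"
  using openin_subset[OF triv_openin] by (auto simp: open_submanifold_simps product_manifold_simps over_def)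

lemma triv_apply: "x \<in> over E \<pi> U \<Longrightarrow> \<psi> x = (\<pi> x, fiber_coord \<psi> x)"
  using triv by (auto simp: local_trivialization_def over_def fiber_coord_def prod_eq_iff)

lemma triv_inv_apply:
  assumes "x \<in> over E \<pi> U"
  shows "triv_inv E \<pi> U \<psi> (\<pi> x) (fiber_coord \<psi> x) = x"
  using diffeomorphismD(4)[OF triv_diffeomorphism, of x] assms triv_apply[OF assms]
  by (simp add: triv_points triv_inv_def)

lemma triv_inv:
  assumes "p \<in> U" "g \<in> points F"
  shows "triv_inv E \<pi> U \<psi> p g \<in> over E \<pi> U" "\<pi> (triv_inv E \<pi> U \<psi> p g) = p"
    "fiber_coord \<psi> (triv_inv E \<pi> U \<psi> p g) = g" "triv_inv E \<pi> U \<psi> p g \<in> fiber E \<pi> p"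
proof -
  have pg: "(p, g) \<in> points (product_manifold (open_submanifold M U) F)"
    using assms by (simp add: triv_points)
  show 1: "triv_inv E \<pi> U \<psi> p g \<in> over E \<pi> U"
    using diffeomorphismD(7)[OF triv_diffeomorphism pg] by (simp add: triv_points triv_inv_def)
  have "\<psi> (triv_inv E \<pi> U \<psi> p g) = (p, g)"
    using diffeomorphismD(5)[OF triv_diffeomorphism pg] by (simp add: triv_points triv_inv_def)
  then show "\<pi> (triv_inv E \<pi> U \<psi> p g) = p" "fiber_coord \<psi> (triv_inv E \<pi> U \<psi> p g) = g"
    using triv_apply[OF 1] by auto
  then show "triv_inv E \<pi> U \<psi> p g \<in> fiber E \<pi> p" using 1 by (simp add: fiber_def over_def)
qed

lemma fiber_over: "p \<in> U \<Longrightarrow> fiber E \<pi> p \<subseteq> over E \<pi> U"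
  by (auto simp: fiber_def over_def)

lemma smooth_fiber_coord: "smooth_map_on E (over E \<pi> U) F (fiber_coord \<psi>)"
proof -
  have "smooth_map (open_submanifold E (over E \<pi> U)) F (snd \<circ> \<psi>)"
    by (rule smooth_map_compose[OF triv_total_atlas triv_product_atlas F diffeomorphismD(2)[OF triv_diffeomorphism]
          smooth_map_snd[OF triv_base_atlas F]])
  then show ?thesis
    by (simp add: smooth_map_open_submanifold_iff[OF E F openin_over] fiber_coord_def)
qed

lemma smooth_triv_inv_product:
  "smooth_map (product_manifold (open_submanifold M U) F) E (\<lambda>z. triv_inv E \<pi> U \<psi> (fst z) (snd z))"
proof -
  have id: "smooth_map (open_submanifold E (over E \<pi> U)) E id"
    using smooth_map_on_id[OF E openin_over] by (simp add: smooth_map_open_submanifold_iff[OF E E openin_over])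
  have "smooth_map (product_manifold (open_submanifold M U) F) E (id \<circ> inv_into (over E \<pi> U) \<psi>)"
    by (rule smooth_map_compose[OF triv_product_atlas triv_total_atlas E
          diffeomorphismD(3)[OF triv_diffeomorphism, unfolded triv_points] id])
  then show ?thesis by (simp add: triv_inv_def o_def)
qed

lemma smooth_Pair_fiber:
  assumes "p \<in> U"
  shows "smooth_map_on F (points F) (product_manifold (open_submanifold M U) F) (\<lambda>g. (p, id g))"
  using assms openin_subset[OF triv_openin]
  by (intro smooth_map_on_Pair[OF F triv_base_atlas F] smooth_map_on_const[OF F] smooth_map_on_id[OF F])
    (auto simp: open_submanifold_simps)

lemma smooth_triv_inv:
  assumes "p \<in> U"
  shows "smooth_map F E (triv_inv E \<pi> U \<psi> p)"
proof -
  have "smooth_map F (product_manifold (open_submanifold M U) F) (\<lambda>g. (p, id g))"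
    using smooth_Pair_fiber[OF assms] by (simp add: smooth_map_on_points[OF F])
  from smooth_map_compose[OF F triv_product_atlas E this smooth_triv_inv_product]
  show ?thesis by (simp add: o_def)
qed

text \<open>The homeomorphism along which \<open>G\<close> is transported to a fibre; its inverse is \<open>g \<mapsto> \<psi>\<^sup>-\<^sup>1 (p, g)\<close>.\<close>

lemma homeomorphic_fiber_coord:
  assumes p: "p \<in> U"
  shows "homeomorphic_map (subtopology (base_top E) (fiber E \<pi> p)) (base_top F) (fiber_coord \<psi>)"
proof -
  have "continuous_map (subtopology (base_top E) (fiber E \<pi> p)) (base_top F) (fiber_coord \<psi>)"
    using smooth_fiber_coord fiber_over[OF p]
    by (auto simp: smooth_map_on_def intro: continuous_map_from_subtopology_mono)
  moreover have "continuous_map (base_top F) (subtopology (base_top E) (fiber E \<pi> p)) (triv_inv E \<pi> U \<psi> p)"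
    using smooth_triv_inv[OF p] triv_inv(4)[OF p] by (auto simp: smooth_map_def continuous_map_in_subtopology)
  moreover have "triv_inv E \<pi> U \<psi> p (fiber_coord \<psi> x) = x" if "x \<in> fiber E \<pi> p" for x
    using triv_inv_apply[of x] that fiber_over[OF p] by (auto simp: fiber_def)
  ultimately have "homeomorphic_maps (subtopology (base_top E) (fiber E \<pi> p)) (base_top F)
      (fiber_coord \<psi>) (triv_inv E \<pi> U \<psi> p)"
    using triv_inv(3)[OF p] by (auto simp: homeomorphic_maps_def)
  then show ?thesis by (auto simp: homeomorphic_maps_map)
qed

text \<open>A vertical vector is tangent to its fibre: in the trivialization it has the coordinates \<open>(0, w)\<close>, and these
  are also the coordinates of the image of \<open>w\<close> under the inclusion of \<open>{p} \<times> F\<close>.\<close>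

lemma vertical_tangent_fiber:
  assumes x: "x \<in> over E \<pi> U" and v: "v \<in> vertical_space E \<pi> M x"
  shows "differential F E (triv_inv E \<pi> U \<psi> (\<pi> x)) (fiber_coord \<psi> x)
      (differential E F (fiber_coord \<psi>) x v) = v"
proof -
  let ?W = "over E \<pi> U" and ?B = "open_submanifold M U" and ?p = "\<pi> x" and ?g = "fiber_coord \<psi> x"
  let ?P = "product_manifold ?B F"
  let ?K = "\<lambda>z. triv_inv E \<pi> U \<psi> (fst z) (snd z)" and ?h = "\<lambda>y. (\<pi> y, fiber_coord \<psi> y)"
    and ?i = "\<lambda>g. (?p, id g)"
  have v': "v \<in> tangent_space E x" and dv: "differential E M \<pi> x v = (\<lambda>d. 0)"
    using v by (auto simp: vertical_space_def)
  have p: "?p \<in> U" and xE: "x \<in> points E" using x by (auto simp: over_def)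
  have g: "?g \<in> points F" by (rule smooth_map_on_image[OF smooth_fiber_coord x])
  note P = triv_product_atlas and B = triv_base_atlas and fc = smooth_fiber_coord
  have \<pi>B: "smooth_map_on E ?W ?B \<pi>"
    by (rule smooth_map_on_into_open_submanifold[OF E M smooth_map_on_smooth_map[OF E M \<pi> openin_over]])
      (auto simp: over_def)
  have h: "smooth_map_on E ?W ?P ?h" by (rule smooth_map_on_Pair[OF E B F \<pi>B fc])
  note i = smooth_Pair_fiber[OF p]
  have K: "smooth_map_on ?P (U \<times> points F) E ?K"
    using smooth_triv_inv_product smooth_map_on_points[OF P, of E ?K] by (simp add: triv_points)
  have hW: "?h ` ?W \<subseteq> U \<times> points F" using smooth_map_on_image[OF fc] by (auto simp: over_def)
  have iF: "?i ` points F \<subseteq> U \<times> points F" using p by auto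
  let ?w = "differential E F (fiber_coord \<psi>) x v"
  have w: "?w \<in> tangent_space F ?g" by (rule differential_in_tangent_space[OF E F fc x v'])
  have const: "smooth_map_on F (points F) ?B (\<lambda>_. ?p)"
    using p openin_subset[OF triv_openin] by (intro smooth_map_on_const[OF F]) (auto simp: open_submanifold_simps)
  have hi: "differential E ?P ?h x v = differential F ?P ?i ?g ?w"
  proof -
    obtain m where m: "m \<in> charts_at M ?p"
      using atlas_cover[OF M] p openin_subset[OF triv_openin] by blast
    obtain d where d: "d \<in> charts_at F ?g" using atlas_cover[OF F g] by blast
    let ?m = "(fst m \<inter> U, snd m)"
    have m': "?m \<in> charts_at ?B ?p" using m p by (auto simp: charts_at_def open_submanifold_simps)
    let ?e = "(fst ?m \<times> fst d, map_prod (snd ?m) (snd d))"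
    have e: "?e \<in> charts_at ?P (?p, ?g)" by (rule product_charts_at[OF m' d])
    have "differential E ?B \<pi> x v ?m = differential E M \<pi> x v m"
      using m m' by (simp add: differential_def Let_def)
    then have 1: "differential E ?P ?h x v ?e = (0, ?w d)"
      using differential_Pair[OF E B F \<pi>B fc x v' m' d] dv by simp
    have d': "d \<in> charts_at F (id ?g)" using d by simp
    have 2: "differential F ?P ?i ?g ?w ?e = (0, ?w d)"
      using differential_Pair[OF F B F const smooth_map_on_id[OF F openin_topspace] g w m' d'] differential_id[OF F g w]
      by (simp add: differential_const id_def)
    show ?thesis
    proof (rule tangent_eqI[OF _ _ e])
      show "differential E ?P ?h x v \<in> tangent_space ?P (?p, ?g)"
        using differential_in_tangent_space[OF E P h x v'] by simp
      show "differential F ?P ?i ?g ?w \<in> tangent_space ?P (?p, ?g)"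
        using differential_in_tangent_space[OF F P i g w] by simp
    qed (simp only: 1 2)
  qed
  have "differential F E (triv_inv E \<pi> U \<psi> ?p) ?g ?w = differential F E (?K \<circ> ?i) ?g ?w"
    by (simp add: o_def)
  also have "\<dots> = differential ?P E ?K (?p, ?g) (differential F ?P ?i ?g ?w)"
    using differential_compose[OF F P E i K iF g w] by simp
  also have "\<dots> = differential ?P E ?K (?h x) (differential E ?P ?h x v)" by (simp only: hi)
  also have "\<dots> = differential E E (?K \<circ> ?h) x v"
    by (rule differential_compose[OF E P E h K hW x v', symmetric])
  also have "\<dots> = differential E E id x v"
    by (rule differential_cong[OF E E smooth_map_on_compose[OF E P E h K hW] _ x v']) (simp add: triv_inv_apply)
  also have "\<dots> = v" by (rule differential_id[OF E xE v'])
  finally show ?thesis .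
qed

end

section \<open>Transition functions\<close>

lemma inv_into_fiber_coord:
  assumes "smooth_atlas E" "smooth_atlas M" "smooth_atlas F" "smooth_map E M \<pi>"
    and "local_trivialization E \<pi> M F U \<psi>" and "p \<in> U" "g \<in> points F"
  shows "inv_into (fiber E \<pi> p) (fiber_coord \<psi>) g = triv_inv E \<pi> U \<psi> p g"
proof (rule inv_into_f_eq)
  show "inj_on (fiber_coord \<psi>) (fiber E \<pi> p)"
    using homeomorphic_imp_injective_map[OF homeomorphic_fiber_coord[OF assms(1-6)]]
    by (simp add: fiber_def Int_def)
qed (use triv_inv[OF assms] in auto)

text \<open>Let \<open>\<sigma>\<close> be the inclusion \<open>g \<mapsto> \<psi>\<^sup>-\<^sup>1 (p, g)\<close> of the fibre through \<open>x\<close> and \<open>\<tau>\<close> the transition. A vertical \<open>w\<close> equals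
  \<open>d\<sigma> (d\<psi>\<^sub>p w)\<close>, and \<open>\<psi>'\<^sub>p \<circ> \<sigma> = \<tau>\<close>, so the image of \<open>w\<close> under the second fibre coordinate is \<open>d\<tau>\<close> of its
  image under the first. Since \<open>\<tau>\<close> preserves \<open>\<omega>\<close>, the two pullbacks agree on vertical vectors.\<close>

lemma pullback_transition:
  assumes E: "smooth_atlas E" and M: "smooth_atlas M" and F: "smooth_atlas (mfd G)" and \<pi>: "smooth_map E M \<pi>"
    and triv: "local_trivialization E \<pi> M (mfd G) U \<psi>" and triv': "local_trivialization E \<pi> M (mfd G) V \<psi>'"
    and x: "x \<in> points E" "\<pi> x \<in> U" "\<pi> x \<in> V"
    and \<tau>: "transition E \<pi> \<psi> \<psi>' (\<pi> x) \<in> Aut_symplectic G \<omega>"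
    and u: "u \<in> vertical_space E \<pi> M x" and v: "v \<in> vertical_space E \<pi> M x"
  shows "pullback E (mfd G) (fiber_coord \<psi>') \<omega> x u v = pullback E (mfd G) (fiber_coord \<psi>) \<omega> x u v"
proof -
  let ?fc = "fiber_coord \<psi>" and ?fc' = "fiber_coord \<psi>'" and ?\<tau> = "transition E \<pi> \<psi> \<psi>' (\<pi> x)"
    and ?\<sigma> = "triv_inv E \<pi> U \<psi> (\<pi> x)" and ?F = "mfd G"
  note A = E M F \<pi> triv and A' = E M F \<pi> triv'
  have xU: "x \<in> over E \<pi> U" using x by (auto simp: over_def)
  have g: "?fc x \<in> points ?F" by (rule smooth_map_on_image[OF smooth_fiber_coord[OF A] xU])
  have \<sigma>: "smooth_map_on ?F (points ?F) E ?\<sigma>"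
    by (rule smooth_map_smooth_map_on[OF F smooth_triv_inv[OF A x(2)]])
  have \<sigma>V: "?\<sigma> ` points ?F \<subseteq> over E \<pi> V"
    using triv_inv(4)[OF A x(2)] x(3) by (auto simp: fiber_def over_def)
  have \<sigma>x: "?\<sigma> (?fc x) = x" by (rule triv_inv_apply[OF A xU])
  have eq: "(?fc' \<circ> ?\<sigma>) h = ?\<tau> h" if "h \<in> points ?F" for h
    using inv_into_fiber_coord[OF A x(2) that] by (simp add: transition_def)
  have D: "differential E ?F ?fc' x w = differential ?F ?F ?\<tau> (?fc x) (differential E ?F ?fc x w)"
    if w: "w \<in> vertical_space E \<pi> M x" for w
  proof -
    let ?w = "differential E ?F ?fc x w"
    have w': "?w \<in> tangent_space ?F (?fc x)"
      using differential_in_tangent_space[OF E F smooth_fiber_coord[OF A] xU] w by (simp add: vertical_space_def)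
    have "differential E ?F ?fc' x w = differential E ?F ?fc' (?\<sigma> (?fc x)) (differential ?F E ?\<sigma> (?fc x) ?w)"
      by (simp add: vertical_tangent_fiber[OF A xU w] \<sigma>x)
    also have "\<dots> = differential ?F ?F (?fc' \<circ> ?\<sigma>) (?fc x) ?w"
      by (rule differential_compose[OF F E F \<sigma> smooth_fiber_coord[OF A'] \<sigma>V g w', symmetric])
    also have "\<dots> = differential ?F ?F ?\<tau> (?fc x) ?w"
      by (rule differential_cong[OF F F smooth_map_on_compose[OF F E F \<sigma> smooth_fiber_coord[OF A'] \<sigma>V] eq g w'])
    finally show ?thesis .
  qed
  have mem: "differential E ?F ?fc x w \<in> tangent_space ?F (?fc x)" if "w \<in> vertical_space E \<pi> M x" for w
    using differential_in_tangent_space[OF E F smooth_fiber_coord[OF A] xU] that by (simp add: vertical_space_def)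
  have fx: "?fc' x = ?\<tau> (?fc x)" using eq[OF g] \<sigma>x by simp
  have "pullback E ?F ?fc' \<omega> x u v =
      pullback ?F ?F ?\<tau> \<omega> (?fc x) (differential E ?F ?fc x u) (differential E ?F ?fc x v)"
    by (simp add: pullback_def D[OF u] D[OF v] fx)
  also have "\<dots> = \<omega> (?fc x) (differential E ?F ?fc x u) (differential E ?F ?fc x v)"
    using \<tau> g mem[OF u] mem[OF v] by (simp add: Aut_symplectic_def equal_two_forms_def)
  finally show ?thesis by (simp add: pullback_def)
qed

lemma vertical_space_linear:
  assumes E: "smooth_atlas E" and \<pi>: "smooth_map E M \<pi>" and x: "x \<in> points E"
    and u: "u \<in> vertical_space E \<pi> M x" and v: "v \<in> vertical_space E \<pi> M x"
  shows "(\<lambda>c. r *\<^sub>R u c + s *\<^sub>R v c) \<in> vertical_space E \<pi> M x"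
  using u v tangent_space_linear[OF E x] differential_linear[OF E smooth_map_smooth_map_on[OF E \<pi>] x]
  by (simp add: vertical_space_def)


section \<open>Symplectic Lie group bundles\<close>

lemma transition_symplectic_of_bundle:
  assumes B: "symplectic_lie_group_bundle G \<omega> E \<pi> M L \<omega>'"
  shows "\<exists>\<Psi>. trivialization_system E \<pi> M (mfd G) \<Psi> \<and>
    (\<forall>(U, \<psi>)\<in>\<Psi>. \<forall>(V, \<psi>')\<in>\<Psi>. \<forall>p\<in>U \<inter> V. transition E \<pi> \<psi> \<psi>' p \<in> Aut_symplectic G \<omega>)"
proof -
  obtain \<Psi> where \<Psi>: "trivialization_system E \<pi> M (mfd G) \<Psi>"
    and iso: "\<And>U \<psi> p. (U, \<psi>) \<in> \<Psi> \<Longrightarrow> p \<in> U \<Longrightarrow>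
      fiber_coord \<psi> \<in> symplectic_lie_group_isos (L p) (fiber_form E (L p) \<omega>') G \<omega>"
    using B unfolding symplectic_lie_group_bundle_def by blast
  have G: "is_lie_group G"
    using B by (simp add: symplectic_lie_group_bundle_def symplectic_lie_group_def)
  have "transition E \<pi> \<psi> \<psi>' p \<in> Aut_symplectic G \<omega>"
    if a: "(U, \<psi>) \<in> \<Psi>" "p \<in> U" and b: "(V, \<psi>') \<in> \<Psi>" "p \<in> V" for U \<psi> V \<psi>' p
  proof -
    have "p \<in> points M" using \<Psi> a unfolding trivialization_system_def by blast
    then have L: "is_lie_group (L p)" "carrier (L p) = fiber E \<pi> p"
      using B by (auto simp: symplectic_lie_group_bundle_def)
    show ?thesis
      unfolding transition_def Aut_symplectic_eq L(2)[symmetric]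
      by (rule symplectic_lie_group_isos_compose[OF G L(1) G symplectic_lie_group_isos_inv[OF L(1) G iso[OF a]] iso[OF b]])
  qed
  then show ?thesis using \<Psi> by blast
qed

text \<open>Each fibre is given the structure transported along one chosen trivialization. All trivializations of the system
  then are isomorphisms onto \<open>(G, \<omega>)\<close>, as they differ from the chosen one by automorphisms of \<open>(G, \<omega>)\<close>.\<close>

lemma bundle_of_symplectic_transitions:
  fixes G :: "('g, 'a::model_space) lie_group" and E :: "('e, 'c::model_space) manifold"
    and M :: "('m, 'b::model_space) manifold" and \<pi> :: "'e \<Rightarrow> 'm"
  assumes G\<omega>: "symplectic_lie_group G \<omega>" and fb: "smooth_fiber_bundle E \<pi> M (mfd G)"
    and \<Psi>: "trivialization_system E \<pi> M (mfd G) \<Psi>"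
    and trans: "\<And>U \<psi> V \<psi>' p. (U, \<psi>) \<in> \<Psi> \<Longrightarrow> (V, \<psi>') \<in> \<Psi> \<Longrightarrow> p \<in> U \<Longrightarrow> p \<in> V \<Longrightarrow>
      transition E \<pi> \<psi> \<psi>' p \<in> Aut_symplectic G \<omega>"
  shows "\<exists>L \<omega>'. symplectic_lie_group_bundle G \<omega> E \<pi> M L \<omega>'"
proof -
  have EM: "smooth_manifold E" "smooth_manifold M" and \<pi>: "smooth_map E M \<pi>"
    using fb by (auto simp: smooth_fiber_bundle_def)
  note E = smooth_manifold_atlas[OF EM(1)] and M = smooth_manifold_atlas[OF EM(2)]
  have G: "is_lie_group G" and \<omega>: "symplectic_form (mfd G) \<omega>" and left: "left_invariant G \<omega>"
    using G\<omega> by (auto simp: symplectic_lie_group_def)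
  note GD = is_lie_groupD[OF G]
  note F = GD(2)
  have triv: "local_trivialization E \<pi> M (mfd G) U \<psi>" if "(U, \<psi>) \<in> \<Psi>" for U \<psi>
    using \<Psi> that by (auto simp: trivialization_system_def)
  have "\<exists>U \<psi>. (U, \<psi>) \<in> \<Psi> \<and> p \<in> U" if "p \<in> points M" for p
    using \<Psi> that unfolding trivialization_system_def by blast
  then obtain nbhd \<kappa> where \<kappa>: "\<And>p. p \<in> points M \<Longrightarrow> (nbhd p, \<kappa> p) \<in> \<Psi>" "\<And>p. p \<in> points M \<Longrightarrow> p \<in> nbhd p"
    by metis
  have \<pi>M: "\<pi> x \<in> points M" if "x \<in> points E" for x
    using smooth_map_on_image[OF smooth_map_smooth_map_on[OF E \<pi>] that] .
  define T where "T p = subtopology (base_top E) (fiber E \<pi> p)" for p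
  define L where "L p = transport_lie_group (T p) (fiber_coord (\<kappa> p)) G" for p
  define \<omega>' where "\<omega>' x = pullback E (mfd G) (fiber_coord (\<kappa> (\<pi> x))) \<omega> x" for x
  have topT: "topspace (T p) = fiber E \<pi> p" for p by (auto simp: T_def fiber_def)

  \<comment> \<open>The form is defined pointwise, with an unrelated choice over each base point; this identity allows it to be
    computed with a fixed trivialization on a whole neighbourhood.\<close>
  have \<omega>'_eq: "\<omega>' x u v = pullback E (mfd G) (fiber_coord \<psi>) \<omega> x u v"
    if "(U, \<psi>) \<in> \<Psi>" "x \<in> over E \<pi> U" "u \<in> vertical_space E \<pi> M x" "v \<in> vertical_space E \<pi> M x" for U \<psi> x u v
  proof -
    have x: "x \<in> points E" "\<pi> x \<in> U" using that(2) by (auto simp: over_def)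
    note c = \<kappa>[OF \<pi>M[OF x(1)]]
    show ?thesis unfolding \<omega>'_def
      by (rule pullback_transition[OF E M F \<pi> triv[OF that(1)] triv[OF c(1)] x(1,2) c(2)
            trans[OF that(1) c(1) x(2) c(2)] that(3,4)])
  qed
  have alt: "alternating_bilinear (vertical_space E \<pi> M x) (\<omega>' x)" if x: "x \<in> points E" for x
  proof -
    note c = \<kappa>[OF \<pi>M[OF x]]
    have xo: "x \<in> over E \<pi> (nbhd (\<pi> x))" using x c by (simp add: over_def)
    note fc = smooth_fiber_coord[OF E M F \<pi> triv[OF c(1)]]
    show ?thesis
    proof (rule alternating_bilinear_pullback[OF E F fc xo])
      show "alternating_bilinear (tangent_space (mfd G) (fiber_coord (\<kappa> (\<pi> x)) x)) (\<omega> (fiber_coord (\<kappa> (\<pi> x)) x))"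
        using \<omega> smooth_map_on_image[OF fc xo] by (simp add: symplectic_form_def smooth_section_Lambda2_dual_def)
      show "vertical_space E \<pi> M x \<subseteq> tangent_space E x" by (auto simp: vertical_space_def)
    qed (simp_all add: \<omega>'_def vertical_space_linear[OF E \<pi> x])
  qed
  have smooth: "smooth_section_Lambda2_dual E (vertical_space E \<pi> M) \<omega>'"
    unfolding smooth_section_Lambda2_dual_def
  proof (intro conjI ballI allI impI; (elim conjE)?)
    fix W A B
    assume W: "openin (base_top E) W" and A: "smooth_vector_field_on E W A" "\<forall>p\<in>W. A p \<in> vertical_space E \<pi> M p"
      and B: "smooth_vector_field_on E W B" "\<forall>p\<in>W. B p \<in> vertical_space E \<pi> M p"
    show "smooth_function_on E W (\<lambda>p. \<omega>' p (A p) (B p))"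
    proof (rule smooth_function_on_local[OF E])
      fix x assume x: "x \<in> W"
      then have xE: "x \<in> points E" using openin_subset[OF W] by blast
      note c = \<kappa>[OF \<pi>M[OF xE]]
      note t = triv[OF c(1)]
      let ?fc = "fiber_coord (\<kappa> (\<pi> x))" and ?N = "W \<inter> over E \<pi> (nbhd (\<pi> x))"
      have N: "openin (base_top E) ?N" by (rule openin_Int[OF W openin_over[OF E M F \<pi> t]])
      have fc: "smooth_map_on E ?N (mfd G) ?fc"
        by (rule smooth_map_on_subset[OF smooth_fiber_coord[OF E M F \<pi> t] N]) simp
      have "smooth_function_on E ?N (\<lambda>p. pullback E (mfd G) ?fc \<omega> p (A p) (B p))"
        using \<omega> by (intro smooth_function_pullback[OF E F fc] smooth_vector_field_on_subset[OF A(1)]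
            smooth_vector_field_on_subset[OF B(1)]) (auto simp: symplectic_form_def)
      then have "smooth_function_on E ?N (\<lambda>p. \<omega>' p (A p) (B p))"
        by (rule smooth_function_on_cong[OF E N, rotated]) (use A(2) B(2) \<omega>'_eq[OF c(1)] in auto)
      then show "\<exists>N. openin (base_top E) N \<and> x \<in> N \<and> smooth_function_on E N (\<lambda>p. \<omega>' p (A p) (B p))"
        using N x xE c(2) by (intro exI[of _ ?N]) (auto simp: over_def)
    qed
  qed (rule alt)

  have fibre: "is_lie_group (L p)" "carrier (L p) = fiber E \<pi> p" "embedded_submanifold (mfd (L p)) E"
    "symplectic_form (mfd (L p)) (fiber_form E (L p) \<omega>')" "left_invariant (L p) (fiber_form E (L p) \<omega>')"
    "\<And>U \<psi>. (U, \<psi>) \<in> \<Psi> \<Longrightarrow> p \<in> U \<Longrightarrow>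
      fiber_coord \<psi> \<in> symplectic_lie_group_isos (L p) (fiber_form E (L p) \<omega>') G \<omega>"
    if p: "p \<in> points M" for p
  proof -
    note c = \<kappa>[OF p]
    note t = triv[OF c(1)]
    let ?f = "fiber_coord (\<kappa> p)" and ?\<sigma> = "triv_inv E \<pi> (nbhd p) (\<kappa> p) p" and ?L = "mfd (L p)"
    have hom: "homeomorphic_map (T p) (base_top (mfd G)) ?f"
      unfolding T_def by (rule homeomorphic_fiber_coord[OF E M F \<pi> t c(2)])
    have T2: "Hausdorff_space (T p)" "second_countable (T p)"
      using EM(1) by (auto simp: T_def smooth_manifold_def Hausdorff_space_subtopology second_countable_subtopology)
    show Lp: "is_lie_group (L p)" unfolding L_def by (rule transport_lie_group(1)[OF G hom T2])
    have f_iso: "?f \<in> lie_group_isos (L p) G" unfolding L_def by (rule transport_lie_group(2)[OF G hom T2])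
    show carrier: "carrier (L p) = fiber E \<pi> p" by (simp add: L_def topT)
    have Lmfd: "?L = transport_manifold (T p) ?f (mfd G)" by (simp add: L_def)
    have Ltop: "base_top ?L = T p" and Lpts: "points ?L = fiber E \<pi> p" by (simp_all add: L_def topT)
    note LA = is_lie_groupD(2)[OF Lp]
    have dif: "diffeomorphism ?L (mfd G) ?f" by (rule lie_group_isosD(2)[OF f_iso])

    \<comment> \<open>In the coordinate \<open>?f\<close> on the fibre, the inclusion into the total space is \<open>g \<mapsto> \<psi>\<^sup>-\<^sup>1 (p, g)\<close>.\<close>
    have "smooth_map ?L E (?\<sigma> \<circ> ?f)"
      by (rule smooth_map_compose[OF LA F E diffeomorphismD(2)[OF dif] smooth_triv_inv[OF E M F \<pi> t c(2)]])
    moreover have "(?\<sigma> \<circ> ?f) x = id x" if "x \<in> points ?L" for x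
      using triv_inv_apply[OF E M F \<pi> t, of x] that c(2) by (auto simp: Lpts fiber_def over_def)
    ultimately have incl: "smooth_map ?L E id" by (rule smooth_map_cong[OF LA E])
    note io = smooth_map_smooth_map_on[OF LA incl]
    have iover: "id ` points ?L \<subseteq> over E \<pi> U" if "p \<in> U" for U
      using that by (auto simp: Lpts fiber_def over_def)
    \<comment> \<open>The projection is constant on the fibre.\<close>
    have ivert: "differential ?L E id x u \<in> vertical_space E \<pi> M x"
      if x: "x \<in> points ?L" and u: "u \<in> tangent_space ?L x" for x u
    proof -
      note \<pi>o = smooth_map_smooth_map_on[OF E \<pi>]
      have sub: "id ` points ?L \<subseteq> points E" by (auto simp: Lpts fiber_def)
      have "differential E M \<pi> (id x) (differential ?L E id x u) = differential ?L M (\<pi> \<circ> id) x u"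
        by (rule differential_compose[OF LA E M io \<pi>o sub x u, symmetric])
      also have "\<dots> = differential ?L M (\<lambda>_. p) x u"
        by (rule differential_cong[OF LA M smooth_map_on_compose[OF LA E M io \<pi>o sub] _ x u])
          (auto simp: Lpts fiber_def)
      finally show ?thesis
        using differential_in_tangent_space[OF LA E io x u] by (simp add: vertical_space_def differential_const)
    qed
    have form: "fiber_form E (L p) \<omega>' x u v = pullback ?L (mfd G) (fiber_coord \<psi>) \<omega> x u v"
      if a: "(U, \<psi>) \<in> \<Psi>" "p \<in> U" and x: "x \<in> points ?L"
        and u: "u \<in> tangent_space ?L x" and v: "v \<in> tangent_space ?L x" for U \<psi> x u v
    proof -
      have "fiber_form E (L p) \<omega>' x u v = pullback ?L E id (pullback E (mfd G) (fiber_coord \<psi>) \<omega>) x u v"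
        using \<omega>'_eq[OF a(1) _ ivert[OF x u] ivert[OF x v]] iover[OF a(2)] x
        by (auto simp: fiber_form_def pullback_def[of ?L])
      also have "\<dots> = pullback ?L (mfd G) (fiber_coord \<psi> \<circ> id) \<omega> x u v"
        by (rule pullback_compose[OF LA E F io smooth_fiber_coord[OF E M F \<pi> triv[OF a(1)]] iover[OF a(2)] x u v, symmetric])
      finally show ?thesis by simp
    qed
    have form_eq: "equal_two_forms ?L (fiber_form E (L p) \<omega>') (pullback ?L (mfd G) ?f \<omega>)"
      using form[OF c] by (simp add: equal_two_forms_def)
    show "symplectic_form ?L (fiber_form E (L p) \<omega>')"
      using transport_symplectic_form[OF F hom form_eq[unfolded Lmfd] \<omega>] by (simp only: Lmfd)
    show "left_invariant (L p) (fiber_form E (L p) \<omega>')"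
      by (rule left_invariant_pullback[OF Lp G f_iso left form_eq])
    show "embedded_submanifold ?L E"
      unfolding embedded_submanifold_def
    proof (intro conjI ballI inj_onI)
      show "smooth_manifold ?L" using Lp by (simp add: is_lie_group_def)
      show "points ?L \<subseteq> points E" by (auto simp: Lpts fiber_def)
      show "base_top ?L = subtopology (base_top E) (points ?L)" unfolding Lpts by (simp add: Ltop T_def)
      show "smooth_map ?L E id" by (rule incl)
      fix x u v assume x: "x \<in> points ?L" and u: "u \<in> tangent_space ?L x" and v: "v \<in> tangent_space ?L x"
        and eq: "differential ?L E id x u = differential ?L E id x v"
      \<comment> \<open>The inclusion is an immersion because the fibre coordinate, a diffeomorphism on the fibre, factors through it.\<close>
      have "differential ?L (mfd G) ?f x w = differential E (mfd G) ?f x (differential ?L E id x w)"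
        if "w \<in> tangent_space ?L x" for w
        using differential_compose[OF LA E F io smooth_fiber_coord[OF E M F \<pi> t] iover[OF c(2)] x that] by simp
      then have "differential ?L (mfd G) ?f x u = differential ?L (mfd G) ?f x v" using u v eq by simp
      then show "u = v"
        using diffeomorphism_differential_inverse[OF LA F dif x u]
          diffeomorphism_differential_inverse[OF LA F dif x v] by metis
    qed
    show "fiber_coord \<psi> \<in> symplectic_lie_group_isos (L p) (fiber_form E (L p) \<omega>') G \<omega>"
      if a: "(U, \<psi>) \<in> \<Psi>" "p \<in> U" for U \<psi>
    proof (rule symplectic_lie_group_isosI)
      let ?\<tau> = "transition E \<pi> (\<kappa> p) \<psi> p"
      have \<tau>: "?\<tau> \<in> lie_group_isos G G"
        using trans[OF c(1) a(1) c(2) a(2)] by (simp add: Aut_symplectic_def Aut_lie_group_def)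
      have inj: "inj_on ?f (fiber E \<pi> p)"
        using homeomorphic_imp_injective_map[OF hom] by (simp add: topT)
      have eq: "(?\<tau> \<circ> ?f) x = fiber_coord \<psi> x" if "x \<in> fiber E \<pi> p" for x
        using inv_into_f_f[OF inj that] by (simp add: transition_def)
      have comp: "?\<tau> \<circ> ?f \<in> iso (L p) G"
        by (rule iso_set_trans[OF lie_group_isosD(1)[OF f_iso] lie_group_isosD(1)[OF \<tau>]])
      have comp_hom: "?\<tau> \<circ> ?f \<in> hom (L p) G" and bij: "bij_betw (?\<tau> \<circ> ?f) (carrier (L p)) (carrier G)"
        using comp by (auto simp: iso_def)
      have eq': "fiber_coord \<psi> x = (?\<tau> \<circ> ?f) x" if "x \<in> carrier (L p)" for x
        using eq that carrier by simp
      interpret Lp: group "L p" by (rule is_lie_groupD(1)[OF Lp])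
      have "fiber_coord \<psi> \<in> hom (L p) G"
      proof (rule homI)
        fix x y assume x: "x \<in> carrier (L p)" and y: "y \<in> carrier (L p)"
        show "fiber_coord \<psi> x \<in> carrier G"
          unfolding eq'[OF x] by (rule hom_in_carrier[OF comp_hom x])
        show "fiber_coord \<psi> (x \<otimes>\<^bsub>L p\<^esub> y) = fiber_coord \<psi> x \<otimes>\<^bsub>G\<^esub> fiber_coord \<psi> y"
          unfolding eq'[OF x] eq'[OF y] eq'[OF Lp.m_closed[OF x y]] by (rule hom_mult[OF comp_hom x y])
      qed
      moreover have "bij_betw (fiber_coord \<psi>) (carrier (L p)) (carrier G)"
        using bij by (simp only: bij_betw_cong[of "carrier (L p)" "fiber_coord \<psi>" "?\<tau> \<circ> ?f" "carrier G", OF eq'])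
      ultimately show "fiber_coord \<psi> \<in> iso (L p) G" by (simp add: iso_def)
      show "diffeomorphism ?L (mfd G) (fiber_coord \<psi>)"
        by (rule diffeomorphism_cong[OF LA F diffeomorphism_compose[OF LA F F dif lie_group_isosD(2)[OF \<tau>]]])
          (use eq Lpts in blast)
    qed (use form[OF a] in simp)
  qed
  have "symplectic_lie_group_bundle G \<omega> E \<pi> M L \<omega>'"
    unfolding symplectic_lie_group_bundle_def
  proof (intro conjI ballI)
    show "\<exists>\<Psi>. trivialization_system E \<pi> M (mfd G) \<Psi> \<and>
        (\<forall>(U, \<psi>)\<in>\<Psi>. \<forall>p\<in>U. fiber_coord \<psi> \<in> symplectic_lie_group_isos (L p) (fiber_form E (L p) \<omega>') G \<omega>)"
    proof (intro exI[of _ \<Psi>] conjI \<Psi>; clarify)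
      fix U \<psi> p assume a: "(U, \<psi>) \<in> \<Psi>" "p \<in> U"
      then have "p \<in> points M" using \<Psi> unfolding trivialization_system_def by blast
      then show "fiber_coord \<psi> \<in> symplectic_lie_group_isos (L p) (fiber_form E (L p) \<omega>') G \<omega>"
        using fibre(6) a by blast
    qed
  qed (use G\<omega> fb smooth fibre(1-5) in auto)
  then show ?thesis by blast
qed

theorem theorem4p8:
  fixes G :: "('g, 'a::model_space) lie_group"
    and \<omega> :: "('g, 'a) two_form"
    and E :: "('e, 'c::model_space) manifold"
    and \<pi> :: "'e \<Rightarrow> 'm"
    and M :: "('m, 'b::model_space) manifold"
  assumes "symplectic_lie_group G \<omega>"
    and "connected_space (base_top (mfd G))"
    and "smooth_fiber_bundle E \<pi> M (mfd G)"
  shows "(\<exists>L \<omega>'. symplectic_lie_group_bundle G \<omega> E \<pi> M L \<omega>') \<longleftrightarrow>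
         (\<exists>\<Psi>. trivialization_system E \<pi> M (mfd G) \<Psi> \<and>
            (\<forall>(U, \<psi>)\<in>\<Psi>. \<forall>(V, \<psi>')\<in>\<Psi>. \<forall>p\<in>U \<inter> V. transition E \<pi> \<psi> \<psi>' p \<in> Aut_symplectic G \<omega>))"
proof
  assume "\<exists>L \<omega>'. symplectic_lie_group_bundle G \<omega> E \<pi> M L \<omega>'"
  then show "\<exists>\<Psi>. trivialization_system E \<pi> M (mfd G) \<Psi> \<and>
      (\<forall>(U, \<psi>)\<in>\<Psi>. \<forall>(V, \<psi>')\<in>\<Psi>. \<forall>p\<in>U \<inter> V. transition E \<pi> \<psi> \<psi>' p \<in> Aut_symplectic G \<omega>)"
    using transition_symplectic_of_bundle by blast
next
  assume "\<exists>\<Psi>. trivialization_system E \<pi> M (mfd G) \<Psi> \<and>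
      (\<forall>(U, \<psi>)\<in>\<Psi>. \<forall>(V, \<psi>')\<in>\<Psi>. \<forall>p\<in>U \<inter> V. transition E \<pi> \<psi> \<psi>' p \<in> Aut_symplectic G \<omega>)"
  then obtain \<Psi> where \<Psi>: "trivialization_system E \<pi> M (mfd G) \<Psi>"
    and trans: "\<forall>(U, \<psi>)\<in>\<Psi>. \<forall>(V, \<psi>')\<in>\<Psi>. \<forall>p\<in>U \<inter> V. transition E \<pi> \<psi> \<psi>' p \<in> Aut_symplectic G \<omega>"
    by blast
  show "\<exists>L \<omega>'. symplectic_lie_group_bundle G \<omega> E \<pi> M L \<omega>'"
    by (rule bundle_of_symplectic_transitions[OF assms(1,3) \<Psi>]) (use trans in blast)
qed

end
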